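(* Let $0<s<1$, $N>2s$, and let $\Omega\subset\mathbb{R}^N$ be a bounded domain of class $\mathcal{C}^{1,1}$, with $d(x)=\mathrm{dist}(x,\partial\Omega)$. Then for every $q\in(0,1)$ the problem $$ (-\Delta)^s u=\frac{u^q}{d^{2s}}\ \text{ in }\Omega,\qquad u>0\ \text{ in }\Omega,\qquad u=0\ \text{ in }\mathbb{R}^N\setminus\Omega, $$ has a distributional solution $u$. Moreover, there is a constant $C>0$ such that $u(x)\ge C\,d^s(x)$ in $\Omega$.
   Context: The fractional Laplacian is $(-\Delta)^s u(x)=a_{N,s}\,\mathrm{P.V.}\int_{\mathbb{R}^N}\frac{u(x)-u(y)}{|x-y|^{N+2s}}\,dy$, where $a_{N,s}>0$ is the normalization constant for which $(-\Delta)^s u=\mathcal{F}^{-1}(|\xi|^{2s}\mathcal{F}u)$ for all Schwartz functions $u$. Distributional solution: for $h\in L^1_{loc}(\Omega)$, a function $u\in L^1(\Omega)$ (extended by $u=0$ in $\mathbb{R}^N\setminus\Omega$) is a distributional solution of $(-\Delta)^s u=h$ in $\Omega$, $u=0$ in $\mathbb{R}^N\setminus\Omega$, if $\int_\Omega u\,(-\Delta)^s\psi\,dx=\int_\Omega h\,\psi\,dx$ for all $\psi\in\mathcal{C}^\infty_0(\Omega)$. For the problem in the claim, this is required with $h=u^q/d^{2s}\in L^1_{loc}(\Omega)$. Pointwise (in)equalities are understood almost everywhere. *)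

theory Defs
  imports "HOL-Analysis.Analysis"
begin

definition partial_deriv ::
    "'n \<Rightarrow> (real ^ 'n \<Rightarrow> 'b::real_normed_vector) \<Rightarrow> real ^ 'n \<Rightarrow> 'b" where
  "partial_deriv i f x = frechet_derivative f (at x) (axis i 1)"

primrec iter_partial_deriv ::
    "'n list \<Rightarrow> (real ^ 'n \<Rightarrow> 'b::real_normed_vector) \<Rightarrow> real ^ 'n \<Rightarrow> 'b" where
  "iter_partial_deriv [] f = f"
| "iter_partial_deriv (i # is) f = partial_deriv i (iter_partial_deriv is f)"

text \<open>Total differentiability of every iterated partial derivative also makes each of them
  continuous, so this is the class of functions that are infinitely often continuously
  differentiable.\<close>

definition smooth :: "(real ^ 'n \<Rightarrow> 'b::real_normed_vector) \<Rightarrow> bool" where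
  "smooth f \<longleftrightarrow> (\<forall>is x. iter_partial_deriv is f differentiable (at x))"

definition test_function :: "(real ^ 'n) set \<Rightarrow> (real ^ 'n \<Rightarrow> real) \<Rightarrow> bool" where
  "test_function \<Omega> \<psi> \<longleftrightarrow>
     smooth \<psi> \<and> compact (closure {x. \<psi> x \<noteq> 0}) \<and> closure {x. \<psi> x \<noteq> 0} \<subseteq> \<Omega>"

definition schwartz :: "(real ^ 'n \<Rightarrow> complex) \<Rightarrow> bool" where
  "schwartz f \<longleftrightarrow>
     smooth f \<and> (\<forall>k is. \<exists>C. \<forall>x. norm x ^ k * norm (iter_partial_deriv is f x) \<le> C)"

text \<open>The Fourier transform is taken in angular frequency; this is the convention in which
  the classical Laplacian \<open>-\<Delta>\<close> has symbol \<open>|\<xi>|\<^sup>2\<close>. How the factor \<open>(2\<pi>)\<^sup>N\<close> is split between the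
  transform and its inverse does not affect the operator with symbol \<open>|\<xi>|\<^sup>2\<^sup>s\<close>.\<close>

definition fourier :: "(real ^ 'n \<Rightarrow> complex) \<Rightarrow> real ^ 'n \<Rightarrow> complex" where
  "fourier f \<xi> = (LINT x|lborel. cis (- (x \<bullet> \<xi>)) * f x)"

definition inverse_fourier :: "(real ^ 'n \<Rightarrow> complex) \<Rightarrow> real ^ 'n \<Rightarrow> complex" where
  "inverse_fourier g x =
     (LINT \<xi>|lborel. cis (x \<bullet> \<xi>) * g \<xi>) /\<^sub>R (2 * pi) ^ CARD('n)"

definition pv_integral ::
    "real \<Rightarrow> (real ^ 'n \<Rightarrow> 'b::{banach, second_countable_topology}) \<Rightarrow> real ^ 'n \<Rightarrow> 'b" where
  "pv_integral s u x =
     Lim (at_right 0) (\<lambda>\<epsilon>. LINT y:(- ball x \<epsilon>)|lborel.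
       (u x - u y) /\<^sub>R norm (x - y) powr (real CARD('n) + 2 * s))"

definition frac_laplacian_const :: "'n::finite itself \<Rightarrow> real \<Rightarrow> real" where
  "frac_laplacian_const _ s =
     (THE a. a > 0 \<and>
        (\<forall>u :: real ^ 'n \<Rightarrow> complex. schwartz u \<longrightarrow>
           (\<forall>x. a *\<^sub>R pv_integral s u x =
              inverse_fourier (\<lambda>\<xi>. (norm \<xi> powr (2 * s)) *\<^sub>R fourier u \<xi>) x)))"

definition frac_laplacian :: "real \<Rightarrow> (real ^ 'n \<Rightarrow> real) \<Rightarrow> real ^ 'n \<Rightarrow> real" where
  "frac_laplacian s u x = frac_laplacian_const TYPE('n) s * pv_integral s u x"

text \<open>Here \<open>S\<close> is a linear subspace, and \<open>g\<close> is the gradient of \<open>\<gamma>\<close> along \<open>S\<close>.\<close>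

definition C11_on :: "(real ^ 'n) set \<Rightarrow> (real ^ 'n \<Rightarrow> real) \<Rightarrow> bool" where
  "C11_on S \<gamma> \<longleftrightarrow>
     (\<exists>g L. (\<forall>y\<in>S. g y \<in> S \<and> (\<gamma> has_derivative (\<lambda>h. g y \<bullet> h)) (at y within S)) \<and>
            L-lipschitz_on S g)"

text \<open>Near each boundary point the domain is the strict epigraph, in some unit direction \<open>e\<close>, of
  a \<open>C\<^sup>1\<^sup>,\<^sup>1\<close> function on the hyperplane orthogonal to \<open>e\<close>; \<open>x - (x \<bullet> e) *\<^sub>R e\<close> is the projection of
  \<open>x\<close> to that hyperplane. In dimension one the hyperplane is \<open>{0}\<close> and the domain is locally a
  half-line.\<close>

definition C11_domain :: "(real ^ 'n) set \<Rightarrow> bool" where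
  "C11_domain \<Omega> \<longleftrightarrow>
     open \<Omega> \<and> connected \<Omega> \<and> \<Omega> \<noteq> {} \<and>
     (\<forall>p\<in>frontier \<Omega>. \<exists>e r \<gamma>. norm e = 1 \<and> r > 0 \<and> C11_on {y. y \<bullet> e = 0} \<gamma> \<and>
        \<Omega> \<inter> ball p r = {x \<in> ball p r. \<gamma> (x - (x \<bullet> e) *\<^sub>R e) < x \<bullet> e})"

definition locally_integrable :: "(real ^ 'n) set \<Rightarrow> (real ^ 'n \<Rightarrow> real) \<Rightarrow> bool" where
  "locally_integrable \<Omega> h \<longleftrightarrow> (\<forall>K. compact K \<longrightarrow> K \<subseteq> \<Omega> \<longrightarrow> set_integrable lborel K h)"

definition distributional_solution ::
    "real \<Rightarrow> (real ^ 'n) set \<Rightarrow> (real ^ 'n \<Rightarrow> real) \<Rightarrow> (real ^ 'n \<Rightarrow> real) \<Rightarrow> bool" where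
  "distributional_solution s \<Omega> h u \<longleftrightarrow>
     locally_integrable \<Omega> h \<and> set_integrable lborel \<Omega> u \<and> (\<forall>x. x \<notin> \<Omega> \<longrightarrow> u x = 0) \<and>
     (\<forall>\<psi>. test_function \<Omega> \<psi> \<longrightarrow>
        (LINT x:\<Omega>|lborel. u x * frac_laplacian s \<psi> x) = (LINT x:\<Omega>|lborel. h x * \<psi> x))"

end

theory Submission
  imports Defs "HOL-Probability.Characteristic_Functions"
begin

text \<open>Write \<open>d\<close> for the distance to the boundary. The weight \<open>d\<^sup>-\<^sup>2\<^sup>s\<close> has the size of the fractional Laplacian of the indicator
function of \<open>\<Omega>\<close>: at \<open>x \<in> \<Omega>\<close> the latter is a constant times \<open>\<kappa>(x) = \<integral> |x - y|\<^bsup>-N-2s\<^esup> dy\<close>, integrated over the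
complement of \<open>\<Omega>\<close>. All points of the complement have distance at least \<open>d(x)\<close> from \<open>x\<close>, so \<open>\<kappa> \<le> C d\<^sup>-\<^sup>2\<^sup>s\<close>; and the
complement contains a ball of radius comparable with \<open>d(x)\<close> at a distance comparable with \<open>d(x)\<close>, so \<open>\<kappa> \<ge> c d\<^sup>-\<^sup>2\<^sup>s\<close>.
Since \<open>q < 1\<close>, a large constant \<open>m\<^sub>1\<close> on \<open>\<Omega>\<close>, extended by zero, is therefore a supersolution, and a small constant
\<open>m\<^sub>0 > 0\<close> is a subsolution. Monotone iteration between them produces a solution \<open>u\<close> with \<open>m\<^sub>0 \<le> u \<le> m\<^sub>1\<close> in \<open>\<Omega>\<close>. As \<open>d\<close>
is bounded in \<open>\<Omega>\<close>, this is stronger than the bound \<open>u \<ge> C d\<^sup>s\<close>. The two-sided estimate of \<open>\<kappa>\<close> is \<open>killing_bounds\<close>, and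
the iteration is \<open>green_iteration\<close>.

The iteration needs an order-preserving solution operator \<open>G\<close> for the linear problem with right-hand side \<open>d\<^sup>-\<^sup>2\<^sup>s w\<close>.
It is built by capping the kernel at \<open>|z| = \<delta>\<close> and the weight at \<open>d = \<delta>\<close>. The capped kernel is integrable, the
problem becomes an integral equation of the second kind, and its Neumann series has nonnegative terms and
converges, because at every jump a fixed proportion of the mass leaves \<open>\<Omega>\<close>. Comparison with constants works for the capped
problem as it does for \<open>\<kappa>\<close>, with constants that do not depend on \<open>\<delta>\<close>. The limit \<open>\<delta> \<rightarrow> 0\<close> is taken weak-star in
\<open>L\<^sup>\<infinity>\<close>, along one filter for all \<open>w\<close>, which keeps \<open>G\<close> order preserving (\<open>weak_star_limit\<close>, \<open>green_operator_exists\<close>). Weak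
convergence is enough there, because this problem is linear and the operator can be moved to the test function. The
nonlinear limit is the one of the iteration, and it is monotone and pointwise.

The normalization constant of the fractional Laplacian enters only through its sign. It is defined, however, as the
unique number for which the operator has the symbol \<open>|\<xi>|\<^sup>2\<^sup>s\<close> on Schwartz functions, so the number must be shown to
exist and to be unique. Existence is Fourier inversion together with the identity
\<open>\<integral> (1 - cos (z \<bullet> \<xi>)) |z|\<^bsup>-N-2s\<^esup> dz = c |\<xi>|\<^sup>2\<^sup>s\<close>, which follows from invariance under rotations and from scaling;
uniqueness is seen on a Gaussian (\<open>hypersingular_eq_multiplier\<close>, \<open>frac_laplacian_const_pos\<close>).\<close>

section \<open>Invariance of Lebesgue measure\<close>

lemma lborel_distr_reflect: "distr lborel borel (\<lambda>y. x - y) = (lborel :: 'a::euclidean_space measure)"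
  by (subst (2) lborel_affine[of "-1" x]) (auto simp: density_1)

lemma nn_integral_lborel_translate:
  fixes f :: "'a::euclidean_space \<Rightarrow> ennreal"
  assumes [measurable]: "f \<in> borel_measurable borel"
  shows "(\<integral>\<^sup>+y. f (x + y) \<partial>lborel) = (\<integral>\<^sup>+y. f y \<partial>lborel)"
  by (subst (2) lborel_distr_plus[of x, symmetric]) (simp add: nn_integral_distr)

lemma nn_integral_lborel_reflect:
  fixes f :: "'a::euclidean_space \<Rightarrow> ennreal"
  assumes [measurable]: "f \<in> borel_measurable borel"
  shows "(\<integral>\<^sup>+y. f (x - y) \<partial>lborel) = (\<integral>\<^sup>+y. f y \<partial>lborel)"
  by (subst (2) lborel_distr_reflect[of x, symmetric]) (simp add: nn_integral_distr)

lemma integral_lborel_translate: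
  fixes f :: "'a::euclidean_space \<Rightarrow> 'b::{banach, second_countable_topology}"
  assumes [measurable]: "f \<in> borel_measurable borel"
  shows "(\<integral>y. f (x + y) \<partial>lborel) = (\<integral>y. f y \<partial>lborel)"
  by (subst (2) lborel_distr_plus[of x, symmetric]) (simp add: integral_distr)

lemma integral_lborel_reflect:
  fixes f :: "'a::euclidean_space \<Rightarrow> 'b::{banach, second_countable_topology}"
  assumes [measurable]: "f \<in> borel_measurable borel"
  shows "(\<integral>y. f (x - y) \<partial>lborel) = (\<integral>y. f y \<partial>lborel)"
  by (subst (2) lborel_distr_reflect[of x, symmetric]) (simp add: integral_distr)

lemma nn_integral_lborel_scale:
  fixes f :: "'a::euclidean_space \<Rightarrow> ennreal"
  assumes [measurable]: "f \<in> borel_measurable borel" and "c \<noteq> 0"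
  shows "(\<integral>\<^sup>+y. f y \<partial>lborel) = ennreal (\<bar>c\<bar> ^ DIM('a)) * (\<integral>\<^sup>+y. f (c *\<^sub>R y) \<partial>lborel)"
  by (subst lborel_affine[OF \<open>c \<noteq> 0\<close>, of 0])
     (simp add: nn_integral_density nn_integral_distr nn_integral_cmult)

lemma integral_lborel_scale:
  fixes f :: "'a::euclidean_space \<Rightarrow> 'b::{banach, second_countable_topology}"
  assumes [measurable]: "f \<in> borel_measurable borel" and "c \<noteq> 0"
  shows "(\<integral>y. f y \<partial>lborel) = (\<bar>c\<bar> ^ DIM('a)) *\<^sub>R (\<integral>y. f (c *\<^sub>R y) \<partial>lborel)"
  by (subst lborel_affine[OF \<open>c \<noteq> 0\<close>, of 0])
     (simp add: integral_density integral_distr)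

text \<open>This is the uniqueness proof for Haar measure, applied to Lebesgue measure \<open>\<lambda>\<close> and its image. Evaluating
\<open>\<integral>\<integral> 1\<^sub>A(f x) 1\<^sub>B(y) dy dx\<close> after the translations \<open>y \<mapsto> f x + y\<close> and \<open>x \<mapsto> x - f\<^sup>-\<^sup>1 y\<close> gives
\<open>\<lambda>(f\<^sup>-\<^sup>1 A) \<lambda>(B) = \<lambda>(A) \<lambda>(f\<^sup>-\<^sup>1 B)\<close>, and the unit ball \<open>B\<close> is its own preimage.\<close>

lemma lborel_distr_orthogonal:
  fixes f :: "'a::euclidean_space \<Rightarrow> 'a"
  assumes "orthogonal_transformation f"
  shows "distr lborel borel f = lborel"
proof (rule measure_eqI)
  have lin: "linear f" using assms by (simp add: orthogonal_transformation_def)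
  have f[measurable]: "f \<in> borel_measurable borel"
    using lin by (intro borel_measurable_continuous_onI linear_continuous_on) (simp add: linear_conv_bounded_linear)
  obtain g where g: "\<And>x. f (g x) = x"
    using assms by (metis orthogonal_transformation_surj surjD)
  \<comment> \<open>The right-hand side is the left-hand side with the roles of the two measures exchanged.\<close>
  have swap: "emeasure lborel (f -` A) * emeasure lborel B = emeasure lborel A * emeasure lborel (f -` B)"
    if [measurable]: "A \<in> sets borel" "B \<in> sets borel" for A B :: "'a set"
  proof -
    have pre[measurable]: "f -` A \<in> sets borel" "f -` B \<in> sets borel"
      using measurable_sets[OF f that(1)] measurable_sets[OF f that(2)] by auto
    have ind: "indicator A (f x) = (indicator (f -` A) x :: ennreal)" "indicator B (f x) = (indicator (f -` B) x :: ennreal)" for x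
      by (auto simp: indicator_def)
    have "emeasure lborel (f -` A) * emeasure lborel B
        = (\<integral>\<^sup>+x. indicator A (f x) * (\<integral>\<^sup>+y. indicator B y \<partial>lborel) \<partial>lborel)"
      by (simp add: nn_integral_multc ind)
    also have "\<dots> = (\<integral>\<^sup>+x. indicator A (f x) * (\<integral>\<^sup>+y. indicator B (f x + y) \<partial>lborel) \<partial>lborel)"
      by (subst nn_integral_lborel_translate) auto
    also have "\<dots> = (\<integral>\<^sup>+x. \<integral>\<^sup>+y. indicator A (f x) * indicator B (f x + y) \<partial>lborel \<partial>lborel)"
      by (simp add: nn_integral_cmult)
    also have "\<dots> = (\<integral>\<^sup>+y. \<integral>\<^sup>+x. indicator A (f x) * indicator B (f x + y) \<partial>lborel \<partial>lborel)"
      by (rule lborel_pair.Fubini'[symmetric]) measurable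
    also have "\<dots> = (\<integral>\<^sup>+y. \<integral>\<^sup>+x. indicator A (f x - y) * indicator B (f x) \<partial>lborel \<partial>lborel)"
    proof (rule nn_integral_cong)
      fix y
      have "(\<integral>\<^sup>+x. indicator A (f x) * indicator B (f x + y) \<partial>lborel)
          = (\<integral>\<^sup>+x. indicator A (f (- g y + x)) * indicator B (f (- g y + x) + y) \<partial>lborel :: ennreal)"
        by (subst nn_integral_lborel_translate[of "\<lambda>x. indicator A (f x) * indicator B (f x + y)"]) auto
      then show "(\<integral>\<^sup>+x. indicator A (f x) * indicator B (f x + y) \<partial>lborel)
          = (\<integral>\<^sup>+x. indicator A (f x - y) * indicator B (f x) \<partial>lborel :: ennreal)"
        by (simp add: linear_diff[OF lin] g)
    qed
    also have "\<dots> = (\<integral>\<^sup>+x. \<integral>\<^sup>+y. indicator A (f x - y) * indicator B (f x) \<partial>lborel \<partial>lborel)"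
      by (rule lborel_pair.Fubini') measurable
    also have "\<dots> = (\<integral>\<^sup>+x. (\<integral>\<^sup>+y. indicator A y \<partial>lborel) * indicator B (f x) \<partial>lborel)"
      by (simp add: nn_integral_multc nn_integral_lborel_reflect)
    also have "\<dots> = emeasure lborel A * emeasure lborel (f -` B)"
      by (simp add: nn_integral_cmult ind)
    finally show ?thesis .
  qed
  fix A assume "A \<in> sets (distr lborel borel f)"
  then have A: "A \<in> sets borel" by simp
  have ball: "f -` ball 0 1 = ball 0 1"
    using orthogonal_transformation_norm[OF assms] by auto
  have fin: "emeasure lborel (ball (0::'a) 1) \<noteq> \<infinity>"
    using emeasure_lborel_ball_finite[of "0::'a" 1] by simp
  have "measure lborel (ball (0::'a) 1) > 0" by (rule content_ball_pos) simp
  then have pos: "emeasure lborel (ball (0::'a) 1) \<noteq> 0" by (auto simp: measure_def)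
  have "emeasure lborel (f -` A) = emeasure lborel A"
    using swap[OF A, of "ball 0 1"] pos fin
    by (simp add: ball mult.commute[of _ "emeasure lborel (ball (0::'a) 1)"] ennreal_mult_cancel_left)
  then show "emeasure (distr lborel borel f) A = emeasure lborel A"
    using A by (subst emeasure_distr) auto
qed simp

section \<open>Integrability of the singular kernel\<close>

lemma dyadic_above:
  fixes r :: real assumes "1 \<le> r" shows "\<exists>j::nat. 2 ^ j \<le> r \<and> r < 2 * 2 ^ j"
proof -
  have ex: "\<exists>j::nat. r < 2 * 2 ^ j"
    using real_arch_pow[of 2 r] by (metis less_le_trans one_less_numeral_iff semiring_norm(76) mult_2 le_add_same_cancel1 zero_le_numeral zero_le_power)
  define j where "j = (LEAST j::nat. r < 2 * 2 ^ j)"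
  have a: "r < 2 * 2 ^ j" unfolding j_def by (rule LeastI_ex[OF ex])
  have "2 ^ j \<le> r"
  proof (cases j)
    case (Suc i)
    then have "\<not> r < 2 * 2 ^ i" using not_less_Least[of i "\<lambda>j. r < 2 * 2 ^ j"] by (simp add: j_def)
    with Suc show ?thesis by simp
  qed (use assms in simp)
  with a show ?thesis by blast
qed

lemma dyadic_below:
  fixes r :: real assumes "0 < r" "r < 1" shows "\<exists>j::nat. (1/2) ^ j \<le> r \<and> r < 2 * (1/2) ^ j"
proof -
  have ex: "\<exists>j::nat. (1/2) ^ j \<le> r"
    using real_arch_pow_inv[of r "1/2"] assms by (auto intro: less_imp_le)
  define j where "j = (LEAST j::nat. (1/2) ^ j \<le> r)"
  have a: "(1/2) ^ j \<le> r" unfolding j_def by (rule LeastI_ex[OF ex])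
  have "r < 2 * (1/2) ^ j"
  proof (cases j)
    case (Suc i)
    then have "\<not> (1/2) ^ i \<le> r" using not_less_Least[of i "\<lambda>j. (1/2) ^ j \<le> r"] by (simp add: j_def)
    with Suc show ?thesis by simp
  qed (use assms in simp)
  with a show ?thesis by blast
qed

text \<open>Decomposition of a radial integral into the shells \<open>t\<^sup>j \<le> |z| < 2 t\<^sup>j\<close>: it is used with \<open>t = 2\<close> at infinity and
with \<open>t = 1/2\<close> at the origin. The hypothesis \<open>geo\<close> bounds the \<open>j\<close>-th shell by a geometric sequence.\<close>

lemma nn_integral_dyadic_finite:
  fixes h :: "'a::euclidean_space \<Rightarrow> real"
  assumes t: "t > 0" and b: "\<And>j. b j \<ge> 0" and q: "0 \<le> q" "q < 1"
    and dom: "\<And>z. h z > 0 \<Longrightarrow> \<exists>j. norm z < 2 * t ^ j \<and> h z \<le> b j"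
    and geo: "\<And>j::nat. b j * (t ^ j) ^ DIM('a) \<le> C * q ^ j"
  shows "(\<integral>\<^sup>+z. ennreal (h z) \<partial>lborel) < \<infinity>"
proof -
  define v where "v = measure lborel (ball (0::'a) 1)"
  have v: "v \<ge> 0" by (simp add: v_def)
  have C: "C \<ge> 0" using geo[of 0] b[of 0] by simp
  have ball: "emeasure lborel (ball (0::'a) r) = ennreal (v * r ^ DIM('a))" if "r > 0" for r
  proof -
    have "emeasure lborel (ball (0::'a) r) = ennreal (measure lborel (ball (0::'a) r))"
      by (rule emeasure_eq_ennreal_measure) (use emeasure_lborel_ball_finite[of "0::'a" r] in simp)
    then show ?thesis using content_ball_conv_unit_ball[of r "0::'a"] that
      by (simp add: v_def mult.commute)
  qed
  have "(\<integral>\<^sup>+z. ennreal (h z) \<partial>lborel) \<le> (\<integral>\<^sup>+z. (\<Sum>j. ennreal (b j) * indicator (ball (0::'a) (2 * t ^ j)) z) \<partial>lborel)"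
  proof (rule nn_integral_mono)
    fix z :: 'a
    show "ennreal (h z) \<le> (\<Sum>j. ennreal (b j) * indicator (ball (0::'a) (2 * t ^ j)) z)"
    proof (cases "h z > 0")
      case True
      then obtain j where j: "norm z < 2 * t ^ j" "h z \<le> b j" using dom by blast
      let ?F = "\<lambda>i. ennreal (b i) * indicator (ball (0::'a) (2 * t ^ i)) z"
      have "ennreal (h z) \<le> ?F j"
        using j by (simp add: ennreal_leI)
      also have "?F j = sum ?F {j}" by (subst sum.insert) (auto simp only: finite.emptyI sum.empty empty_iff add_0_right not_False_eq_True)
      also have "\<dots> \<le> (\<Sum>i. ?F i)" by (rule sum_le_suminf) auto
      finally show ?thesis .
    qed (simp add: ennreal_neg)
  qed
  also have "\<dots> = (\<Sum>j. ennreal (b j) * ennreal (v * (2 * t ^ j) ^ DIM('a)))"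
  proof -
    have pos: "0 < 2 * t ^ j" for j using t by simp
    have meas: "ball (0::'a) (2 * t ^ j) \<in> sets lborel" for j by simp
    have "(\<integral>\<^sup>+z. (\<Sum>j. ennreal (b j) * indicator (ball (0::'a) (2 * t ^ j)) z) \<partial>lborel)
        = (\<Sum>j. \<integral>\<^sup>+z. ennreal (b j) * indicator (ball (0::'a) (2 * t ^ j)) z \<partial>lborel)"
      by (intro nn_integral_suminf borel_measurable_times_ennreal borel_measurable_const borel_measurable_indicator meas)
    then show ?thesis by (simp only: nn_integral_cmult_indicator[OF meas] ball[OF pos])
  qed
  also have "\<dots> \<le> (\<Sum>j. ennreal (v * 2 ^ DIM('a) * C * q ^ j))"
  proof (rule suminf_le)
    fix j
    have "b j * (v * (2 * t ^ j) ^ DIM('a)) = v * 2 ^ DIM('a) * (b j * (t ^ j) ^ DIM('a))"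
      by (simp add: power_mult_distrib)
    also have "\<dots> \<le> v * 2 ^ DIM('a) * (C * q ^ j)" using v by (intro mult_left_mono geo) auto
    finally show "ennreal (b j) * ennreal (v * (2 * t ^ j) ^ DIM('a)) \<le> ennreal (v * 2 ^ DIM('a) * C * q ^ j)"
      using b[of j] v t by (simp add: ennreal_mult[symmetric] ennreal_leI mult.assoc)
  qed auto
  also have "\<dots> = ennreal (\<Sum>j. v * 2 ^ DIM('a) * C * q ^ j)"
    using v C q by (intro suminf_ennreal2) (auto intro!: summable_mult summable_geometric)
  also have "\<dots> < \<infinity>" by simp
  finally show ?thesis .
qed

text \<open>The singular kernel \<open>|z|\<^bsup>-N-2s\<^esup>\<close> of the fractional Laplacian. At the origin its value is \<open>0\<close>, because
\<open>0 powr p = 0\<close>, so comparisons with the capped kernels below hold for \<open>z \<noteq> 0\<close> only.\<close>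

definition jump_kernel :: "real \<Rightarrow> real ^ 'n \<Rightarrow> real" where
  "jump_kernel s z = inverse (norm z powr (real CARD('n) + 2 * s))"

text \<open>The regularization replaces \<open>|z|\<close> by \<open>max |z| \<delta>\<close> instead of removing the jumps shorter than \<open>\<delta>\<close>. A point at distance
less than \<open>\<delta>\<close> from the boundary can then still jump out of the domain, and the rate at which it does so stays
comparable with \<open>\<delta>\<^sup>-\<^sup>2\<^sup>s\<close>.\<close>

definition capped_kernel :: "real \<Rightarrow> real \<Rightarrow> real ^ 'n \<Rightarrow> real" where
  "capped_kernel s \<delta> z = inverse (max (norm z) \<delta> powr (real CARD('n) + 2 * s))"

lemma jump_kernel_measurable [measurable]: "jump_kernel s \<in> borel_measurable borel"
  unfolding jump_kernel_def by measurable

lemma capped_kernel_measurable [measurable]: "capped_kernel s \<delta> \<in> borel_measurable borel"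
  unfolding capped_kernel_def by measurable

lemma jump_kernel_nonneg [simp]: "0 \<le> jump_kernel s z"
  by (simp add: jump_kernel_def)

lemma capped_kernel_nonneg [simp]: "0 \<le> capped_kernel s \<delta> z"
  by (simp add: capped_kernel_def)

lemma jump_kernel_minus [simp]: "jump_kernel s (- z) = jump_kernel s z"
  by (simp add: jump_kernel_def)

lemma capped_kernel_minus [simp]: "capped_kernel s \<delta> (- z) = capped_kernel s \<delta> z"
  by (simp add: capped_kernel_def)

lemma jump_kernel_powr: "jump_kernel s (z :: real ^ 'n) = norm z powr (- (real CARD('n) + 2 * s))"
  by (simp only: jump_kernel_def powr_minus)

lemma jump_kernel_scale:
  assumes "c > 0"
  shows "jump_kernel s (c *\<^sub>R z :: real ^ 'n) = c powr (- real CARD('n) - 2 * s) * jump_kernel s z"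
proof -
  have "c powr (- real CARD('n) - 2 * s) = inverse (c powr (real CARD('n) + 2 * s))"
    by (simp add: powr_minus[symmetric])
  then show ?thesis using assms by (simp add: jump_kernel_def powr_mult)
qed

lemma jump_kernel_tail_finite:
  assumes "0 < s"
  shows "(\<integral>\<^sup>+z. ennreal (jump_kernel s (z :: real ^ 'n) * indicator {z. 1 \<le> norm z} z) \<partial>lborel) < \<infinity>"
proof (rule nn_integral_dyadic_finite[where t = 2 and q = "2 powr (-2 * s)" and C = 1
      and b = "\<lambda>j. (2 ^ j) powr (- (real CARD('n) + 2 * s))"])
  show "2 powr (- 2 * s) < 1" using assms by (simp add: powr_less_one)
next
  fix z :: "real ^ 'n"
  assume "0 < jump_kernel s z * indicator {z. 1 \<le> norm z} z"
  then have z: "1 \<le> norm z" by (cases "1 \<le> norm z") auto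
  obtain j :: nat where j: "2 ^ j \<le> norm z" "norm z < 2 * 2 ^ j" using dyadic_above[OF z] by blast
  have "norm z powr (- (real CARD('n) + 2 * s)) \<le> (2 ^ j) powr (- (real CARD('n) + 2 * s))"
    using j assms by (intro powr_mono2') auto
  then show "\<exists>j. norm z < 2 * 2 ^ j \<and> jump_kernel s z * indicator {z. 1 \<le> norm z} z
      \<le> (2 ^ j) powr (- (real CARD('n) + 2 * s))"
    using j z by (auto simp: jump_kernel_powr intro!: exI[of _ j])
next
  fix j :: nat
  have "(2 ^ j :: real) powr (- (real CARD('n) + 2 * s)) * (2 ^ j) ^ CARD('n)
      = (2 ^ j) powr (- (real CARD('n) + 2 * s)) * (2 ^ j) powr real CARD('n)"
    by (subst powr_realpow[symmetric, of "2 ^ j" "CARD('n)"]) auto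
  also have "\<dots> = (2 ^ j) powr (- 2 * s)" by (simp add: powr_add[symmetric])
  also have "\<dots> = (2 powr (- 2 * s)) ^ j"
    by (simp add: powr_realpow[symmetric] powr_powr mult.commute)
  finally show "(2 ^ j) powr (- (real CARD('n) + 2 * s)) * (2 ^ j) ^ DIM(real ^ 'n)
     \<le> 1 * (2 powr (- 2 * s)) ^ j" by simp
qed auto

lemma jump_kernel_near_finite:
  assumes "s < 1"  "0 < s"
  shows "(\<integral>\<^sup>+z. ennreal (norm z ^ 2 * jump_kernel s (z :: real ^ 'n) * indicator {z. norm z < 1} z) \<partial>lborel) < \<infinity>"
proof (rule nn_integral_dyadic_finite[where t = "1/2" and q = "(1/2) powr (2 - 2 * s)" and C = 4
      and b = "\<lambda>j. 4 * ((1/2) ^ j) ^ 2 * ((1/2) ^ j) powr (- (real CARD('n) + 2 * s))"])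
  show "(1/2) powr (2 - 2 * s) < 1" using assms by (simp add: powr01_less_one)
next
  fix z :: "real ^ 'n"
  assume a: "0 < norm z ^ 2 * jump_kernel s z * indicator {z. norm z < 1} z"
  then have z: "0 < norm z" "norm z < 1" by (cases "norm z < 1"; cases "z = 0"; auto)+
  obtain j :: nat where j: "(1/2) ^ j \<le> norm z" "norm z < 2 * (1/2) ^ j" using dyadic_below[OF z] by blast
  have "norm z powr (- (real CARD('n) + 2 * s)) \<le> ((1/2) ^ j) powr (- (real CARD('n) + 2 * s))"
    using j assms by (intro powr_mono2') auto
  moreover have "norm z ^ 2 \<le> (2 * (1/2)^j) ^ 2" using j by (intro power_mono) auto
  ultimately have "norm z ^ 2 * norm z powr (- (real CARD('n) + 2 * s)) \<le> (2 * (1/2)^j) ^ 2 * ((1/2) ^ j) powr (- (real CARD('n) + 2 * s))"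
    by (intro mult_mono) auto
  then show "\<exists>j. norm z < 2 * (1/2) ^ j \<and> norm z ^ 2 * jump_kernel s z * indicator {z. norm z < 1} z
      \<le> 4 * ((1/2) ^ j) ^ 2 * ((1/2) ^ j) powr (- (real CARD('n) + 2 * s))"
    using j z by (auto simp: jump_kernel_powr power_mult_distrib intro!: exI[of _ j])
next
  fix j :: nat
  let ?r = "(1/2 :: real) ^ j"
  have "4 * ?r ^ 2 * ?r powr (- (real CARD('n) + 2 * s)) * ?r ^ CARD('n)
      = 4 * (?r powr 2 * ?r powr (- (real CARD('n) + 2 * s)) * ?r powr real CARD('n))"
    by (subst powr_realpow[symmetric, of ?r "CARD('n)"], simp, subst powr_realpow[symmetric, of ?r 2]) simp_all
  also have "\<dots> = 4 * ?r powr (2 - 2 * s)" by (simp only: powr_add[symmetric]) simp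
  also have "\<dots> = 4 * ((1/2) powr (2 - 2 * s)) ^ j"
    by (simp add: powr_realpow[symmetric] powr_powr mult.commute)
  finally show "4 * ?r ^ 2 * ?r powr (- (real CARD('n) + 2 * s)) * ?r ^ DIM(real ^ 'n)
     \<le> 4 * ((1/2) powr (2 - 2 * s)) ^ j" by simp
qed auto

lemma integrable_jump_kernel_second_order:
  assumes "s < 1"  "0 < s"
  shows "integrable lborel (\<lambda>z :: real ^ 'n. min 1 (norm z ^ 2) * jump_kernel s z)"
proof (rule integrableI_nonneg)
  have "(\<integral>\<^sup>+z. ennreal (min 1 (norm z ^ 2) * jump_kernel s (z :: real ^ 'n)) \<partial>lborel) \<le>
     (\<integral>\<^sup>+z. ennreal (jump_kernel s (z :: real ^ 'n) * indicator {z. 1 \<le> norm z} z) +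
       ennreal (norm z ^ 2 * jump_kernel s z * indicator {z. norm z < 1} z) \<partial>lborel)"
    by (intro nn_integral_mono)
       (auto simp: indicator_def intro!: ennreal_leI mult_right_mono mult_left_le_one_le)
  also have "\<dots> = (\<integral>\<^sup>+z. ennreal (jump_kernel s (z :: real ^ 'n) * indicator {z. 1 \<le> norm z} z) \<partial>lborel) +
     (\<integral>\<^sup>+z. ennreal (norm z ^ 2 * jump_kernel s (z :: real ^ 'n) * indicator {z. norm z < 1} z) \<partial>lborel)"
    by (intro nn_integral_add) measurable
  also have "\<dots> < \<infinity>"
    using jump_kernel_near_finite[OF assms, where 'n = 'n] jump_kernel_tail_finite[OF assms(2), where 'n = 'n]
    by simp
  finally show "(\<integral>\<^sup>+z. ennreal (min 1 (norm z ^ 2) * jump_kernel s (z :: real ^ 'n)) \<partial>lborel) < \<infinity>" .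
qed auto

text \<open>Scaling by \<open>r\<close> reduces the tail beyond radius \<open>r\<close> to the tail beyond radius \<open>1\<close>; the exponent \<open>-2s\<close> found here is the
one in the weight \<open>d\<^sup>-\<^sup>2\<^sup>s\<close>.\<close>

lemma integrable_jump_kernel_tail:
  assumes "0 < s" "0 < r"
  shows "integrable lborel (\<lambda>z :: real ^ 'n. jump_kernel s z * indicator {z. r \<le> norm z} z)"
    and "(\<integral>z. jump_kernel s (z :: real ^ 'n) * indicator {z. r \<le> norm z} z \<partial>lborel)
       = r powr (-2 * s) * (\<integral>z. jump_kernel s (z :: real ^ 'n) * indicator {z. 1 \<le> norm z} z \<partial>lborel)"
proof -
  let ?f = "\<lambda>r (z :: real ^ 'n). jump_kernel s z * indicator {z. r \<le> norm z} z"
  have scale: "?f r (r *\<^sub>R z) = r powr (- real CARD('n) - 2 * s) * ?f 1 z" for z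
    using assms by (auto simp: jump_kernel_scale indicator_def)
  have "(\<integral>\<^sup>+z. ennreal (?f r z) \<partial>lborel) = ennreal (r ^ CARD('n)) * (\<integral>\<^sup>+z. ennreal (?f r (r *\<^sub>R z)) \<partial>lborel)"
    using assms nn_integral_lborel_scale[of "\<lambda>z. ennreal (?f r z)" r] by simp
  also have "\<dots> = ennreal (r ^ CARD('n)) * (ennreal (r powr (- real CARD('n) - 2 * s)) * (\<integral>\<^sup>+z. ennreal (?f 1 z) \<partial>lborel))"
    unfolding scale by (simp add: ennreal_mult nn_integral_cmult)
  also have "\<dots> < \<infinity>" using jump_kernel_tail_finite[OF assms(1), where 'n='n]
    by (simp add: ennreal_mult_less_top)
  finally show "integrable lborel (?f r)" by (intro integrableI_nonneg) auto
  have "(\<integral>z. ?f r z \<partial>lborel) = r ^ CARD('n) * (\<integral>z. ?f r (r *\<^sub>R z) \<partial>lborel)"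
    using assms integral_lborel_scale[of "?f r" r] by simp
  also have "\<dots> = r ^ CARD('n) * (r powr (- real CARD('n) - 2 * s) * (\<integral>z. ?f 1 z \<partial>lborel))"
    unfolding scale by simp
  also have "r ^ CARD('n) = r powr real CARD('n)" using assms by (simp add: powr_realpow)
  also have "r powr real CARD('n) * (r powr (- real CARD('n) - 2 * s) * (\<integral>z. ?f 1 z \<partial>lborel))
     = r powr (-2 * s) * (\<integral>z. ?f 1 z \<partial>lborel)"
    by (simp add: mult.assoc[symmetric] powr_add[symmetric])
  finally show "(\<integral>z. ?f r z \<partial>lborel) = r powr (-2 * s) * (\<integral>z. ?f 1 z \<partial>lborel)" .
qed

lemma capped_kernel_le_jump_kernel:
  assumes "0 < s" "z \<noteq> 0"
  shows "capped_kernel s \<delta> (z :: real ^ 'n) \<le> jump_kernel s z"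
  using assms unfolding capped_kernel_def jump_kernel_def
  by (intro le_imp_inverse_le powr_mono2) auto

lemma capped_kernel_eq_jump_kernel:
  "\<delta> \<le> norm z \<Longrightarrow> capped_kernel s \<delta> z = jump_kernel s z"
  by (simp add: capped_kernel_def jump_kernel_def max_def)

lemma capped_kernel_scale:
  assumes "c > 0"
  shows "capped_kernel s c (c *\<^sub>R z :: real ^ 'n) = c powr (- real CARD('n) - 2 * s) * capped_kernel s 1 z"
proof -
  have "c powr (- real CARD('n) - 2 * s) = inverse (c powr (real CARD('n) + 2 * s))"
    by (simp add: powr_minus[symmetric])
  moreover have "max (c * norm z) c = c * max (norm z) 1" using assms by (simp add: max_def)
  ultimately show ?thesis using assms by (simp add: capped_kernel_def powr_mult)
qed

lemma integrable_capped_kernel: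
  assumes "0 < s" "0 < \<delta>"
  shows "integrable lborel (capped_kernel s \<delta> :: real ^ 'n \<Rightarrow> real)"
    and "(\<integral>z. capped_kernel s \<delta> (z :: real ^ 'n) \<partial>lborel)
       = \<delta> powr (-2 * s) * (\<integral>z. capped_kernel s 1 (z :: real ^ 'n) \<partial>lborel)"
proof -
  let ?f = "\<lambda>r (z :: real ^ 'n). capped_kernel s r z"
  have int1: "integrable lborel (?f 1)"
  proof (rule Bochner_Integration.integrable_bound)
    show "integrable lborel (\<lambda>z :: real ^ 'n. jump_kernel s z * indicator {z. 1 \<le> norm z} z + indicator (ball 0 1) z)"
      using integrable_jump_kernel_tail(1)[of s 1, where 'n='n] assms emeasure_lborel_ball_finite[of "0 :: real ^ 'n" 1]
      by (intro Bochner_Integration.integrable_add integrable_real_indicator) auto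
    show "AE z in lborel. norm (capped_kernel s 1 z) \<le> norm (jump_kernel s z * indicator {z. 1 \<le> norm z} z + indicator (ball 0 1) z)"
      by (rule AE_I2) (auto simp: capped_kernel_eq_jump_kernel indicator_def, simp add: capped_kernel_def)
  qed auto
  then have fin: "(\<integral>\<^sup>+z. ennreal (?f 1 z) \<partial>lborel) < \<infinity>" by (simp add: integrable_iff_bounded)
  have "(\<integral>\<^sup>+z. ennreal (?f \<delta> z) \<partial>lborel) = ennreal (\<delta> ^ CARD('n)) * (\<integral>\<^sup>+z. ennreal (?f \<delta> (\<delta> *\<^sub>R z)) \<partial>lborel)"
    using assms nn_integral_lborel_scale[of "\<lambda>z. ennreal (?f \<delta> z)" \<delta>] by simp
  also have "\<dots> = ennreal (\<delta> ^ CARD('n)) * (ennreal (\<delta> powr (- real CARD('n) - 2 * s)) * (\<integral>\<^sup>+z. ennreal (?f 1 z) \<partial>lborel))"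
    unfolding capped_kernel_scale[OF assms(2)] by (simp add: ennreal_mult nn_integral_cmult)
  also have "\<dots> < \<infinity>" using fin by (simp add: ennreal_mult_less_top)
  finally show "integrable lborel (?f \<delta>)" by (intro integrableI_nonneg) auto
  have "(\<integral>z. ?f \<delta> z \<partial>lborel) = \<delta> ^ CARD('n) * (\<integral>z. ?f \<delta> (\<delta> *\<^sub>R z) \<partial>lborel)"
    using assms integral_lborel_scale[of "?f \<delta>" \<delta>] by simp
  also have "\<dots> = \<delta> ^ CARD('n) * (\<delta> powr (- real CARD('n) - 2 * s) * (\<integral>z. ?f 1 z \<partial>lborel))"
    unfolding capped_kernel_scale[OF assms(2)] by simp
  also have "\<delta> ^ CARD('n) = \<delta> powr real CARD('n)" using assms by (simp add: powr_realpow)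
  also have "\<delta> powr real CARD('n) * (\<delta> powr (- real CARD('n) - 2 * s) * (\<integral>z. ?f 1 z \<partial>lborel))
     = \<delta> powr (-2 * s) * (\<integral>z. ?f 1 z \<partial>lborel)"
    by (simp add: mult.assoc[symmetric] powr_add[symmetric])
  finally show "(\<integral>z. ?f \<delta> z \<partial>lborel) = \<delta> powr (-2 * s) * (\<integral>z. ?f 1 z \<partial>lborel)" .
qed

section \<open>Second differences and the principal value\<close>

lemma frechet_derivative_expansion:
  fixes f :: "real ^ 'n \<Rightarrow> 'b::real_normed_vector"
  assumes "f differentiable (at x)"
  shows "frechet_derivative f (at x) h = (\<Sum>i\<in>UNIV. (h $ i) *\<^sub>R partial_deriv i f x)"
proof -
  have lin: "linear (frechet_derivative f (at x))" using assms by (rule linear_frechet_derivative)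
  have "h = (\<Sum>i\<in>UNIV. (h $ i) *\<^sub>R axis i 1)"
    using basis_expansion[of h] by (simp add: scalar_mult_eq_scaleR)
  then have "frechet_derivative f (at x) h = frechet_derivative f (at x) (\<Sum>i\<in>UNIV. (h $ i) *\<^sub>R axis i 1)" by simp
  also have "\<dots> = (\<Sum>i\<in>UNIV. (h $ i) *\<^sub>R partial_deriv i f x)"
    by (simp add: linear_sum[OF lin] linear_scale[OF lin] partial_deriv_def)
  finally show ?thesis .
qed

lemma norm_expansion_le:
  fixes v :: "'n::finite \<Rightarrow> 'b::real_normed_vector" and h :: "real ^ 'n"
  assumes "\<And>i. norm (v i) \<le> B"
  shows "norm (\<Sum>i\<in>UNIV. (h $ i) *\<^sub>R v i) \<le> real CARD('n) * B * norm h"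
proof -
  have B: "B \<ge> 0" using assms[of undefined] norm_ge_zero order_trans by blast
  have "norm (\<Sum>i\<in>UNIV. (h $ i) *\<^sub>R v i) \<le> (\<Sum>i\<in>(UNIV::'n set). norm h * B)"
    by (intro sum_norm_le) (auto intro!: mult_mono assms simp: component_le_norm_cart)
  then show ?thesis by (simp add: mult_ac)
qed

lemma lipschitz_of_bounded_partials:
  fixes f :: "real ^ 'n \<Rightarrow> 'b::real_normed_vector"
  assumes "\<And>x. f differentiable (at x)" and "\<And>i x. norm (partial_deriv i f x) \<le> B"
  shows "norm (f x - f y) \<le> real CARD('n) * B * norm (x - y)"
proof (rule differentiable_bound[of UNIV f "\<lambda>x. frechet_derivative f (at x)"])
  fix x
  show "(f has_derivative frechet_derivative f (at x)) (at x within UNIV)"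
    using assms(1) by (simp add: frechet_derivative_works)
  show "onorm (frechet_derivative f (at x)) \<le> real CARD('n) * B"
    by (rule onorm_le) (simp add: frechet_derivative_expansion[OF assms(1)] norm_expansion_le assms(2))
qed auto

text \<open>The function \<open>\<phi> t = f (x + t z) + f (x - t z)\<close> has derivative \<open>D (x + t z) - D (x - t z)\<close>, where \<open>D p\<close> is the derivative
of \<open>f\<close> at \<open>p\<close> in direction \<open>z\<close>. The first order terms cancel, so the derivative is of order \<open>|z|\<^sup>2\<close>.\<close>

lemma second_difference_bound:
  fixes f :: "real ^ 'n \<Rightarrow> 'b::real_normed_vector"
  assumes f: "\<And>x. f differentiable (at x)" and f': "\<And>i x. partial_deriv i f differentiable (at x)"
    and B: "\<And>i j x. norm (partial_deriv j (partial_deriv i f) x) \<le> B"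
  shows "norm (2 *\<^sub>R f x - f (x + z) - f (x - z)) \<le> 2 * (real CARD('n))\<^sup>2 * B * (norm z)\<^sup>2"
proof -
  define D where "D p = (\<Sum>i\<in>UNIV. (z $ i) *\<^sub>R partial_deriv i f p)" for p
  have D: "frechet_derivative f (at p) z = D p" for p
    by (simp add: D_def frechet_derivative_expansion[OF f])
  have B0: "B \<ge> 0" using B[of undefined undefined undefined] norm_ge_zero order_trans by blast
  have Dlip: "norm (D p - D p') \<le> (real CARD('n))\<^sup>2 * B * norm (p - p') * norm z" for p p'
  proof -
    have "D p - D p' = (\<Sum>i\<in>UNIV. (z $ i) *\<^sub>R (partial_deriv i f p - partial_deriv i f p'))"
      by (simp add: D_def sum_subtractf scaleR_diff_right)
    also have "norm \<dots> \<le> real CARD('n) * (real CARD('n) * B * norm (p - p')) * norm z"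
      by (rule norm_expansion_le) (rule lipschitz_of_bounded_partials[OF f' B])
    finally show ?thesis by (simp add: power2_eq_square mult_ac)
  qed
  \<comment> \<open>Only \<open>\<phi> 1 - \<phi> 0\<close> is of interest: it is the second difference up to its sign.\<close>
  define \<phi> where "\<phi> t = f (x + t *\<^sub>R z) + f (x - t *\<^sub>R z)" for t
  have frechet: "(f has_derivative (\<lambda>h. frechet_derivative f (at p) h)) (at p)" for p
    using f by (simp add: frechet_derivative_works)
  have lin: "linear (frechet_derivative f (at p))" for p using f by (rule linear_frechet_derivative)
  have "(\<phi> has_vector_derivative (D (x + t *\<^sub>R z) - D (x - t *\<^sub>R z))) (at t within {0..1})" for t
  proof -
    have 1: "((\<lambda>t. f (x + t *\<^sub>R z)) has_derivative (\<lambda>h. frechet_derivative f (at (x + t *\<^sub>R z)) (h *\<^sub>R z))) (at t within {0..1})"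
      by (rule has_derivative_compose[OF _ frechet]) (auto intro!: derivative_eq_intros)
    have 2: "((\<lambda>t. f (x - t *\<^sub>R z)) has_derivative (\<lambda>h. frechet_derivative f (at (x - t *\<^sub>R z)) (h *\<^sub>R (- z)))) (at t within {0..1})"
      by (rule has_derivative_compose[OF _ frechet]) (auto intro!: derivative_eq_intros)
    show ?thesis
      using has_derivative_add[OF 1 2]
      by (simp only: has_vector_derivative_def \<phi>_def[abs_def] linear_scale[OF lin] linear_neg[OF lin] D)
         (simp add: algebra_simps)
  qed
  then have "norm (\<phi> 1 - \<phi> 0) \<le> (2 * (real CARD('n))\<^sup>2 * B * (norm z)\<^sup>2) * norm (1 - 0 :: real)"
  proof (intro differentiable_bound[of "{0..1}" \<phi> "\<lambda>t h. h *\<^sub>R (D (x + t *\<^sub>R z) - D (x - t *\<^sub>R z))"])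
    fix t :: real assume t: "t \<in> {0..1}"
    have "norm (D (x + t *\<^sub>R z) - D (x - t *\<^sub>R z)) \<le> (real CARD('n))\<^sup>2 * B * norm (x + t *\<^sub>R z - (x - t *\<^sub>R z)) * norm z"
      by (rule Dlip)
    also have "x + t *\<^sub>R z - (x - t *\<^sub>R z) = (2 * t) *\<^sub>R z" by (simp add: scaleR_2[symmetric])
    also have "(real CARD('n))\<^sup>2 * B * norm ((2 * t) *\<^sub>R z) * norm z \<le> (real CARD('n))\<^sup>2 * B * (2 * norm z) * norm z"
      using t B0 by (intro mult_mono mult_left_mono mult_nonneg_nonneg) (auto intro: mult_left_le_one_le)
    finally have "norm (D (x + t *\<^sub>R z) - D (x - t *\<^sub>R z)) \<le> 2 * (real CARD('n))\<^sup>2 * B * (norm z)\<^sup>2"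
      by (simp add: power2_eq_square mult_ac)
    then show "onorm (\<lambda>h. h *\<^sub>R (D (x + t *\<^sub>R z) - D (x - t *\<^sub>R z))) \<le> 2 * (real CARD('n))\<^sup>2 * B * (norm z)\<^sup>2"
      by (intro onorm_le) (simp add: mult.commute mult_left_mono)
  qed (auto simp: has_vector_derivative_def)
  moreover have "2 *\<^sub>R f x - f (x + z) - f (x - z) = - (\<phi> 1 - \<phi> 0)"
    by (simp add: \<phi>_def scaleR_2)
  ultimately show ?thesis by (simp only: norm_minus_cancel) simp
qed

text \<open>Test functions and Schwartz functions share this property, and it is enough for the operator to be defined
pointwise by an absolutely convergent integral.\<close>

definition bounded_smooth :: "(real ^ 'n \<Rightarrow> 'b::real_normed_vector) \<Rightarrow> bool" where
  "bounded_smooth f \<longleftrightarrow> smooth f \<and> (\<forall>is. \<exists>C. \<forall>x. norm (iter_partial_deriv is f x) \<le> C)"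

lemma schwartz_bounded_smooth: "schwartz f \<Longrightarrow> bounded_smooth f"
  unfolding schwartz_def bounded_smooth_def by (metis mult_1 power_0)

lemma smooth_iter_partial_deriv_continuous: "smooth f \<Longrightarrow> continuous_on A (iter_partial_deriv is f)"
  unfolding smooth_def
  by (meson continuous_at_imp_continuous_on differentiable_imp_continuous_within)

lemma smooth_continuous: "smooth f \<Longrightarrow> continuous_on A f"
  using smooth_iter_partial_deriv_continuous[of f A "[]"] by simp

lemma smooth_borel: "smooth (f :: real ^ 'n \<Rightarrow> 'b::real_normed_vector) \<Longrightarrow> f \<in> borel_measurable borel"
  by (simp add: smooth_continuous borel_measurable_continuous_onI)

lemma iter_partial_deriv_outside_support:
  "x \<notin> closure {x. f x \<noteq> 0} \<Longrightarrow> iter_partial_deriv is f x = 0"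
proof (induction "is" arbitrary: x)
  case Nil
  then have "x \<notin> {x. f x \<noteq> 0}" by (rule contra_subsetD[OF closure_subset])
  then show ?case by simp
next
  case (Cons i "is")
  have "((\<lambda>_. 0) has_derivative (\<lambda>_. 0)) (at x)" by (rule has_derivative_const)
  then have "(iter_partial_deriv is f has_derivative (\<lambda>_. 0)) (at x)"
    by (rule has_derivative_transform_within_open[where s = "- closure {x. f x \<noteq> 0}"])
       (use Cons in \<open>auto simp del: closure_eq closure_closed\<close>)
  then have "frechet_derivative (iter_partial_deriv is f) (at x) = (\<lambda>_. 0)"
    by (rule frechet_derivative_at[symmetric])
  then show ?case by (simp add: partial_deriv_def)
qed

lemma test_function_bounded_smooth:
  assumes "test_function \<Omega> \<psi>" shows "bounded_smooth \<psi>"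
  unfolding bounded_smooth_def
proof (intro conjI allI)
  show sm: "smooth \<psi>" using assms by (simp add: test_function_def)
  fix "is"
  let ?K = "closure {x. \<psi> x \<noteq> 0}"
  have "compact ?K" using assms by (simp add: test_function_def)
  then have "bounded (iter_partial_deriv is \<psi> ` ?K)"
    by (intro compact_imp_bounded compact_continuous_image smooth_iter_partial_deriv_continuous sm)
  then obtain C where C: "\<And>x. x \<in> ?K \<Longrightarrow> norm (iter_partial_deriv is \<psi> x) \<le> C" "C > 0"
    by (auto simp: bounded_pos)
  have "norm (iter_partial_deriv is \<psi> x) \<le> C" for x
  proof (cases "x \<in> ?K")
    case False
    then have "iter_partial_deriv is \<psi> x = 0" by (rule iter_partial_deriv_outside_support)
    then show ?thesis using C(2) by simp
  qed (rule C(1))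
  then show "\<exists>C. \<forall>x. norm (iter_partial_deriv is \<psi> x) \<le> C" by blast
qed

lemma bounded_smooth_second_difference:
  assumes "bounded_smooth (f :: real ^ 'n \<Rightarrow> 'b::real_normed_vector)"
  obtains C where "C \<ge> 0" "\<And>x z. norm (2 *\<^sub>R f x - f (x + z) - f (x - z)) \<le> C * min 1 ((norm z)\<^sup>2)"
proof -
  have d: "iter_partial_deriv is f differentiable (at x)" for "is" x
    using assms by (simp add: bounded_smooth_def smooth_def)
  have "\<forall>is. \<exists>C. \<forall>x. norm (iter_partial_deriv is f x) \<le> C"
    using assms unfolding bounded_smooth_def by (rule conjunct2)
  then have "\<exists>C. \<forall>x. norm (iter_partial_deriv [j, i] f x) \<le> C" for i j by (rule spec)
  then have "\<forall>i j. \<exists>C. \<forall>x. norm (partial_deriv j (partial_deriv i f) x) \<le> C"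
    unfolding iter_partial_deriv.simps by (intro allI)
  then obtain c where c: "\<And>i j x. norm (partial_deriv j (partial_deriv i f) x) \<le> c i j"
    by metis
  define B where "B = (\<Sum>i\<in>UNIV. \<Sum>j\<in>UNIV. \<bar>c i j\<bar>)"
  have cB: "c i j \<le> B" for i j
  proof -
    have "c i j \<le> (\<Sum>j\<in>UNIV. \<bar>c i j\<bar>)"
      using member_le_sum[of j UNIV "\<lambda>j. \<bar>c i j\<bar>"] by simp
    also have "\<dots> \<le> B" unfolding B_def
      by (rule member_le_sum[of i UNIV "\<lambda>i. \<Sum>j\<in>UNIV. \<bar>c i j\<bar>"]) (auto intro: sum_nonneg)
    finally show ?thesis .
  qed
  have b2: "norm (2 *\<^sub>R f x - f (x + z) - f (x - z)) \<le> 2 * (real CARD('n))\<^sup>2 * B * (norm z)\<^sup>2" for x z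
    using d[of "[]"] d[of "[i]" for i] order_trans[OF c cB] by (intro second_difference_bound) auto
  obtain M where M: "\<And>x. norm (f x) \<le> M"
    using assms unfolding bounded_smooth_def by (metis iter_partial_deriv.simps(1))
  have b0: "norm (2 *\<^sub>R f x - f (x + z) - f (x - z)) \<le> 4 * M" for x z
  proof -
    have "norm (2 *\<^sub>R f x - f (x + z) - f (x - z)) \<le> norm (2 *\<^sub>R f x) + norm (f (x + z)) + norm (f (x - z))"
      using norm_triangle_ineq4[of "2 *\<^sub>R f x - f (x + z)" "f (x - z)"] norm_triangle_ineq4[of "2 *\<^sub>R f x" "f (x + z)"] by linarith
    then show ?thesis using M[of x] M[of "x + z"] M[of "x - z"] by simp
  qed
  define C where "C = max (4 * M) (2 * (real CARD('n))\<^sup>2 * B)"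
  have M0: "M \<ge> 0" using M norm_ge_zero order_trans by blast
  show ?thesis
  proof
    show C0: "C \<ge> 0" using M0 by (simp add: C_def)
    fix x z
    have "norm (2 *\<^sub>R f x - f (x + z) - f (x - z)) \<le> C" using b0[of x z] by (simp add: C_def)
    moreover have "norm (2 *\<^sub>R f x - f (x + z) - f (x - z)) \<le> C * (norm z)\<^sup>2"
      using b2[of x z] by (rule order_trans) (auto simp: C_def intro!: mult_right_mono)
    ultimately show "norm (2 *\<^sub>R f x - f (x + z) - f (x - z)) \<le> C * min 1 ((norm z)\<^sup>2)"
      by (simp add: min_def)
  qed
qed

text \<open>The principal value integral after the substitutions \<open>y = x + z\<close> and \<open>y = x - z\<close> have been averaged. Second differences
of bounded smooth functions are bounded by a multiple of \<open>min 1 |z|\<^sup>2\<close>, so the integral converges absolutely for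
\<open>0 < s < 1\<close>.\<close>

definition hypersingular :: "real \<Rightarrow> (real ^ 'n \<Rightarrow> 'b::{banach, second_countable_topology}) \<Rightarrow> real ^ 'n \<Rightarrow> 'b" where
  "hypersingular s f x = (\<integral>z. jump_kernel s z *\<^sub>R (2 *\<^sub>R f x - f (x + z) - f (x - z)) \<partial>lborel) /\<^sub>R 2"

lemma integrable_bounded_mult:
  fixes f :: "'a::euclidean_space \<Rightarrow> 'b::{banach, second_countable_topology}"
  assumes "integrable lborel \<kappa>" and [measurable]: "f \<in> borel_measurable borel" and "\<And>x. norm (f x) \<le> M"
  shows "integrable lborel (\<lambda>x. \<kappa> x *\<^sub>R f x)"
proof (rule Bochner_Integration.integrable_bound)
  show "integrable lborel (\<lambda>x. M * \<kappa> x)" using assms(1) by simp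
  have [measurable]: "\<kappa> \<in> borel_measurable borel" using assms(1) by auto
  show "(\<lambda>x. \<kappa> x *\<^sub>R f x) \<in> borel_measurable lborel" by simp
  have M: "M \<ge> 0" using assms(3) norm_ge_zero order_trans by blast
  show "AE x in lborel. norm (\<kappa> x *\<^sub>R f x) \<le> norm (M * \<kappa> x)"
  proof (rule AE_I2)
    fix x
    have "\<bar>\<kappa> x\<bar> * norm (f x) \<le> \<bar>\<kappa> x\<bar> * M" by (intro mult_left_mono assms(3)) simp
    then show "norm (\<kappa> x *\<^sub>R f x) \<le> norm (M * \<kappa> x)" using M by (simp add: abs_mult mult.commute)
  qed
qed

lemma symmetrized_integral:
  fixes f :: "real ^ 'n \<Rightarrow> 'b::{banach, second_countable_topology}"
  assumes \<kappa>: "integrable lborel \<kappa>" "\<And>z. \<kappa> (- z) = \<kappa> z" and f[measurable]: "f \<in> borel_measurable borel"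
    and M: "\<And>x. norm (f x) \<le> M"
  shows "(\<integral>y. \<kappa> (x - y) *\<^sub>R (f x - f y) \<partial>lborel)
       = (\<integral>z. \<kappa> z *\<^sub>R (2 *\<^sub>R f x - f (x + z) - f (x - z)) \<partial>lborel) /\<^sub>R 2"
proof -
  have [measurable]: "\<kappa> \<in> borel_measurable borel" using \<kappa>(1) by auto
  have b: "norm (f x - f y) \<le> 2 * M" for y
    using norm_triangle_ineq4[of "f x" "f y"] M[of x] M[of y] by linarith
  have 1: "(\<integral>y. \<kappa> (x - y) *\<^sub>R (f x - f y) \<partial>lborel) = (\<integral>z. \<kappa> z *\<^sub>R (f x - f (x - z)) \<partial>lborel)"
    using integral_lborel_reflect[of "\<lambda>y. \<kappa> (x - y) *\<^sub>R (f x - f y)" x] by simp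
  have 2: "(\<integral>y. \<kappa> (x - y) *\<^sub>R (f x - f y) \<partial>lborel) = (\<integral>z. \<kappa> z *\<^sub>R (f x - f (x + z)) \<partial>lborel)"
    using integral_lborel_translate[of "\<lambda>y. \<kappa> (x - y) *\<^sub>R (f x - f y)" x] by (simp add: \<kappa>)
  have i: "integrable lborel (\<lambda>z. \<kappa> z *\<^sub>R (f x - f (x - z)))" "integrable lborel (\<lambda>z. \<kappa> z *\<^sub>R (f x - f (x + z)))"
    using b by (auto intro!: integrable_bounded_mult[OF \<kappa>(1), where M="2*M"])
  have "2 *\<^sub>R (\<integral>y. \<kappa> (x - y) *\<^sub>R (f x - f y) \<partial>lborel)
      = (\<integral>z. \<kappa> z *\<^sub>R (f x - f (x - z)) \<partial>lborel) + (\<integral>z. \<kappa> z *\<^sub>R (f x - f (x + z)) \<partial>lborel)"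
    by (simp add: scaleR_2) (simp add: 1 2[symmetric])
  also have "\<dots> = (\<integral>z. \<kappa> z *\<^sub>R (f x - f (x - z)) + \<kappa> z *\<^sub>R (f x - f (x + z)) \<partial>lborel)"
    by (rule Bochner_Integration.integral_add[OF i, symmetric])
  also have "\<dots> = (\<integral>z. \<kappa> z *\<^sub>R (2 *\<^sub>R f x - f (x + z) - f (x - z)) \<partial>lborel)"
    by (rule Bochner_Integration.integral_cong) (auto simp: algebra_simps scaleR_2)
  finally have "(2 *\<^sub>R (\<integral>y. \<kappa> (x - y) *\<^sub>R (f x - f y) \<partial>lborel)) /\<^sub>R 2
    = (\<integral>z. \<kappa> z *\<^sub>R (2 *\<^sub>R f x - f (x + z) - f (x - z)) \<partial>lborel) /\<^sub>R 2" by simp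
  then show ?thesis by simp
qed

lemma integrable_second_difference:
  fixes f :: "real ^ 'n \<Rightarrow> 'b::{banach, second_countable_topology}"
  assumes s: "0 < s" "s < 1" and f: "bounded_smooth f"
  shows "integrable lborel (\<lambda>z. jump_kernel s z *\<^sub>R (2 *\<^sub>R f x - f (x + z) - f (x - z)))"
proof -
  have [measurable]: "f \<in> borel_measurable borel" using f by (simp add: bounded_smooth_def smooth_borel)
  obtain C where C: "C \<ge> 0" "\<And>x z. norm (2 *\<^sub>R f x - f (x + z) - f (x - z)) \<le> C * min 1 ((norm z)\<^sup>2)"
    using bounded_smooth_second_difference[OF f] by blast
  show ?thesis
  proof (rule Bochner_Integration.integrable_bound)
    show "integrable lborel (\<lambda>z::real ^ 'n. C * (min 1 (norm z ^ 2) * jump_kernel s z))"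
      by (intro integrable_mult_right integrable_jump_kernel_second_order s)
    show "AE z in lborel. norm (jump_kernel s z *\<^sub>R (2 *\<^sub>R f x - f (x + z) - f (x - z)))
       \<le> norm (C * (min 1 (norm z ^ 2) * jump_kernel s z))"
    proof (rule AE_I2)
      fix z
      have "jump_kernel s z * norm (2 *\<^sub>R f x - f (x + z) - f (x - z)) \<le> jump_kernel s z * (C * min 1 ((norm z)\<^sup>2))"
        by (intro mult_left_mono C) auto
      then show "norm (jump_kernel s z *\<^sub>R (2 *\<^sub>R f x - f (x + z) - f (x - z)))
         \<le> norm (C * (min 1 (norm z ^ 2) * jump_kernel s z))" using C(1) by (simp add: mult_ac abs_mult)
    qed
  qed simp
qed

text \<open>The sharp cut-offs \<open>1\<^bsub>|z| \<ge> \<epsilon>\<^esub> |z|\<^bsup>-N-2s\<^esup>\<close> of the principal value and the capped kernels are both instances, so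
the two regularizations have the same limit.\<close>

lemma kernel_approximation_tendsto_hypersingular:
  fixes f :: "real ^ 'n \<Rightarrow> 'b::{banach, second_countable_topology}"
  assumes s: "0 < s" "s < 1" and f: "bounded_smooth f"
    and int: "\<And>n::nat. integrable lborel (\<kappa> n)" and even: "\<And>n z. \<kappa> n (- z) = \<kappa> n z"
    and le: "\<And>n z. z \<noteq> 0 \<Longrightarrow> 0 \<le> \<kappa> n z \<and> \<kappa> n z \<le> jump_kernel s z"
    and lim: "\<And>z. z \<noteq> 0 \<Longrightarrow> (\<lambda>n. \<kappa> n z) \<longlonglongrightarrow> jump_kernel s z"
  shows "(\<lambda>n. \<integral>y. \<kappa> n (x - y) *\<^sub>R (f x - f y) \<partial>lborel) \<longlonglongrightarrow> hypersingular s f x"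
proof -
  have [measurable]: "f \<in> borel_measurable borel" using f by (simp add: bounded_smooth_def smooth_borel)
  obtain M where M: "\<And>x. norm (f x) \<le> M"
    using f unfolding bounded_smooth_def by (metis iter_partial_deriv.simps(1))
  have [measurable]: "\<kappa> n \<in> borel_measurable borel" for n using int[of n] by auto
  let ?d = "\<lambda>z. 2 *\<^sub>R f x - f (x + z) - f (x - z)"
  have "(\<lambda>n. (\<integral>z. \<kappa> n z *\<^sub>R ?d z \<partial>lborel)) \<longlonglongrightarrow> (\<integral>z. jump_kernel s z *\<^sub>R ?d z \<partial>lborel)"
  proof (rule integral_dominated_convergence)
    show "integrable lborel (\<lambda>z. norm (jump_kernel s z *\<^sub>R ?d z))"
      by (rule integrable_norm[OF integrable_second_difference[OF s f]])
    show "AE z in lborel. (\<lambda>n. \<kappa> n z *\<^sub>R ?d z) \<longlonglongrightarrow> jump_kernel s z *\<^sub>R ?d z"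
    proof (rule AE_I2)
      fix z show "(\<lambda>n. \<kappa> n z *\<^sub>R ?d z) \<longlonglongrightarrow> jump_kernel s z *\<^sub>R ?d z"
        using lim[of z] by (cases "z = 0") (auto intro!: tendsto_intros simp: scaleR_2)
    qed
    show "AE z in lborel. norm (\<kappa> n z *\<^sub>R ?d z) \<le> norm (jump_kernel s z *\<^sub>R ?d z)" for n
    proof (rule AE_I2)
      fix z show "norm (\<kappa> n z *\<^sub>R ?d z) \<le> norm (jump_kernel s z *\<^sub>R ?d z)"
        using le[of z n] by (cases "z = 0") (auto intro!: mult_right_mono simp: scaleR_2)
    qed
  qed auto
  then have "(\<lambda>n. (\<integral>z. \<kappa> n z *\<^sub>R ?d z \<partial>lborel) /\<^sub>R 2) \<longlonglongrightarrow> hypersingular s f x"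
    unfolding hypersingular_def by (intro tendsto_intros)
  then show ?thesis by (simp only: symmetrized_integral[OF int even \<open>f \<in> borel_measurable borel\<close> M])
qed

lemma pv_integral_eq_hypersingular:
  fixes f :: "real ^ 'n \<Rightarrow> 'b::{banach, second_countable_topology}"
  assumes s: "0 < s" "s < 1" and f: "bounded_smooth f"
  shows "pv_integral s f x = hypersingular s f x"
  unfolding pv_integral_def
proof (rule tendsto_Lim)
  let ?\<kappa> = "\<lambda>\<epsilon> z :: real ^ 'n. jump_kernel s z * indicator {z. \<epsilon> \<le> norm z} z"
  have eq: "(LINT y:(- ball x \<epsilon>)|lborel. (f x - f y) /\<^sub>R norm (x - y) powr (real CARD('n) + 2 * s))
     = (\<integral>y. ?\<kappa> \<epsilon> (x - y) *\<^sub>R (f x - f y) \<partial>lborel)" for \<epsilon>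
    unfolding set_lebesgue_integral_def
    by (rule Bochner_Integration.integral_cong) (auto simp: jump_kernel_def indicator_def dist_norm not_less)
  show "((\<lambda>\<epsilon>. LINT y:(- ball x \<epsilon>)|lborel. (f x - f y) /\<^sub>R norm (x - y) powr (real CARD('n) + 2 * s))
     \<longlongrightarrow> hypersingular s f x) (at_right 0)"
    unfolding eq tendsto_at_iff_sequentially comp_def
  proof (intro allI impI)
    fix X :: "nat \<Rightarrow> real" assume X: "\<forall>i. X i \<in> {0<..} - {0}" "X \<longlonglongrightarrow> 0"
    show "(\<lambda>i. \<integral>y. ?\<kappa> (X i) (x - y) *\<^sub>R (f x - f y) \<partial>lborel) \<longlonglongrightarrow> hypersingular s f x"
    proof (rule kernel_approximation_tendsto_hypersingular[OF s f])
      show "integrable lborel (?\<kappa> (X n))" for n using X s by (intro integrable_jump_kernel_tail) auto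
      fix z :: "real ^ 'n" assume "z \<noteq> 0"
      then have "\<forall>\<^sub>F i in sequentially. X i < norm z" using X(2) by (intro order_tendstoD) auto
      then have "\<forall>\<^sub>F i in sequentially. ?\<kappa> (X i) z = jump_kernel s z"
        by eventually_elim simp
      then show "(\<lambda>i. ?\<kappa> (X i) z) \<longlonglongrightarrow> jump_kernel s z" by (rule tendsto_eventually)
    qed (auto simp: indicator_def)
  qed
qed simp

section \<open>Gaussian integrals\<close>

lemma cis_measurable [measurable]: "cis \<in> borel_measurable borel"
  by (intro borel_measurable_continuous_onI continuous_intros)

lemma integral_lborel_prod:
  fixes f :: "'a::euclidean_space \<Rightarrow> real \<Rightarrow> complex"
  assumes "\<And>b. b \<in> Basis \<Longrightarrow> integrable lborel (f b)"
  shows "(\<integral>x. (\<Prod>b\<in>Basis. f b (x \<bullet> b)) \<partial>lborel) = (\<Prod>b\<in>Basis. (\<integral>x. f b x \<partial>lborel))"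
proof -
  have [measurable]: "\<And>b. b \<in> Basis \<Longrightarrow> f b \<in> borel_measurable borel" using assms by auto
  interpret product_sigma_finite "\<lambda>_. lborel :: real measure" ..
  have "(\<integral>x. (\<Prod>b\<in>Basis. f b (x \<bullet> b)) \<partial>lborel)
      = (\<integral>g. (\<Prod>b\<in>Basis. f b ((\<Sum>b\<in>Basis. g b *\<^sub>R b) \<bullet> b)) \<partial>(\<Pi>\<^sub>M b\<in>(Basis::'a set). lborel))"
    by (subst lborel_eq) (simp add: integral_distr)
  also have "\<dots> = (\<integral>g. (\<Prod>b\<in>Basis. f b (g b)) \<partial>(\<Pi>\<^sub>M b\<in>(Basis::'a set). lborel))"
    by simp
  also have "\<dots> = (\<Prod>b\<in>Basis. (\<integral>x. f b x \<partial>lborel))"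
    by (rule product_integral_prod) (auto intro: assms)
  finally show ?thesis .
qed

definition gaussian :: "'a::euclidean_space \<Rightarrow> real" where
  "gaussian x = exp (- (norm x)\<^sup>2 / 2)"

lemma gaussian_measurable [measurable]: "gaussian \<in> borel_measurable borel"
  unfolding gaussian_def by measurable

lemma gaussian_nonneg [simp]: "0 \<le> gaussian x" and gaussian_le_1: "gaussian x \<le> 1" and gaussian_0 [simp]: "gaussian 0 = 1"
  by (simp_all add: gaussian_def)

lemma gaussian_prod: "gaussian (x :: 'a::euclidean_space) = (\<Prod>b\<in>Basis. exp (- (x \<bullet> b)\<^sup>2 / 2))"
proof -
  have "(norm x)\<^sup>2 = (\<Sum>b\<in>Basis. (x \<bullet> b)\<^sup>2)"
    unfolding power2_norm_eq_inner by (subst euclidean_inner) (simp add: power2_eq_square)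
  then show ?thesis by (simp add: gaussian_def exp_sum[symmetric] sum_negf sum_divide_distrib)
qed

text \<open>This is the characteristic function of the standard normal distribution, up to the factor \<open>sqrt (2 \<pi>)\<close>.\<close>

lemma integral_gaussian_cis_real:
  "integrable lborel (\<lambda>x::real. cis (t * x) * complex_of_real (exp (- x\<^sup>2 / 2)))"
  "(\<integral>x. cis (t * x) * complex_of_real (exp (- x\<^sup>2 / 2)) \<partial>lborel) = complex_of_real (sqrt (2 * pi) * exp (- t\<^sup>2 / 2))"
proof -
  have e: "exp (- x\<^sup>2 / 2) = sqrt (2 * pi) * std_normal_density x" for x
    by (simp add: std_normal_density_def)
  have i: "integrable lborel std_normal_density"
    using integrable_std_normal_moment[of 0] by simp
  show "integrable lborel (\<lambda>x::real. cis (t * x) * complex_of_real (exp (- x\<^sup>2 / 2)))"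
  proof (rule Bochner_Integration.integrable_bound)
    show "integrable lborel (\<lambda>x. sqrt (2 * pi) * std_normal_density x)" using i by simp
    show "AE x in lborel. norm (cis (t * x) * complex_of_real (exp (- x\<^sup>2 / 2))) \<le> norm (sqrt (2 * pi) * std_normal_density x)"
    proof (rule AE_I2)
      fix x :: real
      have "norm (cis (t * x) * complex_of_real (exp (- x\<^sup>2 / 2))) = exp (- x\<^sup>2 / 2)" by (simp add: norm_mult)
      then show "norm (cis (t * x) * complex_of_real (exp (- x\<^sup>2 / 2))) \<le> norm (sqrt (2 * pi) * std_normal_density x)"
        unfolding e real_norm_def by (metis abs_ge_self)
    qed
  qed measurable
  have "char std_normal_distribution t = (\<integral>x. std_normal_density x *\<^sub>R iexp (t * x) \<partial>lborel)"
    unfolding char_def by (rule integral_density) (auto simp: normal_density_nonneg)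
  then have c: "(\<integral>x. std_normal_density x *\<^sub>R iexp (t * x) \<partial>lborel) = complex_of_real (exp (- t\<^sup>2 / 2))"
    by (simp add: char_std_normal_distribution)
  have "cis (t * x) * complex_of_real (exp (- x\<^sup>2 / 2)) = sqrt (2 * pi) *\<^sub>R (std_normal_density x *\<^sub>R iexp (t * x))" for x
    by (simp only: e cis_conv_exp scaleR_conv_of_real of_real_mult) (simp only: mult_ac)
  then have "(\<integral>x. cis (t * x) * complex_of_real (exp (- x\<^sup>2 / 2)) \<partial>lborel)
      = (\<integral>x. sqrt (2 * pi) *\<^sub>R (std_normal_density x *\<^sub>R iexp (t * x)) \<partial>lborel)"
    by (simp only:)
  also have "\<dots> = sqrt (2 * pi) *\<^sub>R complex_of_real (exp (- t\<^sup>2 / 2))"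
    by (simp only: integral_scaleR_right c)
  finally show "(\<integral>x. cis (t * x) * complex_of_real (exp (- x\<^sup>2 / 2)) \<partial>lborel) = complex_of_real (sqrt (2 * pi) * exp (- t\<^sup>2 / 2))"
    by (simp add: scaleR_conv_of_real)
qed

lemma cis_sum: "finite A \<Longrightarrow> cis (\<Sum>a\<in>A. f a) = (\<Prod>a\<in>A. cis (f a))"
  by (induction rule: finite_induct) (auto simp: cis_mult[symmetric])

lemma integral_gaussian_cis:
  "(\<integral>x. cis (x \<bullet> \<xi>) * complex_of_real (gaussian x) \<partial>lborel)
     = complex_of_real (sqrt (2 * pi) ^ DIM('a) * gaussian (\<xi> :: 'a::euclidean_space))"
proof -
  have "cis (x \<bullet> \<xi>) * complex_of_real (gaussian x)
     = (\<Prod>b\<in>Basis. cis ((\<xi> \<bullet> b) * (x \<bullet> b)) * complex_of_real (exp (- (x \<bullet> b)\<^sup>2 / 2)))" for x :: 'a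
  proof -
    have "x \<bullet> \<xi> = (\<Sum>b\<in>Basis. (\<xi> \<bullet> b) * (x \<bullet> b))" by (subst euclidean_inner) (simp add: mult.commute)
    then show ?thesis by (simp add: gaussian_prod cis_sum prod.distrib)
  qed
  then have "(\<integral>x. cis (x \<bullet> \<xi>) * complex_of_real (gaussian x) \<partial>lborel)
     = (\<Prod>b\<in>(Basis :: 'a set). (\<integral>x. cis ((\<xi> \<bullet> b) * x) * complex_of_real (exp (- x\<^sup>2 / 2)) \<partial>lborel))"
    by (simp only: integral_lborel_prod[of "\<lambda>b x. cis ((\<xi> \<bullet> b) * x) * complex_of_real (exp (- x\<^sup>2 / 2))", OF integral_gaussian_cis_real(1)])
  also have "\<dots> = complex_of_real (sqrt (2 * pi) ^ DIM('a) * gaussian \<xi>)"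
    by (simp only: integral_gaussian_cis_real(2)) (simp add: prod.distrib gaussian_prod)
  finally show ?thesis .
qed

lemma integrable_gaussian: "integrable lborel (gaussian :: 'a::euclidean_space \<Rightarrow> real)"
proof (rule integrableI_nonneg)
  have "(\<integral>\<^sup>+x. ennreal (gaussian (x :: 'a)) \<partial>lborel) = (\<integral>\<^sup>+x. (\<Prod>b\<in>(Basis :: 'a set). ennreal (exp (- (x \<bullet> b)\<^sup>2 / 2))) \<partial>lborel)"
    by (simp add: gaussian_prod prod_ennreal)
  also have "\<dots> = (\<Prod>b\<in>(Basis :: 'a set). (\<integral>\<^sup>+x. ennreal (exp (- x\<^sup>2 / 2)) \<partial>lborel))"
    by (subst nn_integral_lborel_prod[of "\<lambda>b x. ennreal (exp (- x\<^sup>2 / 2))"]) auto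
  also have "\<dots> < \<infinity>"
  proof -
    have "integrable lborel (\<lambda>x. cis (0 * x) * complex_of_real (exp (- x\<^sup>2 / 2)))" by (rule integral_gaussian_cis_real)
    then have "(\<integral>\<^sup>+x. ennreal (norm (cis (0 * x) * complex_of_real (exp (- x\<^sup>2 / 2)))) \<partial>lborel) < \<infinity>"
      by (simp only: integrable_iff_bounded)
    then have "(\<integral>\<^sup>+x. ennreal (exp (- x\<^sup>2 / 2)) \<partial>lborel) < \<infinity>" by simp
    then show ?thesis by (simp add: power_less_top_ennreal)
  qed
  finally show "(\<integral>\<^sup>+x. ennreal (gaussian (x :: 'a)) \<partial>lborel) < \<infinity>" .
qed auto

lemma integral_gaussian: "(\<integral>x. gaussian (x :: 'a::euclidean_space) \<partial>lborel) = sqrt (2 * pi) ^ DIM('a)"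
proof -
  have "complex_of_real (\<integral>x. gaussian (x :: 'a) \<partial>lborel) = complex_of_real (sqrt (2 * pi) ^ DIM('a))"
    using integral_gaussian_cis[of "0 :: 'a"] by simp
  then show ?thesis by (simp only: of_real_eq_iff)
qed

section \<open>The Fourier transform of Schwartz functions\<close>

lemma has_vector_derivative_imp_quotient:
  assumes "(F has_vector_derivative v) (at (0::real))"
  shows "((\<lambda>t. (F t - F 0) /\<^sub>R t) \<longlongrightarrow> v) (at 0)"
proof -
  have "((\<lambda>t. norm (F (0 + t) - F 0 - t *\<^sub>R v) / norm t) \<longlongrightarrow> 0) (at 0)"
    using assms unfolding has_vector_derivative_def has_derivative_at by blast
  then have "((\<lambda>t. norm ((F t - F 0) /\<^sub>R t - v)) \<longlongrightarrow> 0) (at 0)"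
  proof (rule Lim_transform_eventually)
    have "norm (F (0 + t) - F 0 - t *\<^sub>R v) / norm t = norm ((F t - F 0) /\<^sub>R t - v)" if "t \<noteq> 0" for t
    proof -
      have "(F t - F 0) /\<^sub>R t - v = (F t - F 0 - t *\<^sub>R v) /\<^sub>R t" using that by (simp add: scaleR_diff_right)
      then show ?thesis by (simp add: divide_inverse mult.commute)
    qed
    then show "\<forall>\<^sub>F t in at 0. norm (F (0 + t) - F 0 - t *\<^sub>R v) / norm t = norm ((F t - F 0) /\<^sub>R t - v)"
      by (simp add: eventually_at_filter)
  qed
  then show ?thesis by (rule LIM_zero_cancel[OF tendsto_norm_zero_cancel])
qed

text \<open>The kernel \<open>capped_kernel (1/2) 1\<close> is \<open>max |x| 1\<close> to the power \<open>-N-1\<close>. It serves as the standard integrable majorant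
for rapidly decreasing functions.\<close>

lemma decay_le_capped_kernel:
  fixes f :: "real ^ 'n \<Rightarrow> 'b::real_normed_vector"
  assumes "norm (f x) \<le> C0" "norm x ^ (CARD('n) + 1) * norm (f x) \<le> C1"
  shows "norm (f x) \<le> (C0 + C1) * capped_kernel (1/2) 1 x"
proof -
  have C: "0 \<le> C0" "0 \<le> C1" using assms by (meson norm_ge_zero order_trans mult_nonneg_nonneg zero_le_power)+
  have k: "capped_kernel (1/2) 1 x = inverse (max (norm x) 1 ^ (CARD('n) + 1))"
    using powr_realpow[of "max (norm x) 1" "CARD('n) + 1"] by (simp add: capped_kernel_def add.commute)
  have "max (norm x) 1 ^ (CARD('n) + 1) * norm (f x) \<le> C0 + C1"
    using assms C by (cases "norm x \<le> 1") (auto simp: max_def)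
  then have "norm (f x) \<le> (C0 + C1) / max (norm x) 1 ^ (CARD('n) + 1)"
    by (subst pos_le_divide_eq) (auto simp: mult.commute intro!: zero_less_power)
  then show ?thesis unfolding k by (simp add: divide_inverse)
qed

lemma integrable_of_decay:
  fixes f :: "real ^ 'n \<Rightarrow> 'b::{banach, second_countable_topology}"
  assumes [measurable]: "f \<in> borel_measurable borel"
    and "\<And>x. norm (f x) \<le> C0" "\<And>x. norm x ^ (CARD('n) + 1) * norm (f x) \<le> C1"
  shows "integrable lborel f"
proof (rule Bochner_Integration.integrable_bound)
  show "integrable lborel (\<lambda>x :: real ^ 'n. (C0 + C1) * capped_kernel (1/2) 1 x)"
    by (intro integrable_mult_right integrable_capped_kernel) auto
  show "AE x in lborel. norm (f x) \<le> norm ((C0 + C1) * capped_kernel (1/2) 1 x)"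
    by (rule AE_I2) (metis abs_ge_self decay_le_capped_kernel[of f, OF assms(2,3)] order_trans real_norm_def)
qed simp

lemma iter_partial_deriv_append: "iter_partial_deriv (is @ js) f = iter_partial_deriv is (iter_partial_deriv js f)"
  by (induction "is") auto

lemma schwartz_iter_partial_deriv: "schwartz f \<Longrightarrow> schwartz (iter_partial_deriv js f)"
  unfolding schwartz_def smooth_def iter_partial_deriv_append[symmetric] by blast

lemma schwartz_bound:
  assumes "schwartz f" shows "\<exists>C. \<forall>x. norm x ^ k * norm (f x) \<le> C"
proof -
  have "\<exists>C. \<forall>x. norm x ^ k * norm (iter_partial_deriv [] f x) \<le> C"
    using assms unfolding schwartz_def by (elim conjE allE)
  then show ?thesis by simp
qed

lemma schwartz_borel: "schwartz f \<Longrightarrow> f \<in> borel_measurable borel"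
  by (simp add: schwartz_def smooth_borel)

lemma schwartz_decay:
  fixes f :: "real ^ 'n \<Rightarrow> complex"
  assumes "schwartz f"
  shows "\<exists>C\<ge>0. \<forall>x. norm (f x) \<le> C * capped_kernel (1/2) 1 x"
proof -
  obtain C0 where C0: "\<And>x. norm x ^ 0 * norm (f x) \<le> C0" using schwartz_bound[OF assms] by metis
  obtain C1 where C1: "\<And>x. norm x ^ (CARD('n) + 1) * norm (f x) \<le> C1" using schwartz_bound[OF assms] by metis
  have "norm (f 0) \<le> C0" using C0[of 0] by simp
  then have "0 \<le> C0" using norm_ge_zero order_trans by blast
  moreover have "0 \<le> C1" using C1[of 0] by simp
  ultimately show ?thesis
    using decay_le_capped_kernel[of f _ C0 C1] C0 C1 by (intro exI[of _ "C0 + C1"]) simp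
qed

lemma schwartz_integrable:
  fixes f :: "real ^ 'n \<Rightarrow> complex"
  assumes "schwartz f" shows "integrable lborel f"
proof -
  obtain C where C: "C \<ge> 0" "\<And>x. norm (f x) \<le> C * capped_kernel (1/2) 1 x" using schwartz_decay[OF assms] by blast
  have [measurable]: "f \<in> borel_measurable borel" using assms by (rule schwartz_borel)
  show ?thesis
  proof (rule Bochner_Integration.integrable_bound)
    show "integrable lborel (\<lambda>x :: real ^ 'n. C * capped_kernel (1/2) 1 x)"
      by (intro integrable_mult_right integrable_capped_kernel) auto
    show "AE x in lborel. norm (f x) \<le> norm (C * capped_kernel (1/2) 1 x)"
      using C by (intro AE_I2) simp
  qed simp
qed

lemma integrable_cis_mult:
  fixes f :: "'a::euclidean_space \<Rightarrow> complex"
  assumes "integrable lborel f" shows "integrable lborel (\<lambda>x. cis (x \<bullet> \<xi>) * f x)" "integrable lborel (\<lambda>x. cis (- (x \<bullet> \<xi>)) * f x)"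
  by (rule Bochner_Integration.integrable_bound[OF assms]; use assms in \<open>auto simp: norm_mult\<close>)+

lemma norm_fourier_le:
  "norm (fourier f \<xi>) \<le> (\<integral>x. norm (f x) \<partial>lborel)"
proof -
  have "norm (fourier f \<xi>) \<le> (\<integral>x. norm (cis (- (x \<bullet> \<xi>)) * f x) \<partial>lborel)"
    unfolding fourier_def by (rule integral_norm_bound)
  then show ?thesis by (simp add: norm_mult)
qed

lemma fourier_measurable:
  assumes [measurable]: "f \<in> borel_measurable borel"
  shows "fourier f \<in> borel_measurable borel"
  unfolding fourier_def[abs_def] by measurable

text \<open>The majorant changes only by a constant factor under translations of length at most \<open>1\<close>, so it also dominates the
difference quotients of a Schwartz function.\<close>

lemma capped_kernel_shift:
  fixes x :: "real ^ 'n"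
  assumes "norm v \<le> 1"
  shows "capped_kernel (1/2) 1 (x + v) \<le> 2 ^ (CARD('n) + 1) * capped_kernel (1/2) 1 x"
proof -
  have k: "capped_kernel (1/2) 1 x = inverse (max (norm x) 1 ^ (CARD('n) + 1))" for x :: "real ^ 'n"
    using powr_realpow[of "max (norm x) 1" "CARD('n) + 1"] by (simp add: capped_kernel_def add.commute)
  have "norm x \<le> norm (x + v) + 1" using norm_triangle_ineq4[of "x + v" v] assms by simp
  then have "max (norm x) 1 \<le> 2 * max (norm (x + v)) 1" by (simp add: max_def)
  then have "max (norm x) 1 ^ (CARD('n) + 1) \<le> (2 * max (norm (x + v)) 1) ^ (CARD('n) + 1)"
    by (intro power_mono) auto
  then have "max (norm x) 1 ^ (CARD('n) + 1) \<le> 2 ^ (CARD('n) + 1) * max (norm (x + v)) 1 ^ (CARD('n) + 1)"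
    by (simp only: power_mult_distrib)
  moreover have "0 < max (norm x) 1 ^ (CARD('n) + 1)" "0 < max (norm (x + v)) 1 ^ (CARD('n) + 1)"
    by (intro zero_less_power less_le_trans[OF zero_less_one max.cobounded2])+
  ultimately show ?thesis unfolding k by (simp only: inverse_eq_divide) (simp add: divide_simps mult_ac)
qed

text \<open>A translation by \<open>h\<close> in direction \<open>i\<close> multiplies the transform by \<open>cis (h \<xi>\<^sub>i)\<close>. Dividing by \<open>h\<close> and letting \<open>h \<rightarrow> 0\<close> under
the integral gives the rule by dominated convergence.\<close>

lemma fourier_partial_deriv:
  fixes f :: "real ^ 'n \<Rightarrow> complex"
  assumes f: "schwartz f"
  shows "fourier (partial_deriv i f) \<xi> = \<i> * complex_of_real (\<xi> $ i) * fourier f \<xi>"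
proof -
  let ?e = "axis i (1::real) :: real ^ 'n"
  define h where "h n = inverse (real (Suc n))" for n
  have h: "0 < h n" "h n \<le> 1" for n by (auto simp: h_def inverse_le_1_iff)
  have h0: "h \<longlonglongrightarrow> 0" unfolding h_def[abs_def] by (rule LIMSEQ_inverse_real_of_nat)
  have diff: "f differentiable (at x)" for x
    using f unfolding schwartz_def smooth_def by (metis iter_partial_deriv.simps(1))
  have g: "schwartz (partial_deriv i f)" using schwartz_iter_partial_deriv[OF f, of "[i]"] by simp
  have [measurable]: "f \<in> borel_measurable borel" "partial_deriv i f \<in> borel_measurable borel"
    using f g by (auto intro: schwartz_borel)
  obtain C where C: "C \<ge> 0" "\<And>x. norm (partial_deriv i f x) \<le> C * capped_kernel (1/2) 1 x"
    using schwartz_decay[OF g] by blast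
  have dir: "((\<lambda>t. f (x + t *\<^sub>R ?e)) has_vector_derivative partial_deriv i f (x + t *\<^sub>R ?e)) (at t within S)" for x t S
  proof -
    have "((\<lambda>t. f (x + t *\<^sub>R ?e)) has_derivative (\<lambda>h. frechet_derivative f (at (x + t *\<^sub>R ?e)) (h *\<^sub>R ?e))) (at t within S)"
      by (rule has_derivative_compose[OF _ diff[unfolded frechet_derivative_works]]) (auto intro!: derivative_eq_intros)
    then show ?thesis
      by (simp add: has_vector_derivative_def partial_deriv_def linear_scale[OF linear_frechet_derivative[OF diff]])
  qed
  define D where "D n x = (f (x + h n *\<^sub>R ?e) - f x) /\<^sub>R h n" for n x
  have D_bound: "norm (D n x) \<le> C * (2 ^ (CARD('n) + 1) * capped_kernel (1/2) 1 x)" for n x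
  proof -
    have "norm (f (x + h n *\<^sub>R ?e) - f (x + 0 *\<^sub>R ?e)) \<le> C * (2 ^ (CARD('n) + 1) * capped_kernel (1/2) 1 x) * norm (h n - 0)"
    proof (rule differentiable_bound[of "{0..1}" "\<lambda>t. f (x + t *\<^sub>R ?e)" "\<lambda>t h. h *\<^sub>R partial_deriv i f (x + t *\<^sub>R ?e)"])
      fix t :: real assume t: "t \<in> {0..1}"
      show "((\<lambda>t. f (x + t *\<^sub>R ?e)) has_derivative (\<lambda>h. h *\<^sub>R partial_deriv i f (x + t *\<^sub>R ?e))) (at t within {0..1})"
        using dir by (simp add: has_vector_derivative_def)
      have "norm (partial_deriv i f (x + t *\<^sub>R ?e)) \<le> C * capped_kernel (1/2) 1 (x + t *\<^sub>R ?e)" by (rule C)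
      also have "\<dots> \<le> C * (2 ^ (CARD('n) + 1) * capped_kernel (1/2) 1 x)"
        using t C(1) by (intro mult_left_mono capped_kernel_shift) (auto simp: norm_axis_1)
      finally show "onorm (\<lambda>h. h *\<^sub>R partial_deriv i f (x + t *\<^sub>R ?e)) \<le> C * (2 ^ (CARD('n) + 1) * capped_kernel (1/2) 1 x)"
        by (intro onorm_le) (simp only: norm_scaleR real_norm_def mult.commute[of "\<bar>_\<bar>"] mult_right_mono abs_ge_zero)
    qed (use h[of n] in auto)
    then have "norm (f (x + h n *\<^sub>R ?e) - f x) \<le> C * (2 ^ (CARD('n) + 1) * capped_kernel (1/2) 1 x) * h n"
      using h(1)[of n] by simp
    moreover have "norm (D n x) = norm (f (x + h n *\<^sub>R ?e) - f x) / h n"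
      using h(1)[of n] by (simp add: D_def divide_inverse mult.commute)
    ultimately show ?thesis using h(1)[of n] by (simp only: pos_divide_le_eq)
  qed
  have lim1: "(\<lambda>n. \<integral>x. cis (- (x \<bullet> \<xi>)) * D n x \<partial>lborel) \<longlonglongrightarrow> fourier (partial_deriv i f) \<xi>"
    unfolding fourier_def
  proof (rule integral_dominated_convergence)
    show "integrable lborel (\<lambda>x :: real ^ 'n. C * (2 ^ (CARD('n) + 1) * capped_kernel (1/2) 1 x))"
      by (intro integrable_mult_right integrable_capped_kernel) auto
    show "AE x in lborel. norm (cis (- (x \<bullet> \<xi>)) * D n x) \<le> C * (2 ^ (CARD('n) + 1) * capped_kernel (1/2) 1 x)" for n
      using D_bound by (simp add: norm_mult)
    show "AE x in lborel. (\<lambda>n. cis (- (x \<bullet> \<xi>)) * D n x) \<longlonglongrightarrow> cis (- (x \<bullet> \<xi>)) * partial_deriv i f x"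
    proof (intro AE_I2 tendsto_intros)
      fix x
      have "((\<lambda>t. f (x + t *\<^sub>R ?e)) has_vector_derivative partial_deriv i f (x + 0 *\<^sub>R ?e)) (at 0)" by (rule dir)
      from has_vector_derivative_imp_quotient[OF this]
      have "((\<lambda>t. (f (x + t *\<^sub>R ?e) - f x) /\<^sub>R t) \<longlongrightarrow> partial_deriv i f x) (at 0)" by simp
      moreover have "filterlim h (at 0) sequentially"
        using h0 h(1) by (auto simp: filterlim_at less_imp_neq[symmetric])
      ultimately show "(\<lambda>n. D n x) \<longlonglongrightarrow> partial_deriv i f x"
        unfolding D_def[abs_def] by (rule filterlim_compose)
    qed
  qed (auto simp: D_def)
  have eq: "(\<integral>x. cis (- (x \<bullet> \<xi>)) * D n x \<partial>lborel) = (cis (h n * \<xi> $ i) - 1) / complex_of_real (h n) * fourier f \<xi>" for n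
  proof -
    have int: "integrable lborel f" by (rule schwartz_integrable[OF f])
    have "(\<integral>x. cis (- (x \<bullet> \<xi>)) * f (x + h n *\<^sub>R ?e) \<partial>lborel)
        = (\<integral>x. cis (- ((- (h n *\<^sub>R ?e) + x) \<bullet> \<xi>)) * f (- (h n *\<^sub>R ?e) + x + h n *\<^sub>R ?e) \<partial>lborel)"
      by (subst integral_lborel_translate[of "\<lambda>x. cis (- (x \<bullet> \<xi>)) * f (x + h n *\<^sub>R ?e)"]) auto
    also have "\<dots> = (\<integral>x. cis (h n * \<xi> $ i) * (cis (- (x \<bullet> \<xi>)) * f x) \<partial>lborel)"
    proof (intro Bochner_Integration.integral_cong refl)
      fix x
      have "?e \<bullet> \<xi> = \<xi> $ i" by (subst inner_commute) (simp add: inner_axis)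
      then have "- ((- (h n *\<^sub>R ?e) + x) \<bullet> \<xi>) = h n * \<xi> $ i + - (x \<bullet> \<xi>)" by (simp add: inner_diff_left inner_add_left)
      then show "cis (- ((- (h n *\<^sub>R ?e) + x) \<bullet> \<xi>)) * f (- (h n *\<^sub>R ?e) + x + h n *\<^sub>R ?e) = cis (h n * \<xi> $ i) * (cis (- (x \<bullet> \<xi>)) * f x)"
        by (simp only: cis_mult[symmetric] mult.assoc) simp
    qed
    also have "\<dots> = cis (h n * \<xi> $ i) * fourier f \<xi>" by (simp add: fourier_def)
    finally have shift: "(\<integral>x. cis (- (x \<bullet> \<xi>)) * f (x + h n *\<^sub>R ?e) \<partial>lborel) = cis (h n * \<xi> $ i) * fourier f \<xi>" .
    have int': "integrable lborel (\<lambda>x. f (x + h n *\<^sub>R ?e))"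
    proof -
      have "integrable (distr lborel borel ((+) (h n *\<^sub>R ?e))) f" by (simp add: lborel_distr_plus int)
      then show ?thesis by (subst (asm) integrable_distr_eq) (auto simp: add.commute)
    qed
    have "(\<integral>x. cis (- (x \<bullet> \<xi>)) * D n x \<partial>lborel)
       = (\<integral>x. (cis (- (x \<bullet> \<xi>)) * f (x + h n *\<^sub>R ?e) - cis (- (x \<bullet> \<xi>)) * f x) /\<^sub>R h n \<partial>lborel)"
      by (intro Bochner_Integration.integral_cong) (auto simp: D_def algebra_simps)
    also have "\<dots> = ((\<integral>x. cis (- (x \<bullet> \<xi>)) * f (x + h n *\<^sub>R ?e) \<partial>lborel) - (\<integral>x. cis (- (x \<bullet> \<xi>)) * f x \<partial>lborel)) /\<^sub>R h n"
      by (simp only: integral_scaleR_right Bochner_Integration.integral_diff[OF integrable_cis_mult(2)[OF int'] integrable_cis_mult(2)[OF int]])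
    also have "\<dots> = (cis (h n * \<xi> $ i) * fourier f \<xi> - fourier f \<xi>) /\<^sub>R h n"
      unfolding shift by (simp add: fourier_def)
    also have "\<dots> = (cis (h n * \<xi> $ i) - 1) / complex_of_real (h n) * fourier f \<xi>"
      by (simp add: scaleR_conv_of_real field_simps)
    finally show ?thesis .
  qed
  have lim2: "(\<lambda>n. (cis (h n * \<xi> $ i) - 1) / complex_of_real (h n)) \<longlonglongrightarrow> \<i> * complex_of_real (\<xi> $ i)"
  proof -
    have "((\<lambda>z. exp (z * (\<i> * complex_of_real (\<xi> $ i)))) has_field_derivative (\<i> * complex_of_real (\<xi> $ i))) (at 0)"
      by (auto intro!: derivative_eq_intros)
    then have "((\<lambda>z. (exp (z * (\<i> * complex_of_real (\<xi> $ i))) - 1) / z) \<longlongrightarrow> \<i> * complex_of_real (\<xi> $ i)) (at 0)"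
      unfolding DERIV_def by simp
    moreover have "filterlim (\<lambda>n. complex_of_real (h n)) (at 0) sequentially"
      using tendsto_of_real[OF h0, where 'a = complex] h(1) by (auto simp: filterlim_at less_imp_neq[symmetric])
    ultimately have "(\<lambda>n. (exp (complex_of_real (h n) * (\<i> * complex_of_real (\<xi> $ i))) - 1) / complex_of_real (h n)) \<longlonglongrightarrow> \<i> * complex_of_real (\<xi> $ i)"
      by (rule filterlim_compose)
    then show ?thesis by (simp add: cis_conv_exp mult_ac)
  qed
  have "(\<lambda>n. \<integral>x. cis (- (x \<bullet> \<xi>)) * D n x \<partial>lborel) \<longlonglongrightarrow> \<i> * complex_of_real (\<xi> $ i) * fourier f \<xi>"
    unfolding eq by (intro tendsto_intros lim2)
  then show ?thesis using LIMSEQ_unique[OF lim1] by blast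
qed

lemma fourier_iterated:
  fixes f :: "real ^ 'n \<Rightarrow> complex"
  assumes f: "schwartz f"
  shows "fourier (iter_partial_deriv (replicate k i) f) \<xi> = (\<i> * complex_of_real (\<xi> $ i)) ^ k * fourier f \<xi>"
proof (induction k)
  case (Suc k)
  then show ?case
    using fourier_partial_deriv[OF schwartz_iter_partial_deriv[OF f, of "replicate k i"], of i \<xi>] by simp
qed simp

text \<open>Some coordinate satisfies \<open>|\<xi>\<^sub>i| \<ge> |\<xi>| / N\<close>, and \<open>|\<xi>\<^sub>i|\<^sup>k\<close> times the transform is the transform of the \<open>k\<close>-th partial
derivative in direction \<open>i\<close>, which is bounded.\<close>

lemma fourier_decay:
  fixes f :: "real ^ 'n \<Rightarrow> complex"
  assumes f: "schwartz f"
  shows "\<exists>C. \<forall>\<xi>. norm \<xi> ^ k * norm (fourier f \<xi>) \<le> C"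
proof -
  define c where "c i = (\<integral>x. norm (iter_partial_deriv (replicate k i) f x) \<partial>lborel)" for i
  have c: "\<bar>\<xi> $ i\<bar> ^ k * norm (fourier f \<xi>) \<le> c i" for i \<xi>
    using norm_fourier_le[of "iter_partial_deriv (replicate k i) f" \<xi>]
    by (simp add: fourier_iterated[OF f] c_def norm_mult norm_power)
  have c0: "0 \<le> c i" for i by (simp add: c_def)
  have "norm \<xi> ^ k * norm (fourier f \<xi>) \<le> real CARD('n) ^ k * (\<Sum>i\<in>UNIV. c i)" for \<xi>
  proof -
    have "\<exists>i. norm \<xi> \<le> real CARD('n) * \<bar>\<xi> $ i\<bar>"
    proof (rule ccontr)
      assume "\<not> (\<exists>i. norm \<xi> \<le> real CARD('n) * \<bar>\<xi> $ i\<bar>)"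
      then have *: "real CARD('n) * \<bar>\<xi> $ i\<bar> < norm \<xi>" for i by (simp add: not_le)
      have "real CARD('n) * norm \<xi> \<le> real CARD('n) * (\<Sum>i\<in>UNIV. \<bar>\<xi> $ i\<bar>)"
        by (intro mult_left_mono norm_le_l1_cart) simp
      also have "\<dots> = (\<Sum>i\<in>UNIV. real CARD('n) * \<bar>\<xi> $ i\<bar>)" by (rule sum_distrib_left)
      also have "\<dots> < (\<Sum>i\<in>(UNIV :: 'n set). norm \<xi>)" using * by (intro sum_strict_mono) auto
      finally show False by simp
    qed
    then obtain i where i: "norm \<xi> \<le> real CARD('n) * \<bar>\<xi> $ i\<bar>" by blast
    have "norm \<xi> ^ k * norm (fourier f \<xi>) \<le> (real CARD('n) * \<bar>\<xi> $ i\<bar>) ^ k * norm (fourier f \<xi>)"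
      using i by (intro mult_right_mono power_mono) auto
    also have "\<dots> = real CARD('n) ^ k * (\<bar>\<xi> $ i\<bar> ^ k * norm (fourier f \<xi>))" by (simp add: power_mult_distrib)
    also have "\<dots> \<le> real CARD('n) ^ k * c i" by (intro mult_left_mono c) simp
    also have "\<dots> \<le> real CARD('n) ^ k * (\<Sum>i\<in>UNIV. c i)"
      using c0 by (intro mult_left_mono member_le_sum) auto
    finally show ?thesis .
  qed
  then show ?thesis by blast
qed

lemma integrable_powr_fourier:
  fixes f :: "real ^ 'n \<Rightarrow> complex"
  assumes f: "schwartz f" and p: "0 < p"
  shows "integrable lborel (\<lambda>\<xi>. norm \<xi> powr p *\<^sub>R fourier f \<xi>)" "integrable lborel (fourier f)"
proof -
  have [measurable]: "fourier f \<in> borel_measurable borel" using f by (intro fourier_measurable schwartz_borel)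
  obtain C where C: "\<And>k \<xi>. norm \<xi> ^ k * norm (fourier f \<xi>) \<le> C k"
    using fourier_decay[OF f] by metis
  show "integrable lborel (fourier f)"
    using C[of _ 0] C[of _ "CARD('n) + 1"] by (intro integrable_of_decay) auto
  \<comment> \<open>The real power is compared with an integer one, for which the decay is known.\<close>
  define m where "m = nat \<lceil>p\<rceil>"
  have pm: "p \<le> real m" unfolding m_def by (rule real_nat_ceiling_ge)
  have le: "norm \<xi> powr p \<le> 1 + norm \<xi> ^ m" for \<xi> :: "real ^ 'n"
  proof (cases "norm \<xi> \<le> 1")
    case True
    then have "norm \<xi> powr p \<le> 1" using p by (intro powr_le1) auto
    then show ?thesis by (simp add: add_increasing2)
  next
    case False
    then have "norm \<xi> powr p \<le> norm \<xi> powr real m" using pm by (intro powr_mono) auto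
    also have "\<dots> = norm \<xi> ^ m" using False by (intro powr_realpow) auto
    finally show ?thesis by simp
  qed
  show "integrable lborel (\<lambda>\<xi>. norm \<xi> powr p *\<^sub>R fourier f \<xi>)"
  proof (rule integrable_of_decay)
    fix \<xi> :: "real ^ 'n"
    have "norm (norm \<xi> powr p *\<^sub>R fourier f \<xi>) \<le> (1 + norm \<xi> ^ m) * norm (fourier f \<xi>)"
      using le[of \<xi>] by (simp add: mult_right_mono)
    also have "\<dots> \<le> C 0 + C m" using C[of \<xi> 0] C[of \<xi> m] by (simp add: algebra_simps)
    finally show "norm (norm \<xi> powr p *\<^sub>R fourier f \<xi>) \<le> C 0 + C m" .
    have "norm \<xi> ^ (CARD('n) + 1) * norm (norm \<xi> powr p *\<^sub>R fourier f \<xi>)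
        \<le> norm \<xi> ^ (CARD('n) + 1) * ((1 + norm \<xi> ^ m) * norm (fourier f \<xi>))"
      using le[of \<xi>] by (intro mult_left_mono) (auto simp: mult_right_mono)
    also have "\<dots> = norm \<xi> ^ (CARD('n) + 1) * norm (fourier f \<xi>) + norm \<xi> ^ (CARD('n) + 1 + m) * norm (fourier f \<xi>)"
      by (simp only: power_add algebra_simps)
    also have "\<dots> \<le> C (CARD('n) + 1) + C (CARD('n) + 1 + m)" by (intro add_mono C)
    finally show "norm \<xi> ^ (CARD('n) + 1) * norm (norm \<xi> powr p *\<^sub>R fourier f \<xi>) \<le> C (CARD('n) + 1) + C (CARD('n) + 1 + m)" .
  qed measurable
qed

section \<open>Fourier inversion\<close>

lemma integral_scaled_gaussian_cis:
  fixes v :: "'a::euclidean_space"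
  assumes \<epsilon>: "\<epsilon> > 0"
  shows "(\<integral>\<xi>. cis (v \<bullet> \<xi>) * complex_of_real (gaussian (\<epsilon> *\<^sub>R \<xi>)) \<partial>lborel)
     = complex_of_real ((sqrt (2 * pi) / \<epsilon>) ^ DIM('a) * gaussian (v /\<^sub>R \<epsilon>))"
proof -
  have "complex_of_real (sqrt (2 * pi) ^ DIM('a) * gaussian (v /\<^sub>R \<epsilon>))
     = (\<integral>x. cis (x \<bullet> (v /\<^sub>R \<epsilon>)) * complex_of_real (gaussian x) \<partial>lborel)"
    by (rule integral_gaussian_cis[symmetric])
  also have "\<dots> = (\<bar>\<epsilon>\<bar> ^ DIM('a)) *\<^sub>R (\<integral>x. cis ((\<epsilon> *\<^sub>R x) \<bullet> (v /\<^sub>R \<epsilon>)) * complex_of_real (gaussian (\<epsilon> *\<^sub>R x)) \<partial>lborel)"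
    by (rule integral_lborel_scale) (use \<epsilon> in auto)
  also have "(\<lambda>x. cis ((\<epsilon> *\<^sub>R x) \<bullet> (v /\<^sub>R \<epsilon>)) * complex_of_real (gaussian (\<epsilon> *\<^sub>R x)))
      = (\<lambda>x. cis (v \<bullet> x) * complex_of_real (gaussian (\<epsilon> *\<^sub>R x)))"
    using \<epsilon> by (simp add: inner_commute mult.assoc[symmetric])
  finally have "complex_of_real (sqrt (2 * pi) ^ DIM('a) * gaussian (v /\<^sub>R \<epsilon>))
     = \<epsilon> ^ DIM('a) *\<^sub>R (\<integral>x. cis (v \<bullet> x) * complex_of_real (gaussian (\<epsilon> *\<^sub>R x)) \<partial>lborel)"
    using \<epsilon> by simp
  then show ?thesis using \<epsilon> by (simp add: scaleR_conv_of_real power_divide field_simps)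
qed

lemma integrable_gaussian_scaled:
  assumes "\<epsilon> > 0" shows "integrable lborel (\<lambda>\<xi> :: 'a::euclidean_space. gaussian (\<epsilon> *\<^sub>R \<xi>))"
proof -
  have "(\<integral>\<^sup>+x. ennreal (gaussian (x :: 'a)) \<partial>lborel) = ennreal (\<bar>\<epsilon>\<bar> ^ DIM('a)) * (\<integral>\<^sup>+x. ennreal (gaussian (\<epsilon> *\<^sub>R (x :: 'a))) \<partial>lborel)"
    by (rule nn_integral_lborel_scale) (use assms in auto)
  moreover have "(\<integral>\<^sup>+x. ennreal (gaussian (x :: 'a)) \<partial>lborel) < \<infinity>"
    using integrable_gaussian[where 'a = 'a] by (simp add: integrable_iff_bounded)
  ultimately have "(\<integral>\<^sup>+x. ennreal (gaussian (\<epsilon> *\<^sub>R (x :: 'a))) \<partial>lborel) < \<infinity>"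
    using assms by (auto simp: ennreal_mult_less_top)
  then show ?thesis by (intro integrableI_nonneg) auto
qed

text \<open>The integral of \<open>cis (x \<bullet> \<xi>)\<close> times the transform is damped by \<open>gaussian (\<epsilon> \<xi>)\<close>. By Fubini the damped integral is the
average of \<open>f (x - \<epsilon> z)\<close> against a Gaussian in \<open>z\<close>, and both forms converge as \<open>\<epsilon> \<rightarrow> 0\<close>.\<close>

lemma fourier_inversion:
  fixes f :: "real ^ 'n \<Rightarrow> complex"
  assumes f: "schwartz f"
  shows "inverse_fourier (fourier f) x = f x"
proof -
  define \<epsilon> where "\<epsilon> n = inverse (real (Suc n))" for n
  have \<epsilon>: "0 < \<epsilon> n" for n by (simp add: \<epsilon>_def)
  have \<epsilon>0: "\<epsilon> \<longlonglongrightarrow> 0" unfolding \<epsilon>_def[abs_def] by (rule LIMSEQ_inverse_real_of_nat)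
  have [measurable]: "f \<in> borel_measurable borel" using f by (rule schwartz_borel)
  have [measurable]: "fourier f \<in> borel_measurable borel" by (rule fourier_measurable) measurable
  have int: "integrable lborel f" by (rule schwartz_integrable[OF f])
  have intF: "integrable lborel (fourier f)" by (rule integrable_powr_fourier(2)[OF f zero_less_one])
  define I where "I n = (\<integral>\<xi>. cis (x \<bullet> \<xi>) * fourier f \<xi> * complex_of_real (gaussian (\<epsilon> n *\<^sub>R \<xi>)) \<partial>lborel)" for n
  have lim1: "I \<longlonglongrightarrow> (\<integral>\<xi>. cis (x \<bullet> \<xi>) * fourier f \<xi> \<partial>lborel)"
    unfolding I_def[abs_def]
  proof (rule integral_dominated_convergence[where w = "\<lambda>\<xi>. norm (fourier f \<xi>)"])
    show "integrable lborel (\<lambda>\<xi>. norm (fourier f \<xi>))" by (rule integrable_norm[OF intF])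
    show "AE \<xi> in lborel. norm (cis (x \<bullet> \<xi>) * fourier f \<xi> * complex_of_real (gaussian (\<epsilon> n *\<^sub>R \<xi>))) \<le> norm (fourier f \<xi>)" for n
      by (rule AE_I2) (simp add: norm_mult gaussian_le_1 mult_left_le)
    show "AE \<xi> in lborel. (\<lambda>n. cis (x \<bullet> \<xi>) * fourier f \<xi> * complex_of_real (gaussian (\<epsilon> n *\<^sub>R \<xi>))) \<longlonglongrightarrow> cis (x \<bullet> \<xi>) * fourier f \<xi>"
    proof (rule AE_I2)
      fix \<xi> :: "real ^ 'n"
      have "(\<lambda>n. exp (- (norm (\<epsilon> n *\<^sub>R \<xi>))\<^sup>2 / 2)) \<longlonglongrightarrow> exp (- (norm (0 *\<^sub>R \<xi>))\<^sup>2 / 2)"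
        by (intro tendsto_intros \<epsilon>0) simp
      then have "(\<lambda>n. gaussian (\<epsilon> n *\<^sub>R \<xi>)) \<longlonglongrightarrow> 1" by (simp add: gaussian_def)
      then have "(\<lambda>n. cis (x \<bullet> \<xi>) * fourier f \<xi> * complex_of_real (gaussian (\<epsilon> n *\<^sub>R \<xi>))) \<longlonglongrightarrow> cis (x \<bullet> \<xi>) * fourier f \<xi> * complex_of_real 1"
        by (intro tendsto_intros)
      then show "(\<lambda>n. cis (x \<bullet> \<xi>) * fourier f \<xi> * complex_of_real (gaussian (\<epsilon> n *\<^sub>R \<xi>))) \<longlonglongrightarrow> cis (x \<bullet> \<xi>) * fourier f \<xi>"
        by simp
    qed
  qed measurable
  have I_eq: "I n = (\<integral>z. complex_of_real (sqrt (2 * pi) ^ CARD('n)) * (f (x - \<epsilon> n *\<^sub>R z) * complex_of_real (gaussian z)) \<partial>lborel)" for n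
  proof -
    let ?h = "\<lambda>(\<xi>, y). cis (x \<bullet> \<xi>) * (cis (- (y \<bullet> \<xi>)) * f y) * complex_of_real (gaussian (\<epsilon> n *\<^sub>R \<xi>))"
    have "I n = (\<integral>\<xi>. (\<integral>y. cis (x \<bullet> \<xi>) * (cis (- (y \<bullet> \<xi>)) * f y) * complex_of_real (gaussian (\<epsilon> n *\<^sub>R \<xi>)) \<partial>lborel) \<partial>lborel)"
      unfolding I_def fourier_def by simp
    also have "\<dots> = (\<integral>y. (\<integral>\<xi>. cis (x \<bullet> \<xi>) * (cis (- (y \<bullet> \<xi>)) * f y) * complex_of_real (gaussian (\<epsilon> n *\<^sub>R \<xi>)) \<partial>lborel) \<partial>lborel)"
    proof (rule lborel_pair.Fubini_integral[symmetric], rule lborel_pair.Fubini_integrable)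
      show "integrable lborel (\<lambda>\<xi>. \<integral>y. norm (?h (\<xi>, y)) \<partial>lborel)"
        using integrable_gaussian_scaled[OF \<epsilon>[of n], where 'a = "real ^ 'n"] by (simp add: norm_mult)
      show "AE \<xi> in lborel. integrable lborel (\<lambda>y. ?h (\<xi>, y))"
      proof (rule AE_I2)
        fix \<xi> :: "real ^ 'n"
        show "integrable lborel (\<lambda>y. ?h (\<xi>, y))"
          using integrable_cis_mult(2)[OF int, of \<xi>] by simp
      qed
    qed measurable
    also have "\<dots> = (\<integral>y. f y * complex_of_real ((sqrt (2 * pi) / \<epsilon> n) ^ CARD('n) * gaussian ((x - y) /\<^sub>R \<epsilon> n)) \<partial>lborel)"
    proof (intro Bochner_Integration.integral_cong refl)
      fix y
      have "(\<lambda>\<xi>. cis (x \<bullet> \<xi>) * (cis (- (y \<bullet> \<xi>)) * f y) * complex_of_real (gaussian (\<epsilon> n *\<^sub>R \<xi>)))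
          = (\<lambda>\<xi>. f y * (cis ((x - y) \<bullet> \<xi>) * complex_of_real (gaussian (\<epsilon> n *\<^sub>R \<xi>))))"
      proof (rule ext)
        fix \<xi>
        have "cis ((x - y) \<bullet> \<xi>) = cis (x \<bullet> \<xi>) * cis (- (y \<bullet> \<xi>))" by (simp add: cis_mult inner_diff_left)
        then show "cis (x \<bullet> \<xi>) * (cis (- (y \<bullet> \<xi>)) * f y) * complex_of_real (gaussian (\<epsilon> n *\<^sub>R \<xi>))
          = f y * (cis ((x - y) \<bullet> \<xi>) * complex_of_real (gaussian (\<epsilon> n *\<^sub>R \<xi>)))"
          by (simp only: mult_ac)
      qed
      then show "(\<integral>\<xi>. cis (x \<bullet> \<xi>) * (cis (- (y \<bullet> \<xi>)) * f y) * complex_of_real (gaussian (\<epsilon> n *\<^sub>R \<xi>)) \<partial>lborel)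
         = f y * complex_of_real ((sqrt (2 * pi) / \<epsilon> n) ^ CARD('n) * gaussian ((x - y) /\<^sub>R \<epsilon> n))"
        using integral_scaled_gaussian_cis[OF \<epsilon>[of n], of "x - y"] by simp
    qed
    also have "\<dots> = (\<integral>y. f (x - y) * complex_of_real ((sqrt (2 * pi) / \<epsilon> n) ^ CARD('n) * gaussian (y /\<^sub>R \<epsilon> n)) \<partial>lborel)"
      by (subst integral_lborel_reflect[of _ x, symmetric]) simp_all
    also have "\<dots> = (\<bar>\<epsilon> n\<bar> ^ DIM(real ^ 'n)) *\<^sub>R (\<integral>z. f (x - \<epsilon> n *\<^sub>R z) * complex_of_real ((sqrt (2 * pi) / \<epsilon> n) ^ CARD('n) * gaussian ((\<epsilon> n *\<^sub>R z) /\<^sub>R \<epsilon> n)) \<partial>lborel)"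
      by (rule integral_lborel_scale) (use \<epsilon>[of n] in auto)
    also have "\<dots> = (\<integral>z. (\<epsilon> n ^ CARD('n)) *\<^sub>R (f (x - \<epsilon> n *\<^sub>R z) * complex_of_real ((sqrt (2 * pi) / \<epsilon> n) ^ CARD('n) * gaussian ((\<epsilon> n *\<^sub>R z) /\<^sub>R \<epsilon> n))) \<partial>lborel)"
      using \<epsilon>[of n] by simp
    also have "\<dots> = (\<integral>z. complex_of_real (sqrt (2 * pi) ^ CARD('n)) * (f (x - \<epsilon> n *\<^sub>R z) * complex_of_real (gaussian z)) \<partial>lborel)"
    proof (intro Bochner_Integration.integral_cong refl)
      fix z :: "real ^ 'n"
      have g: "gaussian ((\<epsilon> n *\<^sub>R z) /\<^sub>R \<epsilon> n) = gaussian z" using \<epsilon>[of n] by simp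
      have c: "complex_of_real (\<epsilon> n ^ CARD('n)) * complex_of_real ((sqrt (2 * pi) / \<epsilon> n) ^ CARD('n)) = complex_of_real (sqrt (2 * pi) ^ CARD('n))"
        using \<epsilon>[of n] by (simp add: power_divide)
      show "(\<epsilon> n ^ CARD('n)) *\<^sub>R (f (x - \<epsilon> n *\<^sub>R z) * complex_of_real ((sqrt (2 * pi) / \<epsilon> n) ^ CARD('n) * gaussian ((\<epsilon> n *\<^sub>R z) /\<^sub>R \<epsilon> n)))
        = complex_of_real (sqrt (2 * pi) ^ CARD('n)) * (f (x - \<epsilon> n *\<^sub>R z) * complex_of_real (gaussian z))"
        unfolding g c[symmetric] by (simp only: scaleR_conv_of_real[where 'a = complex] of_real_mult mult_ac)
    qed
    finally show ?thesis .
  qed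
  have lim2: "I \<longlonglongrightarrow> (\<integral>z. complex_of_real (sqrt (2 * pi) ^ CARD('n)) * (f x * complex_of_real (gaussian (z :: real ^ 'n))) \<partial>lborel)"
    unfolding I_eq
  proof -
    obtain M where M: "\<And>x. norm (f x) \<le> M" using schwartz_bound[OF f, of 0] by auto
    let ?c = "complex_of_real (sqrt (2 * pi) ^ CARD('n))"
    show "(\<lambda>n. \<integral>z. ?c * (f (x - \<epsilon> n *\<^sub>R z) * complex_of_real (gaussian z)) \<partial>lborel)
      \<longlonglongrightarrow> (\<integral>z. ?c * (f x * complex_of_real (gaussian (z :: real ^ 'n))) \<partial>lborel)"
    proof (rule integral_dominated_convergence[where w = "\<lambda>z. norm ?c * M * gaussian z"])
      show "integrable lborel (\<lambda>z :: real ^ 'n. norm ?c * M * gaussian z)"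
        by (intro integrable_mult_right integrable_gaussian)
      show "AE z in lborel. norm (?c * (f (x - \<epsilon> n *\<^sub>R z) * complex_of_real (gaussian z))) \<le> norm ?c * M * gaussian z" for n
      proof (rule AE_I2)
        fix z :: "real ^ 'n"
        have "norm ?c * (norm (f (x - \<epsilon> n *\<^sub>R z)) * gaussian z) \<le> norm ?c * (M * gaussian z)"
          by (intro mult_left_mono mult_right_mono M) auto
        then show "norm (?c * (f (x - \<epsilon> n *\<^sub>R z) * complex_of_real (gaussian z))) \<le> norm ?c * M * gaussian z"
          by (simp add: norm_mult mult_ac)
      qed
      show "AE z in lborel. (\<lambda>n. ?c * (f (x - \<epsilon> n *\<^sub>R z) * complex_of_real (gaussian z))) \<longlonglongrightarrow> ?c * (f x * complex_of_real (gaussian z))"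
      proof (intro AE_I2 tendsto_mult tendsto_const)
        fix z :: "real ^ 'n"
        have "continuous_on UNIV f" using f by (simp add: schwartz_def smooth_continuous)
        moreover have "(\<lambda>n. x - \<epsilon> n *\<^sub>R z) \<longlonglongrightarrow> x - 0 *\<^sub>R z" by (intro tendsto_intros \<epsilon>0)
        ultimately have "(\<lambda>n. f (x - \<epsilon> n *\<^sub>R z)) \<longlonglongrightarrow> f (x - 0 *\<^sub>R z)"
          by (rule continuous_on_tendsto_compose) auto
        then show "(\<lambda>n. f (x - \<epsilon> n *\<^sub>R z)) \<longlonglongrightarrow> f x" by simp
      qed
    qed measurable
  qed
  have "(\<integral>z. complex_of_real (sqrt (2 * pi) ^ CARD('n)) * (f x * complex_of_real (gaussian (z :: real ^ 'n))) \<partial>lborel)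
     = complex_of_real (sqrt (2 * pi) ^ CARD('n)) * (f x * complex_of_real (sqrt (2 * pi) ^ CARD('n)))"
    using integral_gaussian[where 'a = "real ^ 'n"] by simp
  also have "\<dots> = complex_of_real ((sqrt (2 * pi) * sqrt (2 * pi)) ^ CARD('n)) * f x"
    by (simp only: power_mult_distrib of_real_mult mult_ac)
  also have "\<dots> = complex_of_real ((2 * pi) ^ CARD('n)) * f x" by simp
  finally have "(\<integral>\<xi>. cis (x \<bullet> \<xi>) * fourier f \<xi> \<partial>lborel) = complex_of_real ((2 * pi) ^ CARD('n)) * f x"
    using LIMSEQ_unique[OF lim1 lim2] by simp
  then show ?thesis by (simp add: inverse_fourier_def scaleR_conv_of_real field_simps)
qed

section \<open>The symbol of the operator\<close>

text \<open>The factor \<open>c\<close> in \<open>\<integral> (1 - cos (z \<bullet> \<xi>)) |z|\<^bsup>-N-2s\<^esup> dz = c |\<xi>|\<^sup>2\<^sup>s\<close>, obtained from one unit vector \<open>\<xi>\<close>. It is the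
reciprocal of the normalization constant of the fractional Laplacian.\<close>

definition symbol_const :: "'n::finite itself \<Rightarrow> real \<Rightarrow> real" where
  "symbol_const _ s = (\<integral>z. jump_kernel s z * (1 - cos (z \<bullet> (axis undefined 1 :: real ^ 'n))) \<partial>lborel)"

lemma one_minus_cos_le: "1 - cos t \<le> 2 * min 1 (t\<^sup>2)" for t :: real
proof -
  have "1 - cos t = 2 * (sin (t / 2))\<^sup>2" using cos_double_sin[of "t/2"] by simp
  moreover have "\<bar>sin (t / 2)\<bar> \<le> \<bar>t / 2\<bar>" by (rule abs_sin_x_le_abs_x)
  then have "(sin (t / 2))\<^sup>2 \<le> (t / 2)\<^sup>2" using power_mono[of "\<bar>sin (t / 2)\<bar>" "\<bar>t / 2\<bar>" 2] by (simp only: power2_abs abs_ge_zero simp_thms)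
  then have "4 * (sin (t/2))\<^sup>2 \<le> t\<^sup>2" by (simp add: power_divide)
  then have "2 * (sin (t/2))\<^sup>2 \<le> 2 * t\<^sup>2" using zero_le_power2[of "sin (t/2)"] by linarith
  moreover have "(sin (t / 2))\<^sup>2 \<le> 1" by (simp add: abs_square_le_1)
  ultimately show ?thesis by (simp add: min_def)
qed

lemma integrable_symbol:
  assumes s: "0 < s" "s < 1"
  shows "integrable lborel (\<lambda>z :: real ^ 'n. jump_kernel s z * (1 - cos (z \<bullet> \<xi>)))"
proof (rule Bochner_Integration.integrable_bound)
  let ?C = "2 * (1 + (norm \<xi>)\<^sup>2)"
  show "integrable lborel (\<lambda>z :: real ^ 'n. ?C * (min 1 (norm z ^ 2) * jump_kernel s z))"
    by (intro integrable_mult_right integrable_jump_kernel_second_order s)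
  show "AE z in lborel. norm (jump_kernel s z * (1 - cos (z \<bullet> \<xi>))) \<le> norm (?C * (min 1 (norm z ^ 2) * jump_kernel s z))"
  proof (rule AE_I2)
    fix z :: "real ^ 'n"
    have "(z \<bullet> \<xi>)\<^sup>2 \<le> (norm z * norm \<xi>)\<^sup>2"
      using power_mono[OF Cauchy_Schwarz_ineq2[of z \<xi>] abs_ge_zero, of 2] by (simp only: power2_abs)
    then have 1: "min 1 ((z \<bullet> \<xi>)\<^sup>2) \<le> min 1 ((norm \<xi>)\<^sup>2 * (norm z)\<^sup>2)" by (auto simp: power_mult_distrib mult.commute)
    have 2: "min 1 ((norm \<xi>)\<^sup>2 * (norm z)\<^sup>2) \<le> (1 + (norm \<xi>)\<^sup>2) * min 1 ((norm z)\<^sup>2)"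
    proof (cases "1 \<le> (norm z)\<^sup>2")
      case True
      then show ?thesis by (simp add: min_le_iff_disj)
    next
      case False
      have "min 1 ((norm \<xi>)\<^sup>2 * (norm z)\<^sup>2) \<le> (norm \<xi>)\<^sup>2 * (norm z)\<^sup>2" by simp
      also have "\<dots> \<le> (1 + (norm \<xi>)\<^sup>2) * (norm z)\<^sup>2" by (simp add: distrib_right)
      finally show ?thesis using False by (simp add: min_def)
    qed
    have "1 - cos (z \<bullet> \<xi>) \<le> ?C * min 1 ((norm z)\<^sup>2)"
      using one_minus_cos_le[of "z \<bullet> \<xi>"] 1 2 by linarith
    then have "jump_kernel s z * (1 - cos (z \<bullet> \<xi>)) \<le> jump_kernel s z * (?C * min 1 ((norm z)\<^sup>2))"
      by (intro mult_left_mono) auto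
    then show "norm (jump_kernel s z * (1 - cos (z \<bullet> \<xi>))) \<le> norm (?C * (min 1 (norm z ^ 2) * jump_kernel s z))"
      by (simp add: abs_mult mult_ac)
  qed
qed measurable

text \<open>A rotation takes \<open>\<xi> / |\<xi>|\<close> to the unit vector in the definition of \<open>symbol_const\<close>, and the substitution \<open>z \<mapsto> z / |\<xi>|\<close>
produces the power \<open>2s\<close> from the homogeneity of the kernel.\<close>

lemma jump_kernel_symbol:
  fixes \<xi> :: "real ^ 'n"
  assumes s: "0 < s" "s < 1"
  shows "(\<integral>z. jump_kernel s z * (1 - cos (z \<bullet> \<xi>)) \<partial>lborel) = symbol_const TYPE('n) s * norm \<xi> powr (2 * s)"
proof (cases "\<xi> = 0")
  case False
  let ?e = "axis undefined 1 :: real ^ 'n"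
  define r where "r = norm \<xi>"
  have r: "r > 0" using False by (simp add: r_def)
  have "norm (\<xi> /\<^sub>R r) = norm ?e" using r by (simp add: r_def)
  then obtain T where T: "orthogonal_transformation T" "T (\<xi> /\<^sub>R r) = ?e"
    using orthogonal_transformation_exists by blast
  have lin: "linear T" using T(1) by (simp add: orthogonal_transformation_def)
  have [measurable]: "T \<in> borel_measurable borel"
    using lin by (intro borel_measurable_continuous_onI linear_continuous_on) (simp add: linear_conv_bounded_linear)
  define H where "H z = jump_kernel s z * (1 - cos (r * (z \<bullet> ?e)))" for z
  have [measurable]: "H \<in> borel_measurable borel" unfolding H_def by measurable
  have "jump_kernel s z * (1 - cos (z \<bullet> \<xi>)) = H (T z)" for z
  proof -
    have "z \<bullet> (\<xi> /\<^sub>R r) = T z \<bullet> T (\<xi> /\<^sub>R r)" using T(1) by (simp add: orthogonal_transformation_def)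
    then have "z \<bullet> \<xi> = r * (T z \<bullet> ?e)" using r T(2) by (simp add: field_simps)
    moreover have "jump_kernel s (T z) = jump_kernel s z" using T(1) by (simp add: jump_kernel_def orthogonal_transformation_norm)
    ultimately show ?thesis by (simp add: H_def)
  qed
  then have "(\<integral>z. jump_kernel s z * (1 - cos (z \<bullet> \<xi>)) \<partial>lborel) = (\<integral>z. H (T z) \<partial>lborel)" by simp
  also have "\<dots> = (\<integral>z. H z \<partial>lborel)"
    by (subst (2) lborel_distr_orthogonal[OF T(1), symmetric]) (simp add: integral_distr)
  also have "\<dots> = \<bar>inverse r\<bar> ^ CARD('n) * (\<integral>z. H (inverse r *\<^sub>R z) \<partial>lborel)"
    using r integral_lborel_scale[of H "inverse r"] by simp
  also have "(\<lambda>z. H (inverse r *\<^sub>R z)) = (\<lambda>z. inverse r powr (- real CARD('n) - 2 * s) * (jump_kernel s z * (1 - cos (z \<bullet> ?e))))"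
    using r by (auto simp: H_def jump_kernel_scale mult.assoc[symmetric])
  also have "\<bar>inverse r\<bar> ^ CARD('n) * (\<integral>z. inverse r powr (- real CARD('n) - 2 * s) * (jump_kernel s z * (1 - cos (z \<bullet> ?e))) \<partial>lborel)
      = (inverse r powr real CARD('n) * inverse r powr (- real CARD('n) - 2 * s)) * symbol_const TYPE('n) s"
    using r by (simp add: symbol_const_def powr_realpow)
  also have "inverse r powr real CARD('n) * inverse r powr (- real CARD('n) - 2 * s) = inverse r powr (- (2 * s))"
    by (simp add: powr_add[symmetric])
  also have "inverse r powr (- (2 * s)) = r powr (2 * s)" using r by (simp add: powr_minus inverse_powr)
  finally show ?thesis by (simp add: r_def mult.commute)
qed simp

lemma symbol_const_pos:
  assumes s: "0 < s" "s < 1"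
  shows "0 < symbol_const TYPE('n::finite) s"
proof -
  let ?e = "axis undefined 1 :: real ^ 'n"
  let ?h = "\<lambda>z :: real ^ 'n. jump_kernel s z * (1 - cos (z \<bullet> ?e))"
  have int: "integrable lborel ?h" by (rule integrable_symbol[OF s])
  have nn: "0 \<le> ?h z" for z by simp
  have "(\<integral>z. ?h z \<partial>lborel) \<noteq> 0"
  proof
    assume "(\<integral>z. ?h z \<partial>lborel) = 0"
    then have "AE z in lborel. ?h z = 0"
      using integral_nonneg_eq_0_iff_AE[OF int] nn by auto
    moreover have "?h z \<noteq> 0" if "z \<in> ball ?e (1/2)" for z
    proof -
      have "\<bar>(z - ?e) \<bullet> ?e\<bar> \<le> norm (z - ?e) * norm ?e" by (rule Cauchy_Schwarz_ineq2)
      also have "\<dots> < 1/2" using that by (simp add: dist_norm norm_minus_commute)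
      finally have "\<bar>z \<bullet> ?e - 1\<bar> < 1/2" by (simp add: inner_diff_left inner_axis_axis)
      then have "0 < z \<bullet> ?e" "z \<bullet> ?e < 3/2" by linarith+
      then have t: "0 < z \<bullet> ?e" "z \<bullet> ?e < pi" using pi_gt3 by auto
      then have "cos (z \<bullet> ?e) < cos 0" by (intro cos_monotone_0_pi) auto
      moreover have "z \<noteq> 0" using t by auto
      ultimately show ?thesis by (simp add: jump_kernel_def)
    qed
    ultimately have "AE z in lborel. z \<notin> ball ?e (1/2)" by (elim eventually_mono) blast
    then have "emeasure lborel (ball ?e (1/2)) = 0"
      by (subst (asm) AE_iff_measurable[of "ball ?e (1/2)"]) auto
    moreover have "measure lborel (ball ?e (1/2)) > 0" by (rule content_ball_pos) simp
    ultimately show False by (simp add: measure_def)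
  qed
  then show ?thesis using Bochner_Integration.integral_nonneg[of lborel ?h] nn by (simp add: symbol_const_def less_le)
qed

text \<open>By Fourier inversion the second difference of \<open>f\<close> is the inverse transform of \<open>2 (1 - cos (z \<bullet> \<xi>))\<close> times the transform
of \<open>f\<close>. Integration over \<open>z\<close> first replaces this factor by the symbol.\<close>

lemma hypersingular_eq_multiplier:
  fixes f :: "real ^ 'n \<Rightarrow> complex"
  assumes s: "0 < s" "s < 1" and f: "schwartz f"
  shows "hypersingular s f x = symbol_const TYPE('n) s *\<^sub>R inverse_fourier (\<lambda>\<xi>. norm \<xi> powr (2 * s) *\<^sub>R fourier f \<xi>) x"
proof -
  let ?c = "(2 * pi) ^ CARD('n) :: real"
  have [measurable]: "f \<in> borel_measurable borel" using f by (rule schwartz_borel)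
  have [measurable]: "fourier f \<in> borel_measurable borel" by (rule fourier_measurable) measurable
  have intF: "integrable lborel (fourier f)" by (rule integrable_powr_fourier(2)[OF f zero_less_one])
  have intc: "integrable lborel (\<lambda>\<xi>. cis (x \<bullet> \<xi>) * fourier f \<xi>)" for x
    using integrable_cis_mult(1)[OF intF, of x] by (simp add: inner_commute)
  have inv: "f x = (\<integral>\<xi>. cis (x \<bullet> \<xi>) * fourier f \<xi> \<partial>lborel) /\<^sub>R ?c" for x
    using fourier_inversion[OF f, of x] by (simp add: inverse_fourier_def)
  have second: "2 *\<^sub>R f x - f (x + z) - f (x - z)
      = (\<integral>\<xi>. (2 * (1 - cos (z \<bullet> \<xi>))) *\<^sub>R (cis (x \<bullet> \<xi>) * fourier f \<xi>) \<partial>lborel) /\<^sub>R ?c" for z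
  proof -
    have "2 *\<^sub>R f x - f (x + z) - f (x - z)
      = (2 *\<^sub>R (\<integral>\<xi>. cis (x \<bullet> \<xi>) * fourier f \<xi> \<partial>lborel) - (\<integral>\<xi>. cis ((x + z) \<bullet> \<xi>) * fourier f \<xi> \<partial>lborel)
          - (\<integral>\<xi>. cis ((x - z) \<bullet> \<xi>) * fourier f \<xi> \<partial>lborel)) /\<^sub>R ?c"
      by (subst (1 2 3) inv) (simp add: scaleR_diff_right)
    also have "2 *\<^sub>R (\<integral>\<xi>. cis (x \<bullet> \<xi>) * fourier f \<xi> \<partial>lborel) - (\<integral>\<xi>. cis ((x + z) \<bullet> \<xi>) * fourier f \<xi> \<partial>lborel)
          - (\<integral>\<xi>. cis ((x - z) \<bullet> \<xi>) * fourier f \<xi> \<partial>lborel)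
       = (\<integral>\<xi>. 2 *\<^sub>R (cis (x \<bullet> \<xi>) * fourier f \<xi>) - cis ((x + z) \<bullet> \<xi>) * fourier f \<xi> - cis ((x - z) \<bullet> \<xi>) * fourier f \<xi> \<partial>lborel)"
      using intc by (simp only: Bochner_Integration.integral_diff Bochner_Integration.integrable_diff integrable_scaleR_right integral_scaleR_right)
    also have "\<dots> = (\<integral>\<xi>. (2 * (1 - cos (z \<bullet> \<xi>))) *\<^sub>R (cis (x \<bullet> \<xi>) * fourier f \<xi>) \<partial>lborel)"
    proof (intro Bochner_Integration.integral_cong refl)
      fix \<xi>
      have "cis (z \<bullet> \<xi>) + cis (- (z \<bullet> \<xi>)) = complex_of_real (2 * cos (z \<bullet> \<xi>))" by (simp add: complex_eq_iff)
      then have *: "cis (- (z \<bullet> \<xi>)) = complex_of_real (2 * cos (z \<bullet> \<xi>)) - cis (z \<bullet> \<xi>)" by (simp add: algebra_simps)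
      have "cis ((x - z) \<bullet> \<xi>) = cis (x \<bullet> \<xi>) * cis (- (z \<bullet> \<xi>))" by (simp add: cis_mult inner_diff_left)
      moreover have "cis ((x + z) \<bullet> \<xi>) = cis (x \<bullet> \<xi>) * cis (z \<bullet> \<xi>)" by (simp add: cis_mult inner_add_left)
      ultimately show "2 *\<^sub>R (cis (x \<bullet> \<xi>) * fourier f \<xi>) - cis ((x + z) \<bullet> \<xi>) * fourier f \<xi> - cis ((x - z) \<bullet> \<xi>) * fourier f \<xi>
        = (2 * (1 - cos (z \<bullet> \<xi>))) *\<^sub>R (cis (x \<bullet> \<xi>) * fourier f \<xi>)"
        by (simp only: *) (simp add: scaleR_conv_of_real algebra_simps)
    qed
    finally show ?thesis .
  qed
  let ?G = "\<lambda>\<xi> z. (jump_kernel s z * (1 - cos (z \<bullet> \<xi>))) *\<^sub>R (cis (x \<bullet> \<xi>) * fourier f \<xi>)"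
  have "hypersingular s f x = (\<integral>z. jump_kernel s z *\<^sub>R ((\<integral>\<xi>. (2 * (1 - cos (z \<bullet> \<xi>))) *\<^sub>R (cis (x \<bullet> \<xi>) * fourier f \<xi>) \<partial>lborel) /\<^sub>R ?c) \<partial>lborel) /\<^sub>R 2"
    by (simp only: hypersingular_def second)
  also have "\<dots> = (\<integral>z. (2 / ?c) *\<^sub>R (\<integral>\<xi>. ?G \<xi> z \<partial>lborel) \<partial>lborel) /\<^sub>R 2"
  proof -
    have "jump_kernel s z *\<^sub>R ((\<integral>\<xi>. (2 * (1 - cos (z \<bullet> \<xi>))) *\<^sub>R (cis (x \<bullet> \<xi>) * fourier f \<xi>) \<partial>lborel) /\<^sub>R ?c)
       = (2 / ?c) *\<^sub>R (\<integral>\<xi>. ?G \<xi> z \<partial>lborel)" for z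
    proof -
      have "(\<integral>\<xi>. (2 * (1 - cos (z \<bullet> \<xi>))) *\<^sub>R (cis (x \<bullet> \<xi>) * fourier f \<xi>) \<partial>lborel)
         = 2 *\<^sub>R (\<integral>\<xi>. (1 - cos (z \<bullet> \<xi>)) *\<^sub>R (cis (x \<bullet> \<xi>) * fourier f \<xi>) \<partial>lborel)"
        by (simp only: scaleR_scaleR[symmetric] integral_scaleR_right)
      moreover have "(\<integral>\<xi>. ?G \<xi> z \<partial>lborel) = jump_kernel s z *\<^sub>R (\<integral>\<xi>. (1 - cos (z \<bullet> \<xi>)) *\<^sub>R (cis (x \<bullet> \<xi>) * fourier f \<xi>) \<partial>lborel)"
        by (simp only: scaleR_scaleR[symmetric] integral_scaleR_right)
      ultimately show ?thesis by (simp add: divide_inverse mult_ac)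
    qed
    then show ?thesis by (simp only:)
  qed
  also have "\<dots> = (\<integral>z. (\<integral>\<xi>. ?G \<xi> z \<partial>lborel) \<partial>lborel) /\<^sub>R ?c"
  proof -
    have "inverse 2 * (2 / c) = inverse c" for c :: real by (cases "c = 0") (simp_all add: field_simps)
    then show ?thesis by (simp only: integral_scaleR_right scaleR_scaleR)
  qed
  also have "(\<integral>z. (\<integral>\<xi>. ?G \<xi> z \<partial>lborel) \<partial>lborel) = (\<integral>\<xi>. (\<integral>z. ?G \<xi> z \<partial>lborel) \<partial>lborel)"
  proof (rule lborel_pair.Fubini_integral, rule lborel_pair.Fubini_integrable)
    have "(\<integral>z. norm (?G \<xi> z) \<partial>lborel) = symbol_const TYPE('n) s * norm (norm \<xi> powr (2 * s) *\<^sub>R fourier f \<xi>)" for \<xi>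
    proof -
      have "(\<integral>z. norm (?G \<xi> z) \<partial>lborel) = (\<integral>z. jump_kernel s z * (1 - cos (z \<bullet> \<xi>)) * norm (fourier f \<xi>) \<partial>lborel)"
        by (intro Bochner_Integration.integral_cong refl) (simp add: norm_mult abs_mult)
      also have "\<dots> = (\<integral>z. jump_kernel s z * (1 - cos (z \<bullet> \<xi>)) \<partial>lborel) * norm (fourier f \<xi>)" by simp
      finally show ?thesis by (simp only: jump_kernel_symbol[OF s]) simp
    qed
    then show "integrable lborel (\<lambda>\<xi>. \<integral>z. norm ((\<lambda>(\<xi>, z). ?G \<xi> z) (\<xi>, z)) \<partial>lborel)"
      using integrable_powr_fourier(1)[OF f, of "2 * s"] s by (simp only: prod.case) (intro integrable_mult_right integrable_norm, simp)
    show "AE \<xi> in lborel. integrable lborel (\<lambda>z. (\<lambda>(\<xi>, z). ?G \<xi> z) (\<xi>, z))"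
      by (rule AE_I2) (simp only: prod.case, intro integrable_scaleR_left integrable_symbol s)
  qed measurable
  also have "(\<integral>\<xi>. (\<integral>z. ?G \<xi> z \<partial>lborel) \<partial>lborel)
      = (\<integral>\<xi>. symbol_const TYPE('n) s *\<^sub>R (cis (x \<bullet> \<xi>) * (norm \<xi> powr (2 * s) *\<^sub>R fourier f \<xi>)) \<partial>lborel)"
    by (intro Bochner_Integration.integral_cong refl, subst integral_scaleR_left)
       (simp_all add: integrable_symbol[OF s] jump_kernel_symbol[OF s])
  also have "\<dots> /\<^sub>R ?c = symbol_const TYPE('n) s *\<^sub>R inverse_fourier (\<lambda>\<xi>. norm \<xi> powr (2 * s) *\<^sub>R fourier f \<xi>) x"
    unfolding inverse_fourier_def integral_scaleR_right by (rule scaleR_left_commute)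
  finally show ?thesis .
qed

section \<open>The normalization constant\<close>

text \<open>Partial derivatives map the products of a polynomial and the Gaussian to themselves. The next lemmas make this
precise in order to show that the Gaussian is a Schwartz function.\<close>

lemma real_polynomial_function_derivative:
  fixes p :: "'a::real_normed_vector \<Rightarrow> real"
  assumes "real_polynomial_function p"
  shows "\<exists>q. (\<forall>x. (p has_derivative (\<lambda>h. q h x)) (at x)) \<and> (\<forall>h. real_polynomial_function (q h))"
  using assms
proof (induction rule: real_polynomial_function.induct)
  case (linear f)
  then show ?case
    by (intro exI[of _ "\<lambda>h x. f h"]) (auto intro: bounded_linear_imp_has_derivative)
next
  case (const c)
  show ?case by (intro exI[of _ "\<lambda>h x. 0"]) auto
next
  case (add f g)
  then obtain qf qg where "\<And>x. (f has_derivative (\<lambda>h. qf h x)) (at x)" "\<And>h. real_polynomial_function (qf h)"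
      "\<And>x. (g has_derivative (\<lambda>h. qg h x)) (at x)" "\<And>h. real_polynomial_function (qg h)" by blast
  then show ?case by (intro exI[of _ "\<lambda>h x. qf h x + qg h x"]) (auto intro: has_derivative_add)
next
  case (mult f g)
  then obtain qf qg where q: "\<And>x. (f has_derivative (\<lambda>h. qf h x)) (at x)" "\<And>h. real_polynomial_function (qf h)"
      "\<And>x. (g has_derivative (\<lambda>h. qg h x)) (at x)" "\<And>h. real_polynomial_function (qg h)" by blast
  have "((\<lambda>x. f x * g x) has_derivative (\<lambda>h. f x * qg h x + qf h x * g x)) (at x)" for x
    using has_derivative_mult[OF q(1,3)] .
  moreover have "real_polynomial_function (\<lambda>x. f x * qg h x + qf h x * g x)" for h
    by (rule real_polynomial_function.intros(3)[OF real_polynomial_function.intros(4)[OF mult.hyps(1) q(4)]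
          real_polynomial_function.intros(4)[OF q(2) mult.hyps(2)]])
  ultimately show ?case by (intro exI[of _ "\<lambda>h x. f x * qg h x + qf h x * g x"] conjI allI)
qed

lemma real_polynomial_function_growth:
  fixes p :: "'a::real_normed_vector \<Rightarrow> real"
  assumes "real_polynomial_function p"
  shows "\<exists>C k. C \<ge> 0 \<and> (\<forall>x. \<bar>p x\<bar> \<le> C * (1 + norm x) ^ k)"
  using assms
proof (induction rule: real_polynomial_function.induct)
  case (linear f)
  then obtain K where K: "K > 0" "\<And>x. norm (f x) \<le> norm x * K" using bounded_linear.pos_bounded by blast
  have "\<bar>f x\<bar> \<le> K * (1 + norm x) ^ 1" for x
    using K(2)[of x] K(1) by (simp add: algebra_simps)
  then show ?case using K(1) by (intro exI[of _ K] exI[of _ 1]) auto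
next
  case (const c)
  show ?case by (intro exI[of _ "\<bar>c\<bar>"] exI[of _ 0]) auto
next
  case (add f g)
  then obtain C k C' k' where *: "C \<ge> 0" "\<And>x. \<bar>f x\<bar> \<le> C * (1 + norm x) ^ k" "C' \<ge> 0" "\<And>x. \<bar>g x\<bar> \<le> C' * (1 + norm x) ^ k'" by blast
  have "\<bar>f x + g x\<bar> \<le> (C + C') * (1 + norm x) ^ (k + k')" for x
  proof -
    have "\<bar>f x\<bar> \<le> C * (1 + norm x) ^ (k + k')"
      using *(1) by (intro order_trans[OF *(2)] mult_left_mono power_increasing) auto
    moreover have "\<bar>g x\<bar> \<le> C' * (1 + norm x) ^ (k + k')"
      using *(3) by (intro order_trans[OF *(4)] mult_left_mono power_increasing) auto
    ultimately show ?thesis using abs_triangle_ineq[of "f x" "g x"] by (simp add: distrib_right)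
  qed
  then show ?case using *(1,3) by (intro exI[of _ "C + C'"] exI[of _ "k + k'"]) auto
next
  case (mult f g)
  then obtain C k C' k' where *: "C \<ge> 0" "\<And>x. \<bar>f x\<bar> \<le> C * (1 + norm x) ^ k" "C' \<ge> 0" "\<And>x. \<bar>g x\<bar> \<le> C' * (1 + norm x) ^ k'" by blast
  have "\<bar>f x * g x\<bar> \<le> (C * C') * (1 + norm x) ^ (k + k')" for x
  proof -
    have "\<bar>f x\<bar> * \<bar>g x\<bar> \<le> (C * (1 + norm x) ^ k) * (C' * (1 + norm x) ^ k')"
      using *(1) by (intro mult_mono *(2,4)) auto
    then show ?thesis by (simp add: abs_mult power_add mult_ac)
  qed
  then show ?case using *(1,3) by (intro exI[of _ "C * C'"] exI[of _ "k + k'"]) auto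
qed

lemma power_le_fact_exp:
  fixes t :: real
  assumes "0 \<le> t" shows "t ^ n \<le> fact n * exp t"
proof -
  have sums: "summable (\<lambda>k. t ^ k /\<^sub>R fact k)" by (rule summable_exp_generic)
  have "(\<Sum>k\<in>{n}. t ^ k /\<^sub>R fact k) \<le> (\<Sum>k. t ^ k /\<^sub>R fact k)"
    by (rule sum_le_suminf[OF sums]) (use assms in auto)
  then show ?thesis by (simp add: exp_def field_simps)
qed

lemma polynomial_times_gaussian_bounded:
  fixes p :: "'a::euclidean_space \<Rightarrow> real"
  assumes "real_polynomial_function p"
  shows "\<exists>C. \<forall>x. norm x ^ m * \<bar>p x * gaussian x\<bar> \<le> C"
proof -
  obtain C k where C: "C \<ge> 0" "\<And>x. \<bar>p x\<bar> \<le> C * (1 + norm x) ^ k"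
    using real_polynomial_function_growth[OF assms] by blast
  have "norm x ^ m * \<bar>p x * gaussian x\<bar> \<le> C * (fact (m + k) * exp (3/2))" for x
  proof -
    have "norm x ^ m * \<bar>p x * gaussian x\<bar> = norm x ^ m * \<bar>p x\<bar> * gaussian x" by (simp add: abs_mult)
    also have "\<dots> \<le> (1 + norm x) ^ m * (C * (1 + norm x) ^ k) * gaussian x"
      by (intro mult_right_mono mult_mono power_mono C) auto
    also have "\<dots> = C * ((1 + norm x) ^ (m + k) * gaussian x)" by (simp add: power_add mult_ac)
    also have "\<dots> \<le> C * (fact (m + k) * exp (1 + norm x) * gaussian x)"
      by (intro mult_left_mono mult_right_mono power_le_fact_exp C) auto
    also have "\<dots> = C * (fact (m + k) * exp (1 + norm x - (norm x)\<^sup>2 / 2))"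
      by (simp add: gaussian_def mult_exp_exp mult.assoc)
    also have "\<dots> \<le> C * (fact (m + k) * exp (3/2))"
    proof -
      have "0 \<le> (norm x - 1)\<^sup>2" by simp
      then have "1 + norm x - (norm x)\<^sup>2 / 2 \<le> 3/2" by (simp add: power2_diff)
      then show ?thesis using C(1) by (intro mult_left_mono) auto
    qed
    finally show ?thesis .
  qed
  then show ?thesis by blast
qed

lemma gaussian_has_derivative: "(gaussian has_derivative (\<lambda>h. - (x \<bullet> h) * gaussian x)) (at x)"
proof -
  have "((\<lambda>x. exp (- (x \<bullet> x) / 2)) has_derivative (\<lambda>h. - (x \<bullet> h) * exp (- (x \<bullet> x) / 2))) (at x)"
    by (auto intro!: derivative_eq_intros simp: inner_commute)
  then show ?thesis by (simp add: gaussian_def[abs_def] power2_norm_eq_inner)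
qed

lemma polynomial_times_gaussian_partial_deriv:
  fixes p :: "real ^ 'n \<Rightarrow> real"
  assumes "real_polynomial_function p"
  shows "(\<lambda>x. complex_of_real (p x * gaussian x)) differentiable (at x)"
    and "\<exists>p'. real_polynomial_function p' \<and>
      partial_deriv i (\<lambda>x. complex_of_real (p x * gaussian x)) = (\<lambda>x. complex_of_real (p' x * gaussian x))"
proof -
  obtain q where q: "\<And>x. (p has_derivative (\<lambda>h. q h x)) (at x)" "\<And>h. real_polynomial_function (q h)"
    using real_polynomial_function_derivative[OF assms] by blast
  have D: "((\<lambda>x. complex_of_real (p x * gaussian x)) has_derivative
      (\<lambda>h. complex_of_real (p x * (- (x \<bullet> h) * gaussian x) + q h x * gaussian x))) (at x)" for x
    by (intro has_derivative_of_real has_derivative_mult q(1) gaussian_has_derivative)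
  then show "(\<lambda>x. complex_of_real (p x * gaussian x)) differentiable (at x)" by (rule differentiableI)
  define p' where "p' x = q (axis i 1) x - p x * (x \<bullet> axis i 1)" for x
  have "bounded_linear (\<lambda>x :: real ^ 'n. x \<bullet> axis i 1)" by (rule bounded_linear_inner_left)
  then have "real_polynomial_function p'" unfolding p'_def[abs_def]
    by (rule real_polynomial_function_diff[OF q(2) real_polynomial_function.intros(4)[OF assms real_polynomial_function.intros(1)]])
  moreover have "partial_deriv i (\<lambda>x. complex_of_real (p x * gaussian x)) x = complex_of_real (p' x * gaussian x)" for x
    unfolding partial_deriv_def frechet_derivative_at[OF D, symmetric] by (simp add: p'_def algebra_simps)
  ultimately show "\<exists>p'. real_polynomial_function p' \<and>
      partial_deriv i (\<lambda>x. complex_of_real (p x * gaussian x)) = (\<lambda>x. complex_of_real (p' x * gaussian x))" by blast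
qed

lemma schwartz_gaussian: "schwartz (\<lambda>x :: real ^ 'n. complex_of_real (gaussian x))"
proof -
  have "\<exists>p. real_polynomial_function p \<and>
     iter_partial_deriv is (\<lambda>x :: real ^ 'n. complex_of_real (gaussian x)) = (\<lambda>x. complex_of_real (p x * gaussian x))" for "is"
  proof (induction "is")
    case Nil
    show ?case by (intro exI[of _ "\<lambda>_. 1"]) auto
  next
    case (Cons i "is")
    then show ?case using polynomial_times_gaussian_partial_deriv(2) by fastforce
  qed
  then obtain p where p: "\<And>is. real_polynomial_function (p is)"
     "\<And>is. iter_partial_deriv is (\<lambda>x :: real ^ 'n. complex_of_real (gaussian x)) = (\<lambda>x. complex_of_real (p is x * gaussian x))"
    by metis
  show ?thesis
    unfolding schwartz_def smooth_def p(2) norm_of_real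
    using polynomial_times_gaussian_partial_deriv(1)[OF p(1)] polynomial_times_gaussian_bounded[OF p(1)] by blast
qed

text \<open>The Gaussian has its strict maximum at \<open>0\<close>. One Schwartz function with a nonzero value is what makes the
normalization constant unique.\<close>

lemma hypersingular_gaussian_nonzero:
  assumes s: "0 < s" "s < 1"
  shows "hypersingular s (\<lambda>x :: real ^ 'n. complex_of_real (gaussian x)) 0 \<noteq> 0"
proof
  let ?h = "\<lambda>z :: real ^ 'n. jump_kernel s z * (2 - 2 * gaussian z)"
  have eq: "jump_kernel s z *\<^sub>R (2 *\<^sub>R complex_of_real (gaussian 0) - complex_of_real (gaussian (0 + z)) - complex_of_real (gaussian (0 - z))) = complex_of_real (?h z)" for z :: "real ^ 'n"
    by (simp add: gaussian_def scaleR_conv_of_real)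
  have int: "integrable lborel (\<lambda>z. complex_of_real (?h z))"
    using integrable_second_difference[OF s schwartz_bounded_smooth[OF schwartz_gaussian], of "0 :: real ^ 'n"] unfolding eq .
  then have int': "integrable lborel ?h" by (simp only: complex_of_real_integrable_eq)
  assume "hypersingular s (\<lambda>x :: real ^ 'n. complex_of_real (gaussian x)) 0 = 0"
  then have "(\<integral>z. complex_of_real (?h z) \<partial>lborel) = 0" unfolding hypersingular_def eq by simp
  then have "(\<integral>z. ?h z \<partial>lborel) = 0" by (simp only: integral_complex_of_real of_real_eq_0_iff)
  moreover have nn: "0 \<le> ?h z" for z by (simp add: gaussian_le_1)
  ultimately have "AE z in lborel. ?h z = 0" using integral_nonneg_eq_0_iff_AE[OF int'] by auto
  moreover have "?h z \<noteq> 0" if "z \<in> ball (axis undefined 1) (1/2)" for z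
  proof -
    have "z \<noteq> 0" using that by (auto simp: dist_norm)
    then show ?thesis by (simp add: gaussian_def jump_kernel_def)
  qed
  ultimately have "AE z in lborel. z \<notin> ball (axis undefined 1 :: real ^ 'n) (1/2)"
    by (elim eventually_mono) blast
  then have "emeasure lborel (ball (axis undefined 1 :: real ^ 'n) (1/2)) = 0"
    by (subst (asm) AE_iff_measurable[of "ball (axis undefined 1 :: real ^ 'n) (1/2)"]) auto
  moreover have "measure lborel (ball (axis undefined 1 :: real ^ 'n) (1/2)) > 0" by (rule content_ball_pos) simp
  ultimately show False by (simp add: measure_def)
qed

text \<open>The constant is introduced by a definite description, so a statement about its sign needs the existence and the
uniqueness of the described number; it is \<open>1 / symbol_const\<close>.\<close>

lemma frac_laplacian_const_pos:
  assumes s: "0 < s" "s < 1"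
  shows "0 < frac_laplacian_const TYPE('n::finite) s"
proof -
  let ?P = "\<lambda>a. a > 0 \<and> (\<forall>u :: real ^ 'n \<Rightarrow> complex. schwartz u \<longrightarrow>
           (\<forall>x. a *\<^sub>R pv_integral s u x = inverse_fourier (\<lambda>\<xi>. (norm \<xi> powr (2 * s)) *\<^sub>R fourier u \<xi>) x))"
  have c: "0 < symbol_const TYPE('n) s" by (rule symbol_const_pos[OF s])
  have pv: "pv_integral s u x = symbol_const TYPE('n) s *\<^sub>R inverse_fourier (\<lambda>\<xi>. norm \<xi> powr (2 * s) *\<^sub>R fourier u \<xi>) x"
    if "schwartz u" for u :: "real ^ 'n \<Rightarrow> complex" and x
    using pv_integral_eq_hypersingular[OF s schwartz_bounded_smooth[OF that]] hypersingular_eq_multiplier[OF s that] by simp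
  have "?P (inverse (symbol_const TYPE('n) s))" using c by (simp add: pv)
  moreover have "a = inverse (symbol_const TYPE('n) s)" if a: "?P a" for a
  proof -
    let ?g = "\<lambda>x :: real ^ 'n. complex_of_real (gaussian x)"
    have nz: "pv_integral s ?g 0 \<noteq> 0"
      using pv_integral_eq_hypersingular[OF s schwartz_bounded_smooth[OF schwartz_gaussian]] hypersingular_gaussian_nonzero[OF s] by metis
    let ?X = "inverse_fourier (\<lambda>\<xi>. (norm \<xi> powr (2 * s)) *\<^sub>R fourier ?g \<xi>) 0"
    have "a *\<^sub>R pv_integral s ?g 0 = ?X" using a schwartz_gaussian by blast
    moreover have "inverse (symbol_const TYPE('n) s) *\<^sub>R pv_integral s ?g 0 = ?X"
      using c by (simp add: pv[OF schwartz_gaussian])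
    ultimately have "a *\<^sub>R pv_integral s ?g 0 = inverse (symbol_const TYPE('n) s) *\<^sub>R pv_integral s ?g 0" by simp
    then show ?thesis using nz by simp
  qed
  ultimately have "frac_laplacian_const TYPE('n) s = inverse (symbol_const TYPE('n) s)"
    unfolding frac_laplacian_const_def by (intro the_equality)
  then show ?thesis using c by simp
qed

section \<open>Exterior balls at the boundary\<close>

lemma C11_on_lipschitz_on_bounded:
  fixes e :: "real ^ 'n"
  assumes "C11_on {y. y \<bullet> e = 0} \<gamma>"
  obtains \<Lambda> where "\<Lambda> \<ge> 0" "\<And>x y. x \<bullet> e = 0 \<Longrightarrow> y \<bullet> e = 0 \<Longrightarrow> norm x \<le> R \<Longrightarrow> norm y \<le> R
    \<Longrightarrow> \<bar>\<gamma> x - \<gamma> y\<bar> \<le> \<Lambda> * norm (x - y)"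
proof -
  let ?S = "{y. y \<bullet> e = 0}"
  obtain g L where g: "\<And>y. y \<in> ?S \<Longrightarrow> (\<gamma> has_derivative (\<lambda>h. g y \<bullet> h)) (at y within ?S)"
    and L: "L-lipschitz_on ?S g"
    using assms unfolding C11_on_def by blast
  have L0: "L \<ge> 0" using L by (rule lipschitz_on_nonneg)
  define \<Lambda> where "\<Lambda> = norm (g 0) + L * \<bar>R\<bar>"
  have conv: "convex (?S \<inter> cball 0 R)"
    using convex_hyperplane[of e 0] by (intro convex_Int) (auto simp: inner_commute)
  have "\<bar>\<gamma> x - \<gamma> y\<bar> \<le> \<Lambda> * norm (x - y)"
    if "x \<bullet> e = 0" "y \<bullet> e = 0" "norm x \<le> R" "norm y \<le> R" for x y
  proof -
    have "norm (\<gamma> x - \<gamma> y) \<le> \<Lambda> * norm (x - y)"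
    proof (rule differentiable_bound[OF conv])
      fix z assume z: "z \<in> ?S \<inter> cball 0 R"
      show "(\<gamma> has_derivative (\<lambda>h. g z \<bullet> h)) (at z within ?S \<inter> cball 0 R)"
        using g[of z] z by (auto intro: has_derivative_subset)
      have "dist (g z) (g 0) \<le> L * dist z 0" using z by (intro lipschitz_onD[OF L]) auto
      also have "\<dots> \<le> L * \<bar>R\<bar>" using z L0 by (intro mult_left_mono) auto
      finally have "norm (g z) \<le> \<Lambda>"
        using norm_triangle_ineq2[of "g z" "g 0"] by (simp add: dist_norm \<Lambda>_def)
      then have "\<bar>g z \<bullet> h\<bar> \<le> \<Lambda> * norm h" for h
        by (rule order_trans[OF Cauchy_Schwarz_ineq2 mult_right_mono[OF _ norm_ge_zero]])
      then show "onorm (\<lambda>h. g z \<bullet> h) \<le> \<Lambda>" by (intro onorm_le) simp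
    qed (use that in auto)
    then show ?thesis by simp
  qed
  moreover have "\<Lambda> \<ge> 0" using L0 by (simp add: \<Lambda>_def)
  ultimately show ?thesis using that by blast
qed

text \<open>Near \<open>p\<close> the domain lies above the graph of a Lipschitz function. Hence the downward cone at a boundary point, with
opening given by the Lipschitz constant, lies in the complement, and a ball of radius \<open>c \<rho>\<close> about \<open>p' - (\<rho>/2) e\<close> fits
into this cone.\<close>

lemma exterior_ball_near_boundary_point:
  fixes \<Omega> :: "(real ^ 'n) set"
  assumes "C11_domain \<Omega>" "p \<in> frontier \<Omega>"
  shows "\<exists>r>0. \<exists>c>0. \<forall>p'\<in>frontier \<Omega> \<inter> ball p r. \<forall>\<rho>. 0 < \<rho> \<longrightarrow> \<rho> \<le> r \<longrightarrow> (\<exists>z. ball z (c * \<rho>) \<subseteq> ball p' \<rho> - \<Omega>)"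
proof -
  obtain e r0 \<gamma> where e: "norm e = 1" and r0: "r0 > 0" and C11: "C11_on {y. y \<bullet> e = 0} \<gamma>"
    and eq: "\<Omega> \<inter> ball p r0 = {x \<in> ball p r0. \<gamma> (x - (x \<bullet> e) *\<^sub>R e) < x \<bullet> e}"
    using assms unfolding C11_domain_def by blast
  have "open \<Omega>" using assms by (simp add: C11_domain_def)
  define proj where "proj x = x - (x \<bullet> e) *\<^sub>R e" for x
  have ee: "e \<bullet> e = 1" using e by (simp add: dot_square_norm)
  have proj_perp: "proj x \<bullet> e = 0" for x by (simp add: proj_def inner_diff_left ee)
  have proj_norm: "norm (proj x) \<le> 2 * norm x" for x
  proof -
    have "norm (proj x) \<le> norm x + \<bar>x \<bullet> e\<bar>"
      unfolding proj_def using norm_triangle_ineq4[of x "(x \<bullet> e) *\<^sub>R e"] e by simp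
    then show ?thesis using Cauchy_Schwarz_ineq2[of x e] e by simp
  qed
  define R where "R = 2 * (norm p + r0)"
  have mem: "x \<in> \<Omega> \<longleftrightarrow> \<gamma> (proj x) < x \<bullet> e" if "x \<in> ball p r0" for x
    using eq that unfolding proj_def by blast
  have proj_diff: "proj x - proj y = proj (x - y)" for x y
    by (simp add: proj_def inner_diff_left algebra_simps)
  have proj_shift: "proj (x - t *\<^sub>R e) = proj x" for x t
    by (simp add: proj_def inner_diff_left ee algebra_simps)
  obtain \<Lambda> where \<Lambda>: "\<Lambda> \<ge> 0" "\<And>x y. x \<bullet> e = 0 \<Longrightarrow> y \<bullet> e = 0 \<Longrightarrow> norm x \<le> R \<Longrightarrow> norm y \<le> R
      \<Longrightarrow> \<bar>\<gamma> x - \<gamma> y\<bar> \<le> \<Lambda> * norm (x - y)"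
    using C11_on_lipschitz_on_bounded[OF C11] by blast
  \<comment> \<open>With this choice \<open>c \<rho> + \<Lambda> (2 c \<rho>) = \<rho> / 2\<close>: the vertical drop \<open>\<rho> / 2\<close> of the centre pays for the radius and for the slope of the graph.\<close>
  define c where "c = 1 / (2 * (1 + 2 * \<Lambda>))"
  have c: "c > 0" "c \<le> 1/2" "c * (1 + 2 * \<Lambda>) = 1/2" using \<Lambda>(1) by (auto simp: c_def field_simps)
  have in_R: "norm (proj x) \<le> R" if "x \<in> ball p r0" for x
  proof -
    have "norm x \<le> norm p + r0"
      using that norm_triangle_ineq2[of x p] by (simp add: dist_norm norm_minus_commute)
    then show ?thesis using proj_norm[of x] by (simp add: R_def)
  qed
  have "\<exists>z. ball z (c * \<rho>) \<subseteq> ball p' \<rho> - \<Omega>"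
    if p': "p' \<in> frontier \<Omega> \<inter> ball p (r0/2)" and \<rho>: "0 < \<rho>" "\<rho> \<le> r0/2" for p' \<rho>
  proof (intro exI subsetI)
    fix y assume "y \<in> ball (p' - (\<rho>/2) *\<^sub>R e) (c * \<rho>)"
    define z where "z = y - (p' - (\<rho>/2) *\<^sub>R e)"
    have z: "norm z < c * \<rho>" using \<open>y \<in> _\<close> by (simp add: z_def dist_norm norm_minus_commute)
    have yp: "y - p' = z - (\<rho>/2) *\<^sub>R e" by (simp add: z_def)
    have "norm (y - p') \<le> \<rho>/2 + norm z"
    proof -
      have "norm ((\<rho>/2) *\<^sub>R e) = \<rho>/2" using \<rho>(1) e by simp
      then show ?thesis using norm_triangle_ineq4[of z "(\<rho>/2) *\<^sub>R e"] by (simp add: yp)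
    qed
    also have "\<dots> < \<rho>" using z \<rho> mult_right_mono[OF c(2), of \<rho>] by linarith
    finally have yp': "norm (y - p') < \<rho>" .
    then have y_ball: "y \<in> ball p r0"
      using p' \<rho> dist_triangle[of p y p'] by (simp add: dist_norm norm_minus_commute)
    have p'_ball: "p' \<in> ball p r0" using p' r0 by simp
    have "p' \<notin> \<Omega>" using p' \<open>open \<Omega>\<close> by (auto simp: frontier_def interior_open)
    then have p'_below: "\<gamma> (proj p') \<ge> p' \<bullet> e" using mem[OF p'_ball] by simp
    have "proj y - proj p' = proj z" by (simp only: proj_diff yp proj_shift)
    then have "norm (proj y - proj p') \<le> 2 * (c * \<rho>)" using proj_norm[of z] z by simp
    then have "\<Lambda> * norm (proj y - proj p') \<le> \<Lambda> * (2 * (c * \<rho>))" using \<Lambda>(1) by (rule mult_left_mono)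
    then have 1: "\<gamma> (proj y) \<ge> \<gamma> (proj p') - \<Lambda> * (2 * (c * \<rho>))"
      using \<Lambda>(2)[OF proj_perp proj_perp in_R[OF y_ball] in_R[OF p'_ball]] by linarith
    have "z \<bullet> e \<le> c * \<rho>" using Cauchy_Schwarz_ineq2[of z e] e z by simp
    then have 2: "y \<bullet> e \<le> p' \<bullet> e - \<rho>/2 + c * \<rho>" using arg_cong[OF yp, of "\<lambda>v. v \<bullet> e"] by (simp add: inner_diff_left ee)
    have "c * \<rho> + \<Lambda> * (2 * (c * \<rho>)) = (c * (1 + 2 * \<Lambda>)) * \<rho>" by (simp add: algebra_simps)
    then have "c * \<rho> + \<Lambda> * (2 * (c * \<rho>)) = \<rho>/2" by (simp add: c(3))
    then have "y \<notin> \<Omega>" using 1 2 p'_below mem[OF y_ball] by linarith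
    then show "y \<in> ball p' \<rho> - \<Omega>" using yp' by (simp add: dist_norm norm_minus_commute)
  qed
  then show ?thesis using c(1) r0 by (intro exI[of _ "r0/2"] exI[of _ c] conjI) auto
qed

text \<open>Compactness of the boundary makes the constants uniform. Radii up to the given bound \<open>R\<close> are reached by
shrinking \<open>\<rho>\<close> by a fixed factor.\<close>

lemma exterior_ball_uniform:
  fixes \<Omega> :: "(real ^ 'n) set"
  assumes "C11_domain \<Omega>" "bounded \<Omega>" "R > 0"
  obtains c where "c > 0" "\<And>p \<rho>. p \<in> frontier \<Omega> \<Longrightarrow> 0 < \<rho> \<Longrightarrow> \<rho> \<le> R \<Longrightarrow> \<exists>z. ball z (c * \<rho>) \<subseteq> ball p \<rho> - \<Omega>"
proof -
  let ?F = "frontier \<Omega>"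
  have comp: "compact ?F" using assms(2) by (simp add: compact_frontier_bounded)
  have "\<forall>p\<in>?F. \<exists>r c. r > 0 \<and> c > 0 \<and> (\<forall>p'\<in>?F \<inter> ball p r. \<forall>\<rho>. 0 < \<rho> \<longrightarrow> \<rho> \<le> r \<longrightarrow> (\<exists>z. ball z (c * \<rho>) \<subseteq> ball p' \<rho> - \<Omega>))"
    using exterior_ball_near_boundary_point[OF assms(1)] by metis
  then obtain r c where rc: "\<And>p. p \<in> ?F \<Longrightarrow> r p > 0" "\<And>p. p \<in> ?F \<Longrightarrow> c p > 0"
      "\<And>p p' \<rho>. p \<in> ?F \<Longrightarrow> p' \<in> ?F \<inter> ball p (r p) \<Longrightarrow> 0 < \<rho> \<Longrightarrow> \<rho> \<le> r p \<Longrightarrow> \<exists>z. ball z (c p * \<rho>) \<subseteq> ball p' \<rho> - \<Omega>"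
    by metis
  have "?F \<subseteq> (\<Union>p\<in>?F. ball p (r p))" using rc(1) by force
  then obtain D where D: "D \<subseteq> ?F" "finite D" "?F \<subseteq> (\<Union>p\<in>D. ball p (r p))"
    by (rule compactE_image[OF comp, of ?F "\<lambda>p. ball p (r p)", rotated]) auto
  define r1 where "r1 = Min (insert R (r ` D))"
  define c1 where "c1 = Min (insert 1 (c ` D))"
  have r1: "r1 > 0" "r1 \<le> R" "\<And>p. p \<in> D \<Longrightarrow> r1 \<le> r p" using D rc(1) assms(3) by (auto simp: r1_def)
  have c1: "c1 > 0" "\<And>p. p \<in> D \<Longrightarrow> c1 \<le> c p" using D rc(2) by (auto simp: c1_def)
  show ?thesis
  proof
    show "c1 * (r1 / R) > 0" using r1 c1 assms(3) by simp
    fix p' \<rho> assume p': "p' \<in> ?F" and \<rho>: "0 < \<rho>" "\<rho> \<le> R"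
    obtain p where p: "p \<in> D" "p' \<in> ball p (r p)" using D p' by blast
    define \<rho>' where "\<rho>' = \<rho> * (r1 / R)"
    have "r1 / R \<le> 1" using r1 assms(3) by simp
    then have "\<rho>' \<le> \<rho> * 1" unfolding \<rho>'_def using \<rho> by (intro mult_left_mono) auto
    moreover have "\<rho>' \<le> R * (r1 / R)" unfolding \<rho>'_def using \<rho> r1 assms(3) by (intro mult_right_mono) auto
    ultimately have \<rho>': "0 < \<rho>'" "\<rho>' \<le> \<rho>" "\<rho>' \<le> r1" using \<rho> r1 assms(3) by (auto simp: \<rho>'_def)
    obtain z where z: "ball z (c p * \<rho>') \<subseteq> ball p' \<rho>' - \<Omega>"
      using rc(3)[of p p' \<rho>'] p p' D(1) \<rho>' r1(3)[OF p(1)] by auto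
    have "c1 * (r1 / R) * \<rho> = c1 * \<rho>'" by (simp add: \<rho>'_def)
    also have "\<dots> \<le> c p * \<rho>'" using c1(2)[OF p(1)] \<rho>' by (intro mult_right_mono) auto
    finally have "ball z (c1 * (r1 / R) * \<rho>) \<subseteq> ball z (c p * \<rho>')" by (rule subset_ball)
    with z subset_ball[OF \<rho>'(2), of p'] show "\<exists>z. ball z (c1 * (r1 / R) * \<rho>) \<subseteq> ball p' \<rho> - \<Omega>" by blast
  qed
qed

section \<open>Weak-star compactness\<close>

text \<open>A family that only has a cluster point still converges along a finer filter, which is as good as a subsequence for
passing to the limit in equations and inequalities.\<close>

lemma filterlim_along_cluster_point:
  assumes "inf (nhds L) (filtermap \<Phi> F) \<noteq> bot"
  defines "G \<equiv> inf F (filtercomap \<Phi> (nhds L))"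
  shows "G \<noteq> bot" "G \<le> F" "(\<Phi> \<longlongrightarrow> L) G"
proof -
  show "G \<le> F" by (simp add: G_def)
  have "filterlim \<Phi> (nhds L) (filtercomap \<Phi> (nhds L))" by (rule filterlim_filtercomap)
  then show "(\<Phi> \<longlongrightarrow> L) G" by (rule filterlim_mono) (auto simp: G_def)
  show "G \<noteq> bot"
  proof
    assume "G = bot"
    then have "eventually (\<lambda>_. False) G" by simp
    then obtain P Q where P: "eventually P F" and Q: "eventually Q (filtercomap \<Phi> (nhds L))" and PQ: "\<And>x. P x \<Longrightarrow> Q x \<Longrightarrow> False"
      unfolding G_def eventually_inf by blast
    from Q obtain R where R: "eventually R (nhds L)" "\<And>x. R (\<Phi> x) \<Longrightarrow> Q x"
      unfolding eventually_filtercomap by blast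
    have "eventually (\<lambda>y. \<not> R y) (filtermap \<Phi> F)"
      unfolding eventually_filtermap using P by eventually_elim (use PQ R(2) in blast)
    then have "eventually (\<lambda>_. False) (inf (nhds L) (filtermap \<Phi> F))"
      unfolding eventually_inf using R(1) by (intro exI[of _ R] exI[of _ "\<lambda>y. \<not> R y"]) auto
    then show False using assms(1) by (simp add: trivial_limit_def)
  qed
qed

text \<open>Tychonoff's theorem for a product of compact intervals. One filter serves all indices \<open>j\<close>, whose number is
unrestricted; a subsequence chosen separately for each \<open>j\<close> would not allow different indices to be compared.\<close>

lemma bounded_functions_cluster:
  fixes \<Phi> :: "nat \<Rightarrow> 'j \<Rightarrow> real"
  assumes "\<And>n j. a j \<le> \<Phi> n j" "\<And>n j. \<Phi> n j \<le> b j"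
  obtains F L where "F \<noteq> bot" "F \<le> sequentially" "\<And>j. ((\<lambda>n. \<Phi> n j) \<longlongrightarrow> L j) F"
proof -
  define U where "U = PiE UNIV (\<lambda>j. {a j .. b j})"
  have "compactin (product_topology (\<lambda>_. euclidean) UNIV) U"
    unfolding U_def compactin_PiE by simp
  then have "compact U" by (simp add: euclidean_product_topology)
  moreover have "eventually (\<lambda>x. x \<in> U) (filtermap \<Phi> sequentially)"
    using assms by (auto simp: eventually_filtermap U_def PiE_UNIV_domain)
  moreover have "filtermap \<Phi> sequentially \<noteq> bot" by (simp add: filtermap_bot_iff)
  ultimately obtain L where "inf (nhds L) (filtermap \<Phi> sequentially) \<noteq> bot"
    unfolding compact_filter by blast
  note G = filterlim_along_cluster_point[OF this]
  have "((\<lambda>n. \<Phi> n j) \<longlongrightarrow> L j) (inf sequentially (filtercomap \<Phi> (nhds L)))" for j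
  proof -
    have "continuous_on UNIV (\<lambda>x :: 'j \<Rightarrow> real. x j)" by (rule continuous_on_product_coordinates)
    then show ?thesis using G(3) by (rule continuous_on_tendsto_compose) auto
  qed
  with G(1,2) that show ?thesis by blast
qed

lemma finite_measure_integrable_bounded:
  fixes f :: "'a \<Rightarrow> real"
  assumes "integrable M \<phi>" and [measurable]: "f \<in> borel_measurable M" and "\<And>x. x \<in> space M \<Longrightarrow> \<bar>f x\<bar> \<le> B"
  shows "integrable M (\<lambda>x. f x * \<phi> x)" and "\<bar>\<integral>x. f x * \<phi> x \<partial>M\<bar> \<le> B * (\<integral>x. \<bar>\<phi> x\<bar> \<partial>M)"
proof -
  have [measurable]: "\<phi> \<in> borel_measurable M" using assms(1) by auto
  have b: "\<bar>f x * \<phi> x\<bar> \<le> B * \<bar>\<phi> x\<bar>" if "x \<in> space M" for x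
    using assms(3)[OF that] by (simp add: abs_mult mult_right_mono)
  show i: "integrable M (\<lambda>x. f x * \<phi> x)"
  proof (rule Bochner_Integration.integrable_bound[where f = "\<lambda>x. B * \<bar>\<phi> x\<bar>"])
    show "integrable M (\<lambda>x. B * \<bar>\<phi> x\<bar>)" using assms(1) by auto
    show "AE x in M. norm (f x * \<phi> x) \<le> norm (B * \<bar>\<phi> x\<bar>)"
      by (rule AE_I2) (metis b abs_ge_self order_trans real_norm_def)
  qed simp
  have "\<bar>\<integral>x. f x * \<phi> x \<partial>M\<bar> \<le> (\<integral>x. \<bar>f x * \<phi> x\<bar> \<partial>M)" using integral_norm_bound[of M "\<lambda>x. f x * \<phi> x"] by simp
  also have "\<dots> \<le> (\<integral>x. B * \<bar>\<phi> x\<bar> \<partial>M)"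
    using i assms(1) b by (intro integral_mono) auto
  finally show "\<bar>\<integral>x. f x * \<phi> x \<partial>M\<bar> \<le> B * (\<integral>x. \<bar>\<phi> x\<bar> \<partial>M)" by simp
qed

text \<open>Domination by a finite measure upgrades finite additivity to countable additivity. The Radon--Nikodym theorem then
gives the density.\<close>

lemma dominated_additive_set_function_density:
  assumes "finite_measure M" and B: "B \<ge> 0"
    and nonneg: "\<And>A. A \<in> sets M \<Longrightarrow> 0 \<le> \<nu> A"
    and add: "\<And>A A'. A \<in> sets M \<Longrightarrow> A' \<in> sets M \<Longrightarrow> A \<inter> A' = {} \<Longrightarrow> \<nu> (A \<union> A') = \<nu> A + \<nu> A'"
    and le: "\<And>A. A \<in> sets M \<Longrightarrow> \<nu> A \<le> B * measure M A"
  obtains v where "v \<in> borel_measurable M" "\<And>x. 0 \<le> v x" "\<And>x. v x \<le> B"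
    "\<And>A. A \<in> sets M \<Longrightarrow> \<nu> A = (\<integral>x. v x * indicator A x \<partial>M)"
proof -
  interpret finite_measure M by fact
  have \<nu>0: "\<nu> {} = 0" using nonneg[of "{}"] le[of "{}"] by simp
  define N where "N = measure_of (space M) (sets M) (\<lambda>A. ennreal (\<nu> A))"
  have pos: "positive (sets M) (\<lambda>A. ennreal (\<nu> A))" by (simp add: positive_def \<nu>0)
  have "countably_additive (sets M) (\<lambda>A. ennreal (\<nu> A))"
  proof (rule sets.empty_continuous_imp_countably_additive[OF pos])
    show "additive (sets M) (\<lambda>A. ennreal (\<nu> A))"
      by (auto simp: additive_def add nonneg)
    show "\<forall>A\<in>sets M. ennreal (\<nu> A) \<noteq> \<infinity>" by simp
    fix A :: "nat \<Rightarrow> 'a set" assume A: "range A \<subseteq> sets M" "decseq A" "(\<Inter>i. A i) = {}"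
    have "(\<lambda>i. measure M (A i)) \<longlonglongrightarrow> measure M (\<Inter>i. A i)"
      using A by (intro finite_Lim_measure_decseq) auto
    then have "(\<lambda>i. B * measure M (A i)) \<longlonglongrightarrow> 0" using A(3) tendsto_mult_left[of _ 0 _ B] by fastforce
    then have "(\<lambda>i. \<nu> (A i)) \<longlonglongrightarrow> 0"
      by (rule tendsto_sandwich[OF always_eventually always_eventually tendsto_const, rotated 2])
         (use A nonneg le in auto)
    then show "(\<lambda>i. ennreal (\<nu> (A i))) \<longlonglongrightarrow> 0"
      using tendsto_ennrealI by fastforce
  qed
  then have emN: "emeasure N A = ennreal (\<nu> A)" if "A \<in> sets M" for A
    using that pos by (intro emeasure_measure_of[OF N_def]) (auto simp: sets.space_closed N_def)
  have setsN[simp]: "sets N = sets M" by (simp add: N_def)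
  have "absolutely_continuous M N"
    unfolding absolutely_continuous_def
  proof (rule subsetI, rule null_setsI)
    fix A assume A: "A \<in> null_sets M"
    then have "measure M A = 0" "A \<in> sets M" by (auto simp: measure_def)
    then show "emeasure N A = 0" using emN le[of A] nonneg[of A] by simp
  qed auto
  then obtain g where g[measurable]: "g \<in> borel_measurable M" and gN: "density M g = N"
    using Radon_Nikodym[of N] by auto
  have gA: "(\<integral>\<^sup>+x. g x * indicator A x \<partial>M) = ennreal (\<nu> A)" if "A \<in> sets M" for A
    using that emN[OF that] by (simp add: gN[symmetric] emeasure_density)
  have AE: "AE x in M. g x \<le> ennreal B"
  proof -
    define A where "A = {x \<in> space M. ennreal B < g x}"
    have [measurable]: "A \<in> sets M" by (simp add: A_def)
    have "(\<integral>\<^sup>+x. (g x * indicator A x - ennreal B * indicator A x) \<partial>M)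
       = (\<integral>\<^sup>+x. g x * indicator A x \<partial>M) - (\<integral>\<^sup>+x. ennreal B * indicator A x \<partial>M)"
    proof (rule nn_integral_diff)
      show "(\<integral>\<^sup>+x. ennreal B * indicator A x \<partial>M) \<noteq> \<infinity>"
        by (simp add: nn_integral_cmult_indicator ennreal_mult_eq_top_iff)
      show "AE x in M. ennreal B * indicator A x \<le> g x * indicator A x"
        by (rule AE_I2) (auto simp: A_def indicator_def)
    qed measurable
    also have "\<dots> = ennreal (\<nu> A) - ennreal (B * measure M A)"
      using B by (simp add: gA nn_integral_cmult_indicator emeasure_eq_measure ennreal_mult)
    also have "\<dots> = 0" using le[of A] by (simp add: ennreal_leI diff_eq_0_iff_ennreal less_top[symmetric])
    finally have "AE x in M. g x * indicator A x - ennreal B * indicator A x = 0"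
      by (subst (asm) nn_integral_0_iff_AE) auto
    with AE_space show ?thesis
    proof eventually_elim
      case (elim x)
      show ?case
      proof (rule ccontr)
        assume *: "\<not> g x \<le> ennreal B"
        then have "g x - ennreal B = 0" using elim by (simp add: A_def not_le)
        then show False using * by (simp add: diff_eq_0_iff_ennreal)
      qed
    qed
  qed
  define v where "v x = min B (enn2real (g x))" for x
  show ?thesis
  proof
    show v[measurable]: "v \<in> borel_measurable M" unfolding v_def by measurable
    show v0: "0 \<le> v x" for x using B by (simp add: v_def)
    show "v x \<le> B" for x by (simp add: v_def)
    fix A assume A[measurable]: "A \<in> sets M"
    have "AE x in M. ennreal (v x * indicator A x) = g x * indicator A x"
      using AE
    proof eventually_elim
      case (elim x)
      then have "enn2real (g x) \<le> B" using B by (metis enn2real_ennreal enn2real_mono ennreal_less_top)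
      then show ?case using elim ennreal_less_top[of B]
        by (auto simp: v_def min_def indicator_def le_less_trans)
    qed
    then have "(\<integral>\<^sup>+x. ennreal (v x * indicator A x) \<partial>M) = ennreal (\<nu> A)"
      by (subst gA[OF A, symmetric]) (rule nn_integral_cong_AE)
    then show "\<nu> A = (\<integral>x. v x * indicator A x \<partial>M)"
      by (subst integral_eq_nn_integral) (auto simp: v0 nonneg)
  qed
qed

text \<open>The Banach--Alaoglu theorem in \<open>L\<^sup>\<infinity>\<close> of a finite measure, for a whole family of bounded sequences at once. The
integrals over measurable sets converge along a common filter; their limits are dominated additive set functions
and so have densities, and density of the simple functions extends the convergence to all integrable \<open>\<phi>\<close>.\<close>

lemma weak_star_limit:
  fixes f :: "nat \<Rightarrow> 'i \<Rightarrow> 'a \<Rightarrow> real"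
  assumes fin: "finite_measure M" and meas: "\<And>n i. f n i \<in> borel_measurable M"
    and nonneg: "\<And>n i x. x \<in> space M \<Longrightarrow> 0 \<le> f n i x" and le: "\<And>n i x. x \<in> space M \<Longrightarrow> f n i x \<le> B i"
    and B: "\<And>i. 0 \<le> B i"
  obtains F v where "F \<noteq> bot" "F \<le> sequentially" "\<And>i. v i \<in> borel_measurable M"
    "\<And>i x. 0 \<le> v i x" "\<And>i x. v i x \<le> B i"
    "\<And>i \<phi>. integrable M \<phi> \<Longrightarrow> ((\<lambda>n. \<integral>x. f n i x * \<phi> x \<partial>M) \<longlongrightarrow> (\<integral>x. v i x * \<phi> x \<partial>M)) F"
proof -
  interpret finite_measure M by fact
  note [measurable] = meas
  \<comment> \<open>Sets outside the sigma algebra get the value \<open>0\<close>, so that all values of \<open>\<Phi>\<close> lie in compact intervals.\<close>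
  define \<Phi> where "\<Phi> n j = (if snd j \<in> sets M then \<integral>x. f n (fst j) x * indicator (snd j) x \<partial>M else 0)" for n j
  have fB: "\<bar>f n i x\<bar> \<le> B i" if "x \<in> space M" for n i x using nonneg[OF that] le[OF that] by simp
  have ind: "integrable M (\<lambda>x. indicator A x :: real)" if "A \<in> sets M" for A
    using that by (simp add: integrable_real_indicator less_top[symmetric])
  have \<Phi>0: "0 \<le> \<Phi> n j" for n j unfolding \<Phi>_def
    by (auto intro!: Bochner_Integration.integral_nonneg simp: indicator_def nonneg)
  have \<Phi>le: "\<Phi> n (i, A) \<le> B i * measure M A" if A: "A \<in> sets M" for n i A
    using finite_measure_integrable_bounded(2)[OF ind[OF A] meas fB, of n i] A by (simp add: \<Phi>_def)
  have \<Phi>le': "\<Phi> n j \<le> B (fst j) * measure M (space M)" for n j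
  proof (cases "snd j \<in> sets M")
    case True
    then have "\<Phi> n j \<le> B (fst j) * measure M (snd j)" using \<Phi>le[of "snd j" n "fst j"] by simp
    also have "\<dots> \<le> B (fst j) * measure M (space M)" by (intro mult_left_mono B bounded_measure)
    finally show ?thesis .
  qed (simp add: \<Phi>_def B)
  obtain F L where F: "F \<noteq> bot" "F \<le> sequentially" and L: "\<And>j. ((\<lambda>n. \<Phi> n j) \<longlongrightarrow> L j) F"
    using bounded_functions_cluster[of "\<lambda>_. 0" \<Phi> "\<lambda>j. B (fst j) * measure M (space M)"] \<Phi>0 \<Phi>le' by blast
  have "\<exists>v. v \<in> borel_measurable M \<and> (\<forall>x. 0 \<le> v x) \<and> (\<forall>x. v x \<le> B i) \<and>
      (\<forall>A\<in>sets M. L (i, A) = (\<integral>x. v x * indicator A x \<partial>M))" for i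
  proof -
    have 1: "0 \<le> L (i, A)" for A
      using \<Phi>0 by (intro tendsto_lowerbound[OF L _ F(1)]) auto
    have 2: "L (i, A) \<le> B i * measure M A" if "A \<in> sets M" for A
      using \<Phi>le[OF that] by (intro tendsto_upperbound[OF L _ F(1)]) auto
    have 3: "L (i, A \<union> A') = L (i, A) + L (i, A')"
      if A: "A \<in> sets M" "A' \<in> sets M" "A \<inter> A' = {}" for A A'
    proof -
      have "\<Phi> n (i, A \<union> A') = \<Phi> n (i, A) + \<Phi> n (i, A')" for n
      proof -
        have "(\<integral>x. f n i x * indicator A x + f n i x * indicator A' x \<partial>M)
           = (\<integral>x. f n i x * indicator A x \<partial>M) + (\<integral>x. f n i x * indicator A' x \<partial>M)"
          using A by (intro Bochner_Integration.integral_add finite_measure_integrable_bounded(1)[OF ind meas fB])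
        moreover have "f n i x * indicator (A \<union> A') x = f n i x * indicator A x + f n i x * indicator A' x" for x
          using A(3) by (auto simp: indicator_def)
        ultimately show ?thesis using A by (simp add: \<Phi>_def)
      qed
      then have "((\<lambda>n. \<Phi> n (i, A \<union> A')) \<longlongrightarrow> L (i, A) + L (i, A')) F"
        using tendsto_add[OF L[of "(i, A)"] L[of "(i, A')"]] by simp
      then show ?thesis using tendsto_unique[OF F(1) L] by blast
    qed
    show ?thesis
    proof (rule dominated_additive_set_function_density[where \<nu> = "\<lambda>A. L (i, A)", OF fin B[of i]])
      show "0 \<le> L (i, A)" for A by (rule 1)
      show "L (i, A \<union> A') = L (i, A) + L (i, A')" if "A \<in> sets M" "A' \<in> sets M" "A \<inter> A' = {}" for A A'
        using that by (rule 3)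
      show "L (i, A) \<le> B i * measure M A" if "A \<in> sets M" for A using that by (rule 2)
    qed blast
  qed
  then obtain v where v: "\<And>i. v i \<in> borel_measurable M" "\<And>i x. 0 \<le> v i x" "\<And>i x. v i x \<le> B i"
      "\<And>i A. A \<in> sets M \<Longrightarrow> L (i, A) = (\<integral>x. v i x * indicator A x \<partial>M)" by metis
  note [measurable] = v(1)
  have vB: "\<bar>v i x\<bar> \<le> B i" for i x using v(2,3)[of i x] by simp
  have "((\<lambda>n. \<integral>x. f n i x * \<phi> x \<partial>M) \<longlongrightarrow> (\<integral>x. v i x * \<phi> x \<partial>M)) F" if "integrable M \<phi>" for i \<phi>
    using that
  proof (induction rule: integrable_induct)
    case (base A c)
    have "(\<integral>x. f n i x * (indicator A x *\<^sub>R c) \<partial>M) = \<Phi> n (i, A) * c" for n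
      using base(1) by (simp add: \<Phi>_def mult.assoc[symmetric])
    moreover have "(\<integral>x. v i x * (indicator A x *\<^sub>R c) \<partial>M) = L (i, A) * c"
      by (simp add: v(4)[OF base(1)] mult.assoc[symmetric])
    ultimately show ?case by (simp only:) (intro tendsto_intros L)
  next
    case (add g h)
    have "(\<integral>x. f n i x * (g x + h x) \<partial>M) = (\<integral>x. f n i x * g x \<partial>M) + (\<integral>x. f n i x * h x \<partial>M)" for n
      unfolding distrib_left
      using add by (intro Bochner_Integration.integral_add finite_measure_integrable_bounded(1)[OF _ meas fB])
    moreover have "(\<integral>x. v i x * (g x + h x) \<partial>M) = (\<integral>x. v i x * g x \<partial>M) + (\<integral>x. v i x * h x \<partial>M)"
      unfolding distrib_left
      using add by (intro Bochner_Integration.integral_add finite_measure_integrable_bounded(1)[OF _ v(1) vB])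
    ultimately show ?case using add by (simp only:) (intro tendsto_intros)
  next
    case (lim g h)
    have IH: "((\<lambda>n. \<integral>x. f n i x * h k x \<partial>M) \<longlongrightarrow> (\<integral>x. v i x * h k x \<partial>M)) F" for k
      by (fact lim)
    have conv: "(\<lambda>k. h k x) \<longlonglongrightarrow> g x" if "x \<in> space M" for x using that by (fact lim)
    have bound: "norm (h k x) \<le> 2 * norm (g x)" if "x \<in> space M" for k x using that by (fact lim)
    have diff: "integrable M (\<lambda>x. g x - h k x)" for k using lim by auto
    have "(\<lambda>k. \<integral>x. \<bar>g x - h k x\<bar> \<partial>M) \<longlonglongrightarrow> (\<integral>x. 0 \<partial>M)"
    proof (rule integral_dominated_convergence[where w = "\<lambda>x. 3 * \<bar>g x\<bar>"])
      show "AE x in M. norm \<bar>g x - h k x\<bar> \<le> 3 * \<bar>g x\<bar>" for k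
        by (rule AE_I2) (use bound[of _ k] in fastforce)
      show "AE x in M. (\<lambda>k. \<bar>g x - h k x\<bar>) \<longlonglongrightarrow> 0"
      proof (rule AE_I2)
        fix x assume "x \<in> space M"
        then have "(\<lambda>k. \<bar>g x - h k x\<bar>) \<longlonglongrightarrow> \<bar>g x - g x\<bar>" by (intro tendsto_intros conv)
        then show "(\<lambda>k. \<bar>g x - h k x\<bar>) \<longlonglongrightarrow> 0" by simp
      qed
    qed (use diff lim in \<open>auto intro: borel_measurable_integrable\<close>)
    then have small: "(\<lambda>k. B i * (\<integral>x. \<bar>g x - h k x\<bar> \<partial>M)) \<longlonglongrightarrow> 0"
      using tendsto_mult_left[of _ 0 _ "B i"] by fastforce
    show ?case
    proof (rule tendstoI)
      fix e :: real assume e: "e > 0"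
      obtain k where k: "B i * (\<integral>x. \<bar>g x - h k x\<bar> \<partial>M) < e / 3"
        using order_tendstoD(2)[OF small, of "e/3"] e by (auto simp: eventually_sequentially)
      have split: "(\<integral>x. w x * g x \<partial>M) = (\<integral>x. w x * h k x \<partial>M) + (\<integral>x. w x * (g x - h k x) \<partial>M)"
        if "w \<in> borel_measurable M" "\<And>x. x \<in> space M \<Longrightarrow> \<bar>w x\<bar> \<le> B i" for w
      proof -
        have "(\<integral>x. w x * h k x + w x * (g x - h k x) \<partial>M) = (\<integral>x. w x * h k x \<partial>M) + (\<integral>x. w x * (g x - h k x) \<partial>M)"
          using that lim diff by (intro Bochner_Integration.integral_add finite_measure_integrable_bounded(1)[of M _ w "B i"])
        then show ?thesis by (simp add: algebra_simps)
      qed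
      have "\<forall>\<^sub>F n in F. dist (\<integral>x. f n i x * h k x \<partial>M) (\<integral>x. v i x * h k x \<partial>M) < e / 3"
        using IH[of k] e by (intro tendstoD) auto
      then show "\<forall>\<^sub>F n in F. dist (\<integral>x. f n i x * g x \<partial>M) (\<integral>x. v i x * g x \<partial>M) < e"
      proof eventually_elim
        case (elim n)
        have "\<bar>\<integral>x. f n i x * (g x - h k x) \<partial>M\<bar> < e / 3" "\<bar>\<integral>x. v i x * (g x - h k x) \<partial>M\<bar> < e / 3"
          using finite_measure_integrable_bounded(2)[where f = "f n i" and B = "B i", OF diff[of k] meas fB]
             finite_measure_integrable_bounded(2)[where f = "v i" and B = "B i", OF diff[of k] v(1) vB] k by linarith+
        then show ?case using elim split[of "f n i", OF meas fB] split[of "v i", OF v(1) vB]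
          unfolding dist_real_def by linarith
      qed
    qed
  qed
  from F v(1-3) this show ?thesis by (rule that)
qed

section \<open>Neumann series with nonnegative kernels\<close>

text \<open>The partial sums of the Neumann series for \<open>u = f + P u\<close>, where \<open>P\<close> is the integral operator with the nonnegative
kernel \<open>p\<close>. With extended nonnegative values the series always makes sense, and monotonicity and comparison with
supersolutions are inductions over partial sums.\<close>

primrec neumann_partial :: "'a measure \<Rightarrow> ('a \<Rightarrow> 'a \<Rightarrow> ennreal) \<Rightarrow> ('a \<Rightarrow> ennreal) \<Rightarrow> nat \<Rightarrow> 'a \<Rightarrow> ennreal" where
  "neumann_partial M p f 0 = (\<lambda>_. 0)"
| "neumann_partial M p f (Suc n) = (\<lambda>x. f x + (\<integral>\<^sup>+y. p x y * neumann_partial M p f n y \<partial>M))"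

definition neumann_series :: "'a measure \<Rightarrow> ('a \<Rightarrow> 'a \<Rightarrow> ennreal) \<Rightarrow> ('a \<Rightarrow> ennreal) \<Rightarrow> 'a \<Rightarrow> ennreal" where
  "neumann_series M p f x = (SUP n. neumann_partial M p f n x)"

context
  fixes M :: "'a measure" and p :: "'a \<Rightarrow> 'a \<Rightarrow> ennreal"
  assumes M: "sigma_finite_measure M"
    and p[measurable]: "(\<lambda>(x, y). p x y) \<in> borel_measurable (M \<Otimes>\<^sub>M M)"
begin

interpretation sigma_finite_measure M by (rule M)

lemma kernel_section_measurable: "x \<in> space M \<Longrightarrow> p x \<in> borel_measurable M"
  using measurable_compose[OF measurable_Pair1' p] by simp

lemma neumann_partial_measurable:
  assumes [measurable]: "f \<in> borel_measurable M"
  shows "neumann_partial M p f n \<in> borel_measurable M"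
proof (induction n)
  case (Suc n)
  note [measurable] = Suc
  show ?case by simp
qed simp

lemma neumann_partial_incseq: "incseq (\<lambda>n. neumann_partial M p f n x)"
proof (rule incseq_SucI)
  fix n show "neumann_partial M p f n x \<le> neumann_partial M p f (Suc n) x"
  proof (induction n arbitrary: x)
    case (Suc n)
    show ?case using Suc by (simp only: neumann_partial.simps) (intro add_mono nn_integral_mono mult_left_mono order_refl, auto)
  qed simp
qed

lemma neumann_series_measurable:
  assumes [measurable]: "f \<in> borel_measurable M"
  shows "neumann_series M p f \<in> borel_measurable M"
proof -
  note [measurable] = neumann_partial_measurable
  show ?thesis unfolding neumann_series_def[abs_def] by measurable
qed

lemma neumann_series_fixed_point:
  assumes [measurable]: "f \<in> borel_measurable M" and x: "x \<in> space M"
  shows "neumann_series M p f x = f x + (\<integral>\<^sup>+y. p x y * neumann_series M p f y \<partial>M)"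
proof -
  note [measurable] = neumann_partial_measurable kernel_section_measurable[OF x]
  have "(\<integral>\<^sup>+y. p x y * neumann_series M p f y \<partial>M) = (\<integral>\<^sup>+y. (SUP n. p x y * neumann_partial M p f n y) \<partial>M)"
    by (simp add: neumann_series_def SUP_mult_left_ennreal)
  also have "\<dots> = (SUP n. \<integral>\<^sup>+y. p x y * neumann_partial M p f n y \<partial>M)"
  proof (rule nn_integral_monotone_convergence_SUP)
    show "incseq (\<lambda>n y. p x y * neumann_partial M p f n y)"
      using neumann_partial_incseq[of f] by (auto simp: incseq_def le_fun_def intro!: mult_left_mono)
  qed measurable
  finally have "f x + (\<integral>\<^sup>+y. p x y * neumann_series M p f y \<partial>M) = (SUP n. neumann_partial M p f (Suc n) x)"
    by (simp add: ennreal_SUP_add_right)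
  also have "\<dots> = neumann_series M p f x"
    unfolding neumann_series_def
  proof (rule antisym)
    show "(SUP n. neumann_partial M p f (Suc n) x) \<le> (SUP n. neumann_partial M p f n x)"
      by (rule SUP_least) (rule SUP_upper[OF UNIV_I])
    show "(SUP n. neumann_partial M p f n x) \<le> (SUP n. neumann_partial M p f (Suc n) x)"
      by (rule SUP_mono) (use incseq_SucD[OF neumann_partial_incseq[of f x]] in blast)
  qed
  finally show ?thesis by simp
qed

lemma neumann_series_mono:
  assumes "\<And>x. x \<in> space M \<Longrightarrow> f x \<le> g x" "x \<in> space M"
  shows "neumann_series M p f x \<le> neumann_series M p g x"
proof -
  have "neumann_partial M p f n x \<le> neumann_partial M p g n x" if "x \<in> space M" for n x
    using that
  proof (induction n arbitrary: x)
    case (Suc n)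
    then show ?case using assms(1) by (simp only: neumann_partial.simps) (intro add_mono nn_integral_mono mult_left_mono, auto)
  qed simp
  then show ?thesis unfolding neumann_series_def using assms(2) by (intro SUP_mono) blast
qed

lemma neumann_series_le_supersolution:
  assumes "\<And>x. x \<in> space M \<Longrightarrow> f x + (\<integral>\<^sup>+y. p x y * b \<partial>M) \<le> b" "x \<in> space M"
  shows "neumann_series M p f x \<le> b"
proof -
  have "neumann_partial M p f n x \<le> b" if "x \<in> space M" for n x
    using that
  proof (induction n arbitrary: x)
    case (Suc n)
    have "neumann_partial M p f (Suc n) x \<le> f x + (\<integral>\<^sup>+y. p x y * b \<partial>M)"
      using Suc by (simp only: neumann_partial.simps) (intro add_mono nn_integral_mono mult_left_mono order_refl, auto)
    also have "\<dots> \<le> b" by (rule assms(1)) fact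
    finally show ?case .
  qed simp
  then show ?thesis unfolding neumann_series_def using assms(2) by (intro SUP_least) blast
qed

text \<open>Every partial sum misses the constant subsolution \<open>b\<close> by at most \<open>\<theta>\<^sup>n b\<close>. The strict contraction is needed: for mass
preserving kernels the constants solve the homogeneous equation and the conclusion fails.\<close>

lemma neumann_series_ge_subsolution:
  fixes b \<theta> :: real
  assumes f: "f \<in> borel_measurable M"
    and sub: "\<And>x. x \<in> space M \<Longrightarrow> ennreal b \<le> f x + (\<integral>\<^sup>+y. p x y * ennreal b \<partial>M)"
    and \<theta>: "0 \<le> \<theta>" "\<theta> < 1" "\<And>x. x \<in> space M \<Longrightarrow> (\<integral>\<^sup>+y. p x y \<partial>M) \<le> ennreal \<theta>" and b: "0 \<le> b"
    and x: "x \<in> space M"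
  shows "ennreal b \<le> neumann_series M p f x"
proof -
  note [measurable] = neumann_partial_measurable[OF f]
  have "ennreal b \<le> neumann_partial M p f n x + ennreal (\<theta> ^ n * b)" if "x \<in> space M" for n x
    using that
  proof (induction n arbitrary: x)
    case (Suc n)
    note [measurable] = kernel_section_measurable[OF Suc.prems]
    have "ennreal b \<le> f x + (\<integral>\<^sup>+y. p x y * ennreal b \<partial>M)" by (rule sub) fact
    also have "\<dots> \<le> f x + (\<integral>\<^sup>+y. p x y * (neumann_partial M p f n y + ennreal (\<theta> ^ n * b)) \<partial>M)"
      using Suc.IH by (intro add_mono nn_integral_mono mult_left_mono order_refl) auto
    also have "\<dots> = neumann_partial M p f (Suc n) x + (\<integral>\<^sup>+y. p x y \<partial>M) * ennreal (\<theta> ^ n * b)"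
      by (simp add: distrib_left nn_integral_add nn_integral_multc add.assoc)
    also have "\<dots> \<le> neumann_partial M p f (Suc n) x + ennreal \<theta> * ennreal (\<theta> ^ n * b)"
      using \<theta>(3) Suc.prems by (intro add_mono mult_right_mono order_refl) auto
    also have "ennreal \<theta> * ennreal (\<theta> ^ n * b) = ennreal (\<theta> ^ Suc n * b)"
      using \<theta>(1) b by (simp add: ennreal_mult[symmetric] mult.assoc)
    finally show ?case .
  qed simp
  then have le: "ennreal b \<le> neumann_series M p f x + ennreal (\<theta> ^ n * b)" for n
    using x unfolding neumann_series_def by (meson SUP_upper UNIV_I add_right_mono order_trans)
  have "(\<lambda>n. \<theta> ^ n * b) \<longlonglongrightarrow> 0 * b" using \<theta> by (intro tendsto_intros LIMSEQ_realpow_zero) auto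
  then have "(\<lambda>n. ennreal (\<theta> ^ n * b)) \<longlonglongrightarrow> 0" using tendsto_ennrealI by fastforce
  then have "(\<lambda>n. neumann_series M p f x + ennreal (\<theta> ^ n * b)) \<longlonglongrightarrow> neumann_series M p f x + 0"
    by (intro tendsto_add tendsto_const)
  then show ?thesis using le by (intro LIMSEQ_le_const[where X = "\<lambda>n. neumann_series M p f x + ennreal (\<theta> ^ n * b)"]) auto
qed

end

section \<open>Killed jump operators\<close>

text \<open>The operator \<open>u \<mapsto> A u - \<integral> J(\<cdot>,y) u(y) dy\<close> is the negative generator of a jump process with total jump rate \<open>A\<close>, of which only the part \<open>J\<close>
stays in the space; the process is killed at rate \<open>A - \<integral> J(x,y) dy\<close>. This rate is what the operator yields on the
constant function \<open>1\<close>. Its comparability with the weight \<open>g\<close> turns constants into super- and subsolutions of the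
equation with right-hand side \<open>g w\<close>.\<close>

locale killed_jump_operator =
  fixes M :: "'a measure" and J :: "'a \<Rightarrow> 'a \<Rightarrow> real" and A Jm c C \<gamma> :: real and g :: "'a \<Rightarrow> real"
  assumes fin: "finite_measure M"
    and J[measurable]: "(\<lambda>(x, y). J x y) \<in> borel_measurable (M \<Otimes>\<^sub>M M)"
    and J_nonneg: "0 \<le> J x y" and J_le: "J x y \<le> Jm" and J_sym: "J x y = J y x"
    and A: "0 < A" and c: "0 < c" and C: "0 < C" and \<gamma>: "0 < \<gamma>"
    and g[measurable]: "g \<in> borel_measurable M" and g_ge: "x \<in> space M \<Longrightarrow> \<gamma> \<le> g x"
    and killing_ge: "x \<in> space M \<Longrightarrow> c * g x \<le> A - (\<integral>y. J x y \<partial>M)"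
    and killing_le: "x \<in> space M \<Longrightarrow> A - (\<integral>y. J x y \<partial>M) \<le> C * g x"
begin

sublocale finite_measure M by (rule fin)

text \<open>The equation \<open>A u - \<integral> J(\<cdot>,y) u(y) dy = g w\<close> divided by \<open>A\<close> has the form \<open>u = f + P u\<close> with a contraction \<open>P\<close>.\<close>

definition solution :: "('a \<Rightarrow> real) \<Rightarrow> 'a \<Rightarrow> real" where
  "solution w x = enn2real (neumann_series M (\<lambda>x y. ennreal (J x y / A)) (\<lambda>x. ennreal (g x * w x / A)) x)"

lemma J_section [measurable]: "x \<in> space M \<Longrightarrow> J x \<in> borel_measurable M"
  using measurable_compose[OF measurable_Pair1' J] by simp

lemma J_integrable: "x \<in> space M \<Longrightarrow> integrable M (J x)"
  by (rule integrable_const_bound[where B = Jm]) (auto simp: J_nonneg J_le)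

lemma g_nonneg: "x \<in> space M \<Longrightarrow> 0 \<le> g x"
  using g_ge[of x] \<gamma> by linarith

lemma p_measurable: "(\<lambda>(x, y). ennreal (J x y / A)) \<in> borel_measurable (M \<Otimes>\<^sub>M M)"
  using J by (simp add: case_prod_beta')

lemma integral_p: "x \<in> space M \<Longrightarrow> (\<integral>\<^sup>+y. ennreal (J x y / A) \<partial>M) = ennreal ((\<integral>y. J x y \<partial>M) / A)"
  using A J_integrable by (subst nn_integral_eq_integral) (auto simp: J_nonneg)

lemma integral_p_const:
  "x \<in> space M \<Longrightarrow> 0 \<le> b \<Longrightarrow> (\<integral>\<^sup>+y. ennreal (J x y / A) * ennreal b \<partial>M) = ennreal ((\<integral>y. J x y \<partial>M) / A * b)"
  using A by (subst nn_integral_multc) (auto simp: integral_p ennreal_mult[symmetric] J_nonneg)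

context
  fixes w :: "'a \<Rightarrow> real" and b :: real
  assumes w[measurable]: "w \<in> borel_measurable M"
    and w_nonneg: "\<And>x. x \<in> space M \<Longrightarrow> 0 \<le> w x" and w_le: "\<And>x. x \<in> space M \<Longrightarrow> w x \<le> b"
    and b: "0 \<le> b"
begin

lemma source_measurable: "(\<lambda>x. ennreal (g x * w x / A)) \<in> borel_measurable M"
  by measurable

lemma neumann_le:
  assumes x: "x \<in> space M"
  shows "neumann_series M (\<lambda>x y. ennreal (J x y / A)) (\<lambda>x. ennreal (g x * w x / A)) x \<le> ennreal (b / c)"
proof (rule neumann_series_le_supersolution[OF sigma_finite_measure_axioms p_measurable _ x])
  fix x assume x: "x \<in> space M"
  have "g x * w x + (\<integral>y. J x y \<partial>M) * (b / c) \<le> g x * b + (A - c * g x) * (b / c)"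
    using x w_le[OF x] g_nonneg[OF x] killing_ge[OF x] b c by (intro add_mono mult_left_mono mult_right_mono) auto
  also have "\<dots> = A * (b / c)" using c by (simp add: field_simps)
  finally have "g x * w x / A + (\<integral>y. J x y \<partial>M) / A * (b / c) \<le> b / c"
    using A c by (simp add: field_simps)
  moreover have "0 \<le> (\<integral>y. J x y \<partial>M)" by (simp add: J_nonneg)
  ultimately show "ennreal (g x * w x / A) + (\<integral>\<^sup>+y. ennreal (J x y / A) * ennreal (b / c) \<partial>M) \<le> ennreal (b / c)"
    using x A b c g_nonneg[OF x] w_nonneg[OF x]
    by (simp add: integral_p_const ennreal_plus[symmetric] ennreal_leI del: ennreal_plus)
qed

lemma ennreal_solution:
  "x \<in> space M \<Longrightarrow> ennreal (solution w x) = neumann_series M (\<lambda>x y. ennreal (J x y / A)) (\<lambda>x. ennreal (g x * w x / A)) x"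
  unfolding solution_def by (intro ennreal_enn2real le_less_trans[OF neumann_le ennreal_less_top])

lemma solution_measurable: "solution w \<in> borel_measurable M"
  unfolding solution_def[abs_def]
  using neumann_series_measurable[OF sigma_finite_measure_axioms p_measurable source_measurable] by measurable

lemma solution_nonneg: "0 \<le> solution w x"
  by (simp add: solution_def)

lemma solution_le:
  assumes x: "x \<in> space M" shows "solution w x \<le> b / c"
proof -
  have "ennreal (solution w x) \<le> ennreal (b / c)" using neumann_le[OF x] by (simp add: ennreal_solution[OF x])
  then show ?thesis using b c by (simp add: ennreal_le_iff)
qed

lemma solution_eq:
  assumes x: "x \<in> space M"
  shows "A * solution w x = g x * w x + (\<integral>y. J x y * solution w y \<partial>M)"
proof -
  note [measurable] = solution_measurable J_section[OF x]
  have i: "integrable M (\<lambda>y. J x y * solution w y)"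
  proof (rule integrable_const_bound[where B = "Jm * (b / c)"])
    show "AE y in M. norm (J x y * solution w y) \<le> Jm * (b / c)"
    proof (rule AE_I2)
      fix y assume "y \<in> space M"
      then have "J x y * solution w y \<le> Jm * (b / c)"
        using order_trans[OF J_nonneg J_le] by (intro mult_mono J_le solution_le solution_nonneg) auto
      then show "norm (J x y * solution w y) \<le> Jm * (b / c)" by (simp add: J_nonneg solution_nonneg)
    qed
  qed simp
  have "ennreal (solution w x) = ennreal (g x * w x / A) + (\<integral>\<^sup>+y. ennreal (J x y / A) * ennreal (solution w y) \<partial>M)"
    unfolding ennreal_solution[OF x]
    by (subst neumann_series_fixed_point[OF sigma_finite_measure_axioms p_measurable source_measurable x])
       (auto intro!: arg_cong2[of _ _ _ _ "(+)"] nn_integral_cong simp: ennreal_solution)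
  also have "(\<integral>\<^sup>+y. ennreal (J x y / A) * ennreal (solution w y) \<partial>M) = (\<integral>\<^sup>+y. ennreal (J x y * solution w y / A) \<partial>M)"
    using A by (intro nn_integral_cong) (simp add: ennreal_mult[symmetric] J_nonneg solution_nonneg)
  also have "\<dots> = ennreal ((\<integral>y. J x y * solution w y \<partial>M) / A)"
    using i A by (subst nn_integral_eq_integral) (auto simp: J_nonneg solution_nonneg)
  also have "ennreal (g x * w x / A) + ennreal ((\<integral>y. J x y * solution w y \<partial>M) / A)
      = ennreal (g x * w x / A + (\<integral>y. J x y * solution w y \<partial>M) / A)"
    using A x by (intro ennreal_plus[symmetric]) (auto simp: g_nonneg w_nonneg J_nonneg solution_nonneg)
  finally have "solution w x = g x * w x / A + (\<integral>y. J x y * solution w y \<partial>M) / A"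
    using A x by (subst (asm) ennreal_inj) (auto simp: g_nonneg w_nonneg J_nonneg solution_nonneg intro!: add_nonneg_nonneg)
  then show ?thesis using A by (simp add: field_simps)
qed

lemma solution_ge:
  assumes x: "x \<in> space M" and \<beta>: "0 \<le> \<beta>" "\<And>x. x \<in> space M \<Longrightarrow> \<beta> \<le> w x"
  shows "\<beta> / C \<le> solution w x"
proof -
  have "ennreal (\<beta> / C) \<le> neumann_series M (\<lambda>x y. ennreal (J x y / A)) (\<lambda>x. ennreal (g x * w x / A)) x"
  proof (rule neumann_series_ge_subsolution[where \<theta> = "1 - c * \<gamma> / A", OF sigma_finite_measure_axioms p_measurable source_measurable _ _ _ _ _ x])
    show "0 \<le> \<beta> / C" using \<beta> C by simp
    have K: "0 \<le> (\<integral>y. J x y \<partial>M)" "(\<integral>y. J x y \<partial>M) \<le> A - c * \<gamma>" if "x \<in> space M" for x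
    proof -
      show "0 \<le> (\<integral>y. J x y \<partial>M)" by (simp add: J_nonneg)
      show "(\<integral>y. J x y \<partial>M) \<le> A - c * \<gamma>"
        using killing_ge[OF that] mult_left_mono[OF g_ge[OF that] less_imp_le[OF c]] by linarith
    qed
    have "c * \<gamma> \<le> A" using K[OF x] by linarith
    then show "0 \<le> 1 - c * \<gamma> / A" using A by simp
    show "1 - c * \<gamma> / A < 1" using A c \<gamma> by simp
    show "(\<integral>\<^sup>+y. ennreal (J x y / A) \<partial>M) \<le> ennreal (1 - c * \<gamma> / A)" if "x \<in> space M" for x
      unfolding integral_p[OF that] using K[OF that] A by (intro ennreal_leI) (simp add: field_simps)
    fix x assume x: "x \<in> space M"
    have "A * (\<beta> / C) = C * g x * (\<beta> / C) + (A - C * g x) * (\<beta> / C)" by (simp add: algebra_simps)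
    also have "\<dots> \<le> g x * w x + (\<integral>y. J x y \<partial>M) * (\<beta> / C)"
      using \<beta>(2)[OF x] g_nonneg[OF x] killing_le[OF x] C \<beta>(1)
      by (intro add_mono mult_right_mono) (auto intro: mult_left_mono)
    finally have "\<beta> / C \<le> g x * w x / A + (\<integral>y. J x y \<partial>M) / A * (\<beta> / C)" using A C by (simp add: field_simps)
    then show "ennreal (\<beta> / C) \<le> ennreal (g x * w x / A) + (\<integral>\<^sup>+y. ennreal (J x y / A) * ennreal (\<beta> / C) \<partial>M)"
      using x A \<beta>(1) C g_nonneg[OF x] w_nonneg[OF x] K[OF x]
      by (simp add: integral_p_const ennreal_plus[symmetric] ennreal_leI del: ennreal_plus)
  qed
  then have "ennreal (\<beta> / C) \<le> ennreal (solution w x)" by (simp add: ennreal_solution[OF x])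
  then show ?thesis by (simp add: ennreal_le_iff solution_nonneg)
qed

text \<open>The symmetry of \<open>J\<close> moves the operator to \<open>\<psi>\<close>. In this form the kernel no longer acts on the solution, and only weak
convergence of the solution is needed to remove the regularization.\<close>

lemma solution_weak_form:
  assumes \<psi>[measurable]: "\<psi> \<in> borel_measurable M" and m: "\<And>x. x \<in> space M \<Longrightarrow> \<bar>\<psi> x\<bar> \<le> m"
  shows "(\<integral>x. solution w x * (A * \<psi> x - (\<integral>y. J x y * \<psi> y \<partial>M)) \<partial>M) = (\<integral>x. g x * w x * \<psi> x \<partial>M)"
proof -
  note [measurable] = solution_measurable
  interpret pair_sigma_finite M M ..
  interpret P: finite_measure "M \<Otimes>\<^sub>M M" by (rule finite_measure_pair_measure) unfold_locales
  have Jm: "0 \<le> Jm" using order_trans[OF J_nonneg J_le] .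
  have bc: "0 \<le> b / c" using b c by simp
  have bound: "\<bar>solution w x * (J x y * \<psi> y)\<bar> \<le> (b / c) * (Jm * m)" if "x \<in> space M" "y \<in> space M" for x y
    unfolding abs_mult using that bc Jm order_trans[OF abs_ge_zero m[OF that(2)]]
    by (intro mult_mono mult_nonneg_nonneg m) (auto simp: J_nonneg J_le solution_nonneg solution_le)
  have int: "integrable (M \<Otimes>\<^sub>M M) (\<lambda>(x, y). solution w x * (J x y * \<psi> y))"
  proof (rule P.integrable_const_bound[where B = "(b / c) * (Jm * m)"])
    show "AE z in M \<Otimes>\<^sub>M M. norm (case z of (x, y) \<Rightarrow> solution w x * (J x y * \<psi> y)) \<le> (b / c) * (Jm * m)"
    proof (rule AE_I2)
      fix z assume "z \<in> space (M \<Otimes>\<^sub>M M)"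
      then show "norm (case z of (x, y) \<Rightarrow> solution w x * (J x y * \<psi> y)) \<le> (b / c) * (Jm * m)"
        using bound[of "fst z" "snd z"] by (simp only: case_prod_beta' space_pair_measure mem_Times_iff real_norm_def)
    qed
    show "(\<lambda>(x, y). solution w x * (J x y * \<psi> y)) \<in> borel_measurable (M \<Otimes>\<^sub>M M)"
      using J by (simp add: case_prod_beta')
  qed
  have K_bound: "\<bar>\<integral>y. J x y * \<psi> y \<partial>M\<bar> \<le> Jm * m * measure M (space M)" if x: "x \<in> space M" for x
  proof -
    note [measurable] = J_section[OF x]
    have le: "norm (J x y * \<psi> y) \<le> Jm * m" if "y \<in> space M" for y
      unfolding norm_mult using that Jm by (intro mult_mono) (auto simp: J_nonneg J_le m)
    have int: "integrable M (\<lambda>y. J x y * \<psi> y)"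
      using le by (intro integrable_const_bound[where B = "Jm * m"] AE_I2) auto
    have "norm (\<integral>y. J x y * \<psi> y \<partial>M) \<le> (\<integral>y. norm (J x y * \<psi> y) \<partial>M)"
      by (rule integral_norm_bound)
    also have "\<dots> \<le> (\<integral>y. Jm * m \<partial>M)"
      using int le by (intro integral_mono) auto
    finally have "norm (\<integral>y. J x y * \<psi> y \<partial>M) \<le> (\<integral>y. Jm * m \<partial>M)" .
    then show ?thesis by (simp add: mult_ac)
  qed
  have Kmeas[measurable]: "(\<lambda>x. \<integral>y. J x y * \<psi> y \<partial>M) \<in> borel_measurable M"
    by measurable
  have i0: "integrable M \<psi>" using m by (intro integrable_const_bound[where B = m] AE_I2) auto
  have sol_bound: "\<bar>solution w x\<bar> \<le> b / c" if "x \<in> space M" for x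
    using solution_le[OF that] by (simp add: solution_nonneg)
  have i1: "integrable M (\<lambda>x. solution w x * (A * \<psi> x))"
    by (intro finite_measure_integrable_bounded(1)[OF _ solution_measurable sol_bound] integrable_mult_right i0)
  have i2: "integrable M (\<lambda>x. solution w x * (\<integral>y. J x y * \<psi> y \<partial>M))"
    by (intro finite_measure_integrable_bounded(1)[OF _ solution_measurable sol_bound]
        integrable_const_bound[where B = "Jm * m * measure M (space M)"] AE_I2 Kmeas) (simp add: K_bound)
  have i3: "integrable M (\<lambda>x. (\<integral>y. J x y * solution w y \<partial>M) * \<psi> x)"
    and i4: "integrable M (\<lambda>x. g x * w x * \<psi> x)"
  proof -
    have g_le: "g x \<le> A / c" if "x \<in> space M" for x
    proof -
      have "0 \<le> (\<integral>y. J x y \<partial>M)" by (simp add: J_nonneg)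
      then have "c * g x \<le> A" using killing_ge[OF that] by linarith
      then show ?thesis using c by (simp add: field_simps)
    qed
    show i4: "integrable M (\<lambda>x. g x * w x * \<psi> x)"
    proof (rule finite_measure_integrable_bounded(1)[OF i0])
      show "\<bar>g x * w x\<bar> \<le> A / c * b" if "x \<in> space M" for x
        unfolding abs_mult using that A c by (intro mult_mono) (auto simp: g_nonneg w_nonneg g_le w_le)
    qed simp
    have "integrable M (\<lambda>x. A * solution w x * \<psi> x - g x * w x * \<psi> x)"
      using i1 i4 by (intro Bochner_Integration.integrable_diff) (auto simp: mult_ac)
    then show "integrable M (\<lambda>x. (\<integral>y. J x y * solution w y \<partial>M) * \<psi> x)"
      by (rule Bochner_Integration.integrable_cong[THEN iffD1, rotated -1]) (auto simp: solution_eq algebra_simps)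
  qed
  have "(\<integral>x. solution w x * (\<integral>y. J x y * \<psi> y \<partial>M) \<partial>M) = (\<integral>x. (\<integral>y. solution w x * (J x y * \<psi> y) \<partial>M) \<partial>M)"
    by simp
  also have "\<dots> = (\<integral>y. (\<integral>x. solution w x * (J x y * \<psi> y) \<partial>M) \<partial>M)"
    using Fubini_integral[OF int] by simp
  also have "\<dots> = (\<integral>y. (\<integral>x. J y x * solution w x \<partial>M) * \<psi> y \<partial>M)"
  proof (intro Bochner_Integration.integral_cong refl)
    fix y
    have "(\<lambda>x. solution w x * (J x y * \<psi> y)) = (\<lambda>x. J y x * solution w x * \<psi> y)"
      by (auto simp: J_sym[of _ y] mult_ac)
    then show "(\<integral>x. solution w x * (J x y * \<psi> y) \<partial>M) = (\<integral>x. J y x * solution w x \<partial>M) * \<psi> y"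
      by simp
  qed
  finally have swap: "(\<integral>x. solution w x * (\<integral>y. J x y * \<psi> y \<partial>M) \<partial>M) = (\<integral>x. (\<integral>y. J x y * solution w y \<partial>M) * \<psi> x \<partial>M)" .
  have "(\<integral>x. solution w x * (A * \<psi> x - (\<integral>y. J x y * \<psi> y \<partial>M)) \<partial>M)
     = (\<integral>x. solution w x * (A * \<psi> x) \<partial>M) - (\<integral>x. solution w x * (\<integral>y. J x y * \<psi> y \<partial>M) \<partial>M)"
    unfolding right_diff_distrib by (rule Bochner_Integration.integral_diff[OF i1 i2])
  also have "\<dots> = (\<integral>x. solution w x * (A * \<psi> x) - (\<integral>y. J x y * solution w y \<partial>M) * \<psi> x \<partial>M)"
    unfolding swap by (rule Bochner_Integration.integral_diff[OF i1 i3, symmetric])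
  also have "\<dots> = (\<integral>x. g x * w x * \<psi> x \<partial>M)"
  proof (intro Bochner_Integration.integral_cong refl)
    fix x assume x: "x \<in> space M"
    have "solution w x * (A * \<psi> x) = (A * solution w x) * \<psi> x" by simp
    then show "solution w x * (A * \<psi> x) - (\<integral>y. J x y * solution w y \<partial>M) * \<psi> x = g x * w x * \<psi> x"
      by (simp only: solution_eq[OF x]) (simp add: algebra_simps)
  qed
  finally show ?thesis .
qed

end

lemma solution_mono:
  assumes "w \<in> borel_measurable M" "w' \<in> borel_measurable M"
    and "\<And>x. x \<in> space M \<Longrightarrow> 0 \<le> w x" "\<And>x. x \<in> space M \<Longrightarrow> w x \<le> w' x" "\<And>x. x \<in> space M \<Longrightarrow> w' x \<le> b"
    and "0 \<le> b" and x: "x \<in> space M"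
  shows "solution w x \<le> solution w' x"
proof -
  have w': "\<And>x. x \<in> space M \<Longrightarrow> 0 \<le> w' x" "\<And>x. x \<in> space M \<Longrightarrow> w x \<le> b"
    using assms(3-5) order_trans by blast+
  have "neumann_series M (\<lambda>x y. ennreal (J x y / A)) (\<lambda>x. ennreal (g x * w x / A)) x
      \<le> neumann_series M (\<lambda>x y. ennreal (J x y / A)) (\<lambda>x. ennreal (g x * w' x / A)) x"
    using A assms(4) g_nonneg
    by (intro neumann_series_mono[OF sigma_finite_measure_axioms p_measurable _ x] ennreal_leI divide_right_mono mult_left_mono) auto
  then have "ennreal (solution w x) \<le> ennreal (solution w' x)"
    by (simp only: ennreal_solution[OF assms(1,3) w'(2) assms(6) x] ennreal_solution[OF assms(2) w'(1) assms(5,6) x])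
  then show ?thesis by (simp add: ennreal_le_iff solution_nonneg[OF assms(2) w'(1) assms(5,6)] solution_def)
qed

end

section \<open>The killing rate of the domain\<close>

text \<open>The segment from a point of \<open>\<Omega>\<close> to a point of the complement meets the frontier.\<close>

lemma infdist_frontier_le_dist:
  fixes \<Omega> :: "'a::euclidean_space set"
  assumes "x \<in> \<Omega>" "y \<notin> \<Omega>"
  shows "infdist x (frontier \<Omega>) \<le> dist x y"
proof -
  have "closed_segment x y \<inter> frontier \<Omega> \<noteq> {}"
    by (rule connected_Int_frontier) (use assms in auto)
  then obtain z where z: "z \<in> closed_segment x y" "z \<in> frontier \<Omega>" by blast
  have "infdist x (frontier \<Omega>) \<le> dist x z" by (rule infdist_le) (rule z)
  also have "\<dots> \<le> dist x y" using segment_bound(1)[OF z(1)] by (simp add: dist_norm norm_minus_commute)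
  finally show ?thesis .
qed

lemma infdist_frontier_pos:
  fixes \<Omega> :: "'a::euclidean_space set"
  assumes "open \<Omega>" "x \<in> \<Omega>" "frontier \<Omega> \<noteq> {}"
  shows "0 < infdist x (frontier \<Omega>)"
proof -
  have "x \<notin> frontier \<Omega>" using assms by (simp add: frontier_def interior_open)
  then show ?thesis using assms(3) by (intro infdist_pos_not_in_closed) auto
qed

lemma frontier_nonempty:
  fixes \<Omega> :: "'a::euclidean_space set"
  assumes "bounded \<Omega>" "\<Omega> \<noteq> {}" shows "frontier \<Omega> \<noteq> {}"
  using assms by (metis frontier_not_empty not_bounded_UNIV)

lemma infdist_frontier_bounded:
  fixes \<Omega> :: "'a::euclidean_space set"
  assumes "bounded \<Omega>" "\<Omega> \<noteq> {}"
  shows "\<exists>D. \<forall>x\<in>\<Omega>. infdist x (frontier \<Omega>) \<le> D"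
proof -
  obtain p where p: "p \<in> frontier \<Omega>" using frontier_nonempty[OF assms] by blast
  obtain B where B: "\<And>x. x \<in> \<Omega> \<Longrightarrow> dist p x \<le> B" using assms(1) bounded_any_center[of \<Omega> p] by auto
  have "infdist x (frontier \<Omega>) \<le> B" if "x \<in> \<Omega>" for x
    using infdist_le[OF p, of x] B[OF that] by (simp add: dist_commute)
  then show ?thesis by blast
qed

lemma finite_measure_restrict_lborel:
  fixes \<Omega> :: "'a::euclidean_space set"
  assumes "bounded \<Omega>" "open \<Omega>"
  shows "finite_measure (restrict_space lborel \<Omega>)"
proof
  have "emeasure (restrict_space lborel \<Omega>) (space (restrict_space lborel \<Omega>)) = emeasure lborel \<Omega>"
    using assms(2) by (simp add: emeasure_restrict_space space_restrict_space)
  also have "\<dots> \<noteq> \<infinity>" using emeasure_bounded_finite[OF assms(1)] by simp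
  finally show "emeasure (restrict_space lborel \<Omega>) (space (restrict_space lborel \<Omega>)) \<noteq> \<infinity>" .
qed

lemma integral_restrict_lborel:
  fixes f :: "'a::euclidean_space \<Rightarrow> real"
  assumes "open \<Omega>"
  shows "(\<integral>x. f x \<partial>restrict_space lborel \<Omega>) = (\<integral>x. indicator \<Omega> x * f x \<partial>lborel)"
  using assms by (subst integral_restrict_space) auto

text \<open>The killing rate of the kernel restricted to \<open>\<Omega>\<close> is the rate of jumps into the complement.\<close>

lemma killing_decomposition:
  fixes \<Omega> :: "(real ^ 'n) set" and \<kappa> :: "real ^ 'n \<Rightarrow> real"
  assumes "open \<Omega>" and \<kappa>: "integrable lborel \<kappa>"
  shows "integrable lborel (\<lambda>y. indicator (- \<Omega>) y * \<kappa> (x - y))"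
    and "(\<integral>z. \<kappa> z \<partial>lborel) - (\<integral>y. \<kappa> (x - y) \<partial>restrict_space lborel \<Omega>) = (\<integral>y. indicator (- \<Omega>) y * \<kappa> (x - y) \<partial>lborel)"
    and "integrable lborel (\<lambda>y. \<kappa> (x - y))"
proof -
  have [measurable]: "\<kappa> \<in> borel_measurable borel" using \<kappa> by auto
  have [measurable]: "\<Omega> \<in> sets borel" using assms(1) by simp
  have "integrable (distr lborel borel (\<lambda>y. x - y)) \<kappa> \<longleftrightarrow> integrable lborel (\<lambda>y. \<kappa> (x - y))"
    by (rule integrable_distr_eq) measurable
  then show int: "integrable lborel (\<lambda>y. \<kappa> (x - y))" using \<kappa> by (simp add: lborel_distr_reflect)
  have i1: "integrable lborel (\<lambda>y. indicator A y * \<kappa> (x - y))" if [measurable]: "A \<in> sets borel" for A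
    by (rule Bochner_Integration.integrable_bound[OF int]) (auto simp: indicator_def)
  show i2: "integrable lborel (\<lambda>y. indicator (- \<Omega>) y * \<kappa> (x - y))" by (rule i1) measurable
  have "(\<integral>z. \<kappa> z \<partial>lborel) = (\<integral>y. \<kappa> (x - y) \<partial>lborel)" by (simp add: integral_lborel_reflect)
  also have "\<dots> = (\<integral>y. indicator \<Omega> y * \<kappa> (x - y) + indicator (- \<Omega>) y * \<kappa> (x - y) \<partial>lborel)"
    by (intro Bochner_Integration.integral_cong) (auto simp: indicator_def)
  also have "\<dots> = (\<integral>y. indicator \<Omega> y * \<kappa> (x - y) \<partial>lborel) + (\<integral>y. indicator (- \<Omega>) y * \<kappa> (x - y) \<partial>lborel)"
    by (rule Bochner_Integration.integral_add[OF i1 i2]) measurable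
  finally show "(\<integral>z. \<kappa> z \<partial>lborel) - (\<integral>y. \<kappa> (x - y) \<partial>restrict_space lborel \<Omega>) = (\<integral>y. indicator (- \<Omega>) y * \<kappa> (x - y) \<partial>lborel)"
    by (simp add: integral_restrict_lborel[OF assms(1)])
qed

text \<open>The killing rate is of the order \<open>m\<^sup>-\<^sup>2\<^sup>s\<close> with \<open>m = max d \<delta>\<close>, uniformly in \<open>\<delta>\<close>. The lower bound comes from an exterior
ball of radius \<open>c\<^sub>0 m\<close> within distance \<open>m\<close> of the boundary point nearest to \<open>x\<close>: on it the kernel is at least
\<open>(2 m)\<^bsup>-N-2s\<^esup>\<close>. For the upper bound, all exterior points have distance at least \<open>d\<close> from \<open>x\<close>, and the total mass of the
capped kernel is proportional to \<open>\<delta>\<^sup>-\<^sup>2\<^sup>s\<close>.\<close>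

lemma killing_bounds:
  fixes \<Omega> :: "(real ^ 'n) set"
  assumes \<Omega>: "C11_domain \<Omega>" "bounded \<Omega>" and s: "0 < s"
  defines "d \<equiv> (\<lambda>x. infdist x (frontier \<Omega>))"
  obtains c C where "0 < c" "0 < C" "\<And>\<delta> x. 0 < \<delta> \<Longrightarrow> \<delta> \<le> 1 \<Longrightarrow> x \<in> \<Omega> \<Longrightarrow>
      c * max (d x) \<delta> powr (-2 * s) \<le> (\<integral>z. capped_kernel s \<delta> (z :: real ^ 'n) \<partial>lborel) - (\<integral>y. capped_kernel s \<delta> (x - y) \<partial>restrict_space lborel \<Omega>) \<and>
      (\<integral>z. capped_kernel s \<delta> (z :: real ^ 'n) \<partial>lborel) - (\<integral>y. capped_kernel s \<delta> (x - y) \<partial>restrict_space lborel \<Omega>) \<le> C * max (d x) \<delta> powr (-2 * s)"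
proof -
  have op: "open \<Omega>" and ne: "\<Omega> \<noteq> {}" using \<Omega> by (auto simp: C11_domain_def)
  note [measurable] = borel_open[OF op]
  have fne: "frontier \<Omega> \<noteq> {}" by (rule frontier_nonempty[OF \<Omega>(2) ne])
  obtain D where D: "\<And>x. x \<in> \<Omega> \<Longrightarrow> d x \<le> D"
    using infdist_frontier_bounded[OF \<Omega>(2) ne] unfolding d_def by blast
  define R where "R = max D 1"
  have R: "R > 0" by (simp add: R_def)
  obtain c0 where c0: "c0 > 0" "\<And>p \<rho>. p \<in> frontier \<Omega> \<Longrightarrow> 0 < \<rho> \<Longrightarrow> \<rho> \<le> R \<Longrightarrow> \<exists>z. ball z (c0 * \<rho>) \<subseteq> ball p \<rho> - \<Omega>"
    using exterior_ball_uniform[OF \<Omega> R] by blast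
  let ?N = "real CARD('n)"
  define v where "v = measure lborel (ball (0 :: real ^ 'n) 1)"
  have v: "v > 0" unfolding v_def by (rule content_ball_pos) simp
  define c where "c = 2 powr (- (?N + 2 * s)) * c0 ^ CARD('n) * v"
  have c: "c > 0" using c0 v by (simp add: c_def)
  define T where "T = (\<integral>z. jump_kernel s z * indicator {z. 1 \<le> norm z} z \<partial>(lborel :: (real ^ 'n) measure))"
  define A where "A = (\<integral>z. capped_kernel s 1 z \<partial>(lborel :: (real ^ 'n) measure))"
  have T0: "T \<ge> 0" and A0: "A \<ge> 0" by (simp_all add: T_def A_def)
  \<comment> \<open>In the upper constant, \<open>T\<close> serves the case \<open>\<delta> \<le> d x\<close>, \<open>A\<close> the case \<open>d x < \<delta>\<close>, and \<open>1\<close> makes the sum positive.\<close>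
  have "c * max (d x) \<delta> powr (-2 * s) \<le> (\<integral>y. indicator (- \<Omega>) y * capped_kernel s \<delta> (x - y) \<partial>lborel) \<and>
      (\<integral>y. indicator (- \<Omega>) y * capped_kernel s \<delta> (x - y) \<partial>lborel) \<le> (T + A + 1) * max (d x) \<delta> powr (-2 * s)"
    if \<delta>: "0 < \<delta>" "\<delta> \<le> 1" and x: "x \<in> \<Omega>" for \<delta> x
  proof
    note cap = integrable_capped_kernel(1)[OF s \<delta>(1), where 'n = 'n]
    note int = killing_decomposition(1)[OF op cap, of x]
    define m where "m = max (d x) \<delta>"
    have m: "0 < m" "m \<le> R" "d x \<le> m" "\<delta> \<le> m" using \<delta> D[OF x] by (auto simp: m_def R_def)
    obtain p where p: "p \<in> frontier \<Omega>" "d x = dist x p"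
      using infdist_attains_inf[OF frontier_closed fne, of x] by (auto simp: d_def)
    obtain z where z: "ball z (c0 * m) \<subseteq> ball p m - \<Omega>" using c0(2)[OF p(1) m(1,2)] by blast
    let ?K = "inverse ((2 * m) powr (?N + 2 * s))"
    have "(\<integral>y. ?K * indicator (ball z (c0 * m)) y \<partial>lborel) \<le> (\<integral>y. indicator (- \<Omega>) y * capped_kernel s \<delta> (x - y) \<partial>lborel)"
    proof (rule integral_mono[OF _ int])
      show "integrable lborel (\<lambda>y. ?K * indicator (ball z (c0 * m)) y)"
        using emeasure_lborel_ball_finite[of z "c0 * m"] by (intro integrable_mult_right integrable_real_indicator) auto
      fix y
      show "?K * indicator (ball z (c0 * m)) y \<le> indicator (- \<Omega>) y * capped_kernel s \<delta> (x - y)"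
      proof (cases "y \<in> ball z (c0 * m)")
        case True
        then have y: "y \<notin> \<Omega>" "dist p y < m" using z by auto
        have "norm (x - y) \<le> 2 * m" using y(2) p(2) m(3) dist_triangle[of x y p] by (simp add: dist_norm)
        then have "max (norm (x - y)) \<delta> \<le> 2 * m" using m by simp
        then have "?K \<le> capped_kernel s \<delta> (x - y)"
          unfolding capped_kernel_def using \<delta>(1) s by (intro le_imp_inverse_le powr_mono2) (auto simp: max_def)
        then show ?thesis using True y by simp
      qed simp
    qed
    also have "(\<integral>y. ?K * indicator (ball z (c0 * m)) y \<partial>lborel) = c * m powr (-2 * s)"
    proof -
      have "measure lborel (ball z (c0 * m)) = (c0 * m) ^ CARD('n) * v"
        using content_ball_conv_unit_ball[of "c0 * m" z] c0(1) m(1) by (simp add: v_def)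
      then have "(\<integral>y. ?K * indicator (ball z (c0 * m)) y \<partial>lborel) = ?K * ((c0 * m) ^ CARD('n) * v)" by simp
      also have "\<dots> = (2 * m) powr (- (?N + 2 * s)) * (c0 ^ CARD('n) * m powr ?N * v)"
        using m(1) by (simp only: powr_minus power_mult_distrib powr_realpow)
      also have "(2 * m) powr (- (?N + 2 * s)) = 2 powr (- (?N + 2 * s)) * m powr (- (?N + 2 * s))"
        by (rule powr_mult)
      also have "2 powr (- (?N + 2 * s)) * m powr (- (?N + 2 * s)) * (c0 ^ CARD('n) * m powr ?N * v) = c * (m powr (- (?N + 2 * s)) * m powr ?N)"
        by (simp add: c_def)
      also have "m powr (- (?N + 2 * s)) * m powr ?N = m powr (-2 * s)" by (simp add: powr_add[symmetric])
      finally show ?thesis .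
    qed
    finally show "c * max (d x) \<delta> powr (-2 * s) \<le> (\<integral>y. indicator (- \<Omega>) y * capped_kernel s \<delta> (x - y) \<partial>lborel)"
      by (simp add: m_def)
    show "(\<integral>y. indicator (- \<Omega>) y * capped_kernel s \<delta> (x - y) \<partial>lborel) \<le> (T + A + 1) * max (d x) \<delta> powr (-2 * s)"
    proof (cases "\<delta> \<le> d x")
      case True
      then have dx: "0 < d x" using \<delta> by simp
      note tail = integrable_jump_kernel_tail[OF s dx, where 'n = 'n]
      have "(\<integral>y. indicator (- \<Omega>) y * capped_kernel s \<delta> (x - y) \<partial>lborel)
          \<le> (\<integral>y. jump_kernel s (x - y) * indicator {z. d x \<le> norm z} (x - y) \<partial>lborel)"
      proof (rule integral_mono[OF int killing_decomposition(3)[OF op tail(1)]])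
        fix y
        show "indicator (- \<Omega>) y * capped_kernel s \<delta> (x - y) \<le> jump_kernel s (x - y) * indicator {z. d x \<le> norm z} (x - y)"
        proof (cases "y \<in> \<Omega>")
          case False
          then have "d x \<le> norm (x - y)" using infdist_frontier_le_dist[OF x False] by (simp add: d_def dist_norm)
          then show ?thesis using True False by (simp add: capped_kernel_eq_jump_kernel)
        qed simp
      qed
      also have "\<dots> = (\<integral>z. jump_kernel s z * indicator {z. d x \<le> norm z} z \<partial>(lborel :: (real ^ 'n) measure))"
        by (rule integral_lborel_reflect[of "\<lambda>z. jump_kernel s z * indicator {z. d x \<le> norm z} z"]) measurable
      also have "\<dots> = d x powr (-2 * s) * T" by (simp only: tail(2) T_def)
      also have "\<dots> \<le> (T + A + 1) * d x powr (-2 * s)" using T0 A0 by (simp add: mult.commute mult_right_mono)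
      finally show ?thesis using True by (simp add: max_def)
    next
      case False
      have "(\<integral>y. indicator (- \<Omega>) y * capped_kernel s \<delta> (x - y) \<partial>lborel) \<le> (\<integral>y. capped_kernel s \<delta> (x - y) \<partial>lborel)"
        by (rule integral_mono[OF int killing_decomposition(3)[OF op cap]]) (auto simp: indicator_def)
      also have "\<dots> = (\<integral>z. capped_kernel s \<delta> (z :: real ^ 'n) \<partial>lborel)" by (rule integral_lborel_reflect) measurable
      also have "\<dots> = \<delta> powr (-2 * s) * A" by (simp only: integrable_capped_kernel(2)[OF s \<delta>(1)] A_def)
      also have "\<dots> \<le> (T + A + 1) * \<delta> powr (-2 * s)" using T0 A0 by (simp add: mult.commute mult_right_mono)
      finally show ?thesis using False by (simp add: max_def)
    qed
  qed
  then show ?thesis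
    using that[of c "T + A + 1"] c T0 A0 by (simp add: killing_decomposition(2)[OF op integrable_capped_kernel(1)[OF s]])
qed

section \<open>The Green operator\<close>

lemma AE_le_of_set_integrals_le:
  fixes f g :: "'a \<Rightarrow> real"
  assumes f: "integrable M f" and g: "integrable M g"
    and le: "\<And>A. A \<in> sets M \<Longrightarrow> (\<integral>x. f x * indicator A x \<partial>M) \<le> (\<integral>x. g x * indicator A x \<partial>M)"
  shows "AE x in M. f x \<le> g x"
proof -
  have [measurable]: "f \<in> borel_measurable M" "g \<in> borel_measurable M" using f g by auto
  define A where "A = {x \<in> space M. g x < f x}"
  have A[measurable]: "A \<in> sets M" by (simp add: A_def)
  have i: "integrable M (\<lambda>x. f x * indicator A x)" "integrable M (\<lambda>x. g x * indicator A x)"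
    using f g by (auto intro: integrable_real_mult_indicator)
  have int: "integrable M (\<lambda>x. f x * indicator A x - g x * indicator A x)" using i by auto
  have nn: "AE x in M. 0 \<le> f x * indicator A x - g x * indicator A x"
    by (rule AE_I2) (auto simp: A_def indicator_def)
  have "(\<integral>x. f x * indicator A x - g x * indicator A x \<partial>M) \<le> 0"
    using le[OF A] by (simp add: i)
  then have "(\<integral>x. f x * indicator A x - g x * indicator A x \<partial>M) = 0"
    using integral_nonneg_AE[OF nn] by simp
  then have "AE x in M. f x * indicator A x - g x * indicator A x = 0"
    using integral_nonneg_eq_0_iff_AE[OF int nn] by simp
  with AE_space show ?thesis
  proof eventually_elim
    case (elim x)
    then show ?case by (cases "x \<in> A") (auto simp: A_def)
  qed
qed

lemma hypersingular_measurable: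
  fixes f :: "real ^ 'n \<Rightarrow> real"
  assumes [measurable]: "f \<in> borel_measurable borel"
  shows "hypersingular s f \<in> borel_measurable borel"
  unfolding hypersingular_def[abs_def] by measurable

text \<open>One bound for all kernels below the singular one provides the dominating constant for the limit \<open>\<delta> \<rightarrow> 0\<close>.\<close>

lemma second_difference_integral_bounded:
  fixes f :: "real ^ 'n \<Rightarrow> real"
  assumes s: "0 < s" "s < 1" and f: "bounded_smooth f"
  shows "\<exists>B. \<forall>\<kappa> x. \<kappa> \<in> borel_measurable borel \<longrightarrow> (\<forall>z. z \<noteq> 0 \<longrightarrow> 0 \<le> \<kappa> z \<and> \<kappa> z \<le> jump_kernel s z) \<longrightarrow>
    \<bar>(\<integral>z. \<kappa> z *\<^sub>R (2 *\<^sub>R f x - f (x + z) - f (x - z)) \<partial>lborel) /\<^sub>R 2\<bar> \<le> B"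
proof -
  have [measurable]: "f \<in> borel_measurable borel" using f by (simp add: bounded_smooth_def smooth_borel)
  obtain C where C: "C \<ge> 0" "\<And>x z. norm (2 *\<^sub>R f x - f (x + z) - f (x - z)) \<le> C * min 1 ((norm z)\<^sup>2)"
    using bounded_smooth_second_difference[OF f] by blast
  let ?w = "\<lambda>z :: real ^ 'n. C * (min 1 (norm z ^ 2) * jump_kernel s z)"
  have jint: "integrable lborel ?w"
    by (intro integrable_mult_right integrable_jump_kernel_second_order s)
  have "\<bar>(\<integral>z. \<kappa> z *\<^sub>R (2 *\<^sub>R f x - f (x + z) - f (x - z)) \<partial>lborel) /\<^sub>R 2\<bar> \<le> (\<integral>z. ?w z \<partial>lborel)"
    if [measurable]: "\<kappa> \<in> borel_measurable borel" and \<kappa>: "\<And>z. z \<noteq> 0 \<Longrightarrow> 0 \<le> \<kappa> z \<and> \<kappa> z \<le> jump_kernel s z" for \<kappa> x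
  proof -
    let ?g = "\<lambda>z. \<kappa> z *\<^sub>R (2 *\<^sub>R f x - f (x + z) - f (x - z))"
    have le: "\<bar>?g z\<bar> \<le> ?w z" for z
    proof (cases "z = 0")
      case False
      have "\<kappa> z * norm (2 *\<^sub>R f x - f (x + z) - f (x - z)) \<le> jump_kernel s z * (C * min 1 ((norm z)\<^sup>2))"
        using \<kappa>[OF False] by (intro mult_mono C) auto
      then show ?thesis using \<kappa>[OF False] by (simp add: abs_mult mult_ac)
    qed simp
    have gint: "integrable lborel ?g"
      by (rule Bochner_Integration.integrable_bound[OF jint])
         (measurable, intro AE_I2, use order_trans[OF le abs_ge_self] in \<open>simp only: real_norm_def\<close>)
    have "\<bar>\<integral>z. ?g z \<partial>lborel\<bar> \<le> (\<integral>z. \<bar>?g z\<bar> \<partial>lborel)" using integral_norm_bound[of lborel ?g] by simp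
    also have "\<dots> \<le> (\<integral>z. ?w z \<partial>lborel)"
      by (rule integral_mono[OF integrable_abs[OF gint] jint le])
    moreover have "\<bar>X /\<^sub>R 2\<bar> \<le> \<bar>X\<bar>" for X :: real by simp
    ultimately show ?thesis by (meson order_trans)
  qed
  then show ?thesis by (intro exI[of _ "\<integral>z. ?w z \<partial>lborel"]) blast
qed

lemma capped_operator_bounded:
  fixes f :: "real ^ 'n \<Rightarrow> real"
  assumes s: "0 < s" "s < 1" and f: "bounded_smooth f"
  obtains B where "\<And>\<delta> x. 0 < \<delta> \<Longrightarrow> \<bar>\<integral>y. capped_kernel s \<delta> (x - y) * (f x - f y) \<partial>lborel\<bar> \<le> B"
    and "\<And>x. \<bar>hypersingular s f x\<bar> \<le> B"
proof -
  have f_meas: "f \<in> borel_measurable borel" using f by (simp add: bounded_smooth_def smooth_borel)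
  obtain M where M: "\<And>x. norm (f x) \<le> M"
    using f unfolding bounded_smooth_def by (metis iter_partial_deriv.simps(1))
  from second_difference_integral_bounded[OF s f] obtain B where "\<forall>\<kappa> x. \<kappa> \<in> borel_measurable borel \<longrightarrow>
    (\<forall>z. z \<noteq> 0 \<longrightarrow> 0 \<le> \<kappa> z \<and> \<kappa> z \<le> jump_kernel s z) \<longrightarrow>
    \<bar>(\<integral>z. \<kappa> z *\<^sub>R (2 *\<^sub>R f x - f (x + z) - f (x - z)) \<partial>lborel) /\<^sub>R 2\<bar> \<le> B" by (rule exE)
  note B = this[rule_format]
  show ?thesis
  proof
    fix \<delta> :: real and x assume \<delta>: "0 < \<delta>"
    have "\<bar>\<integral>y. capped_kernel s \<delta> (x - y) *\<^sub>R (f x - f y) \<partial>lborel\<bar> \<le> B"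
      unfolding symmetrized_integral[OF integrable_capped_kernel(1)[OF s(1) \<delta>] capped_kernel_minus f_meas M]
      using capped_kernel_le_jump_kernel[OF s(1)] by (intro B) auto
    then show "\<bar>\<integral>y. capped_kernel s \<delta> (x - y) * (f x - f y) \<partial>lborel\<bar> \<le> B" by (simp only: real_scaleR_def)
  next
    show "\<bar>hypersingular s f x\<bar> \<le> B" for x unfolding hypersingular_def by (rule B) auto
  qed
qed

lemma infdist_frontier_ge_on_compact:
  fixes \<Omega> :: "'a::euclidean_space set"
  assumes "open \<Omega>" "compact K" "K \<subseteq> \<Omega>" "frontier \<Omega> \<noteq> {}"
  obtains r where "0 < r" "\<And>x. x \<in> K \<Longrightarrow> r \<le> infdist x (frontier \<Omega>)"
proof -
  have "K \<inter> frontier \<Omega> = {}" using assms by (auto simp: frontier_def interior_open)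
  then obtain r where r: "r > 0" "\<And>x y. x \<in> K \<Longrightarrow> y \<in> frontier \<Omega> \<Longrightarrow> r \<le> dist x y"
    using separate_compact_closed[OF assms(2) frontier_closed] by metis
  have "r \<le> infdist x (frontier \<Omega>)" if "x \<in> K" for x
    using infdist_attains_inf[OF frontier_closed assms(4), of x] r(2)[OF that] by metis
  then show ?thesis using that r(1) by blast
qed

text \<open>Data \<open>w\<close> for the linear problem with right-hand side \<open>d\<^sup>-\<^sup>2\<^sup>s w\<close>.\<close>

definition admissible :: "(real ^ 'n) set \<Rightarrow> real \<Rightarrow> (real ^ 'n \<Rightarrow> real) \<Rightarrow> bool" where
  "admissible \<Omega> b w \<longleftrightarrow> w \<in> borel_measurable (restrict_space lborel \<Omega>) \<and> (\<forall>x\<in>\<Omega>. 0 \<le> w x \<and> w x \<le> b)"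

text \<open>The map \<open>w \<mapsto> G w\<close> solves, in the sense of distributions and up to the normalization constant, the Dirichlet problem
with right-hand side \<open>d\<^sup>-\<^sup>2\<^sup>s w\<close>, preserves the order, and maps data between \<open>\<beta>\<close> and \<open>b\<close> to functions between \<open>\<beta> / C\<close>
and \<open>b / c\<close>; these are the properties that monotone iteration uses. The order relations hold almost everywhere,
because \<open>G w\<close> arises as a weak limit.\<close>

definition green_operator :: "real \<Rightarrow> (real ^ 'n) set \<Rightarrow> real \<Rightarrow> real \<Rightarrow> real \<Rightarrow> ((real ^ 'n \<Rightarrow> real) \<Rightarrow> real ^ 'n \<Rightarrow> real) \<Rightarrow> bool" where
  "green_operator s \<Omega> c C b G \<longleftrightarrow>
    (\<forall>w. admissible \<Omega> b w \<longrightarrow>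
       G w \<in> borel_measurable (restrict_space lborel \<Omega>) \<and> (\<forall>x. 0 \<le> G w x \<and> G w x \<le> b / c) \<and>
       (\<forall>\<beta>\<ge>0. (\<forall>x\<in>\<Omega>. \<beta> \<le> w x) \<longrightarrow> (AE x in restrict_space lborel \<Omega>. \<beta> / C \<le> G w x)) \<and>
       (\<forall>w'. admissible \<Omega> b w' \<longrightarrow> (\<forall>x\<in>\<Omega>. w x \<le> w' x) \<longrightarrow> (AE x in restrict_space lborel \<Omega>. G w x \<le> G w' x)) \<and>
       (\<forall>\<psi>. test_function \<Omega> \<psi> \<longrightarrow>
          (\<integral>x. G w x * hypersingular s \<psi> x \<partial>restrict_space lborel \<Omega>)
            = (\<integral>x. infdist x (frontier \<Omega>) powr (-2 * s) * w x * \<psi> x \<partial>restrict_space lborel \<Omega>)))"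

lemma capped_kernel_le:
  assumes "0 < s" "0 < \<delta>"
  shows "capped_kernel s \<delta> (z :: real ^ 'n) \<le> inverse (\<delta> powr (real CARD('n) + 2 * s))"
  unfolding capped_kernel_def using assms by (intro le_imp_inverse_le powr_mono2) auto

lemma killed_jump_operator_capped:
  fixes \<Omega> :: "(real ^ 'n) set"
  assumes \<Omega>: "open \<Omega>" "bounded \<Omega>" "\<Omega> \<noteq> {}" and s: "0 < s" and \<delta>: "0 < \<delta>" "\<delta> \<le> 1" and cC: "0 < c" "0 < C"
    and D: "\<And>x. x \<in> \<Omega> \<Longrightarrow> infdist x (frontier \<Omega>) \<le> D"
    and bounds: "\<And>x. x \<in> \<Omega> \<Longrightarrow>
      c * max (infdist x (frontier \<Omega>)) \<delta> powr (-2 * s) \<le> (\<integral>z. capped_kernel s \<delta> (z :: real ^ 'n) \<partial>lborel) - (\<integral>y. capped_kernel s \<delta> (x - y) \<partial>restrict_space lborel \<Omega>) \<and>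
      (\<integral>z. capped_kernel s \<delta> (z :: real ^ 'n) \<partial>lborel) - (\<integral>y. capped_kernel s \<delta> (x - y) \<partial>restrict_space lborel \<Omega>) \<le> C * max (infdist x (frontier \<Omega>)) \<delta> powr (-2 * s)"
  shows "killed_jump_operator (restrict_space lborel \<Omega>) (\<lambda>x y. capped_kernel s \<delta> (x - y)) (\<integral>z. capped_kernel s \<delta> (z :: real ^ 'n) \<partial>lborel)
     (inverse (\<delta> powr (real CARD('n) + 2 * s))) c C (max D 1 powr (-2 * s)) (\<lambda>x. max (infdist x (frontier \<Omega>)) \<delta> powr (-2 * s))"
proof (rule killed_jump_operator.intro)
  let ?M = "restrict_space lborel \<Omega>"
  have space: "space ?M = \<Omega>" by (simp add: space_restrict_space)
  have id[measurable]: "(\<lambda>x. x) \<in> ?M \<rightarrow>\<^sub>M borel" by (rule measurable_restrict_space1) simp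
  have [measurable]: "fst \<in> ?M \<Otimes>\<^sub>M ?M \<rightarrow>\<^sub>M borel" "snd \<in> ?M \<Otimes>\<^sub>M ?M \<rightarrow>\<^sub>M borel"
    using measurable_compose[OF measurable_fst id] measurable_compose[OF measurable_snd id] by auto
  show "finite_measure ?M" by (rule finite_measure_restrict_lborel[OF \<Omega>(2,1)])
  have "(\<lambda>z. capped_kernel s \<delta> (fst z - snd z)) \<in> borel_measurable (?M \<Otimes>\<^sub>M ?M)" by measurable
  then show "(\<lambda>(x, y). capped_kernel s \<delta> (x - y)) \<in> borel_measurable (?M \<Otimes>\<^sub>M ?M)" by (simp add: case_prod_beta')
  show "capped_kernel s \<delta> (x - y) = capped_kernel s \<delta> (y - x)" for x y :: "real ^ 'n"
    using capped_kernel_minus[of s \<delta> "x - y"] by simp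
  show "capped_kernel s \<delta> (x - y) \<le> inverse (\<delta> powr (real CARD('n) + 2 * s))" for x y :: "real ^ 'n"
    by (rule capped_kernel_le[OF s \<delta>(1)])
  obtain x where x: "x \<in> \<Omega>" using \<Omega>(3) by blast
  have "0 < c * max (infdist x (frontier \<Omega>)) \<delta> powr (-2 * s)" using cC \<delta>(1) by (auto simp: max_def)
  moreover have "0 \<le> (\<integral>y. capped_kernel s \<delta> (x - y) \<partial>?M)" by simp
  ultimately show "0 < (\<integral>z. capped_kernel s \<delta> (z :: real ^ 'n) \<partial>lborel)" using bounds[OF x] by linarith
  have [measurable]: "(\<lambda>x. infdist x (frontier \<Omega>)) \<in> borel_measurable borel"
    by (intro borel_measurable_continuous_onI continuous_intros)
  have "(\<lambda>x. max (infdist x (frontier \<Omega>)) \<delta> powr (-2 * s)) \<in> borel_measurable borel"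
    by measurable
  then show "(\<lambda>x. max (infdist x (frontier \<Omega>)) \<delta> powr (-2 * s)) \<in> borel_measurable ?M"
    by (intro measurable_restrict_space1) simp
  show "max D 1 powr (-2 * s) \<le> max (infdist x (frontier \<Omega>)) \<delta> powr (-2 * s)" if "x \<in> space ?M" for x
    using that D[of x] \<delta> s by (intro powr_mono2') (auto simp: space)
  show "0 < max D 1 powr (-2 * s)" by simp
qed (use bounds cC in \<open>auto simp: space_restrict_space\<close>)

lemma capped_generator_on_test_function:
  fixes \<Omega> :: "(real ^ 'n) set"
  assumes "open \<Omega>" "0 < s" "0 < \<delta>" and \<psi>: "\<psi> \<in> borel_measurable borel" "\<And>x. x \<notin> \<Omega> \<Longrightarrow> \<psi> x = 0" "\<And>x. \<bar>\<psi> x\<bar> \<le> m"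
  shows "(\<integral>z. capped_kernel s \<delta> (z :: real ^ 'n) \<partial>lborel) * \<psi> x - (\<integral>y. capped_kernel s \<delta> (x - y) * \<psi> y \<partial>restrict_space lborel \<Omega>)
     = (\<integral>y. capped_kernel s \<delta> (x - y) * (\<psi> x - \<psi> y) \<partial>lborel)"
proof -
  have int: "integrable lborel (\<lambda>y. capped_kernel s \<delta> (x - y))"
    by (rule killing_decomposition(3)[OF assms(1) integrable_capped_kernel(1)[OF assms(2,3)]])
  have int\<psi>: "integrable lborel (\<lambda>y. capped_kernel s \<delta> (x - y) * \<psi> y)"
    using integrable_bounded_mult[OF int \<psi>(1), of m] \<psi>(3) by simp
  have "(\<lambda>y. indicator \<Omega> y * (capped_kernel s \<delta> (x - y) * \<psi> y)) = (\<lambda>y. capped_kernel s \<delta> (x - y) * \<psi> y)"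
  proof (rule ext)
    fix y show "indicator \<Omega> y * (capped_kernel s \<delta> (x - y) * \<psi> y) = capped_kernel s \<delta> (x - y) * \<psi> y"
      using \<psi>(2)[of y] by (cases "y \<in> \<Omega>") auto
  qed
  then have "(\<integral>y. capped_kernel s \<delta> (x - y) * \<psi> y \<partial>restrict_space lborel \<Omega>) = (\<integral>y. capped_kernel s \<delta> (x - y) * \<psi> y \<partial>lborel)"
    by (simp add: integral_restrict_lborel[OF assms(1)])
  moreover have "(\<integral>z. capped_kernel s \<delta> (z :: real ^ 'n) \<partial>lborel) = (\<integral>y. capped_kernel s \<delta> (x - y) \<partial>lborel)"
    by (simp add: integral_lborel_reflect)
  ultimately show ?thesis
    using int int\<psi> by (simp add: right_diff_distrib)
qed

lemma test_functionD:
  assumes "test_function \<Omega> \<psi>"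
  shows "\<psi> \<in> borel_measurable borel" "\<exists>m. \<forall>x. \<bar>\<psi> x\<bar> \<le> m" "\<And>x. x \<notin> \<Omega> \<Longrightarrow> \<psi> x = 0"
    "\<exists>K. compact K \<and> K \<subseteq> \<Omega> \<and> (\<forall>x. x \<notin> K \<longrightarrow> \<psi> x = 0)"
proof -
  have bs: "bounded_smooth \<psi>" by (rule test_function_bounded_smooth[OF assms])
  then show "\<psi> \<in> borel_measurable borel" by (simp add: bounded_smooth_def smooth_borel)
  have "\<exists>m. \<forall>x. norm (iter_partial_deriv [] \<psi> x) \<le> m" using bs unfolding bounded_smooth_def by (elim conjE allE)
  then show "\<exists>m. \<forall>x. \<bar>\<psi> x\<bar> \<le> m" by simp
  show K: "\<exists>K. compact K \<and> K \<subseteq> \<Omega> \<and> (\<forall>x. x \<notin> K \<longrightarrow> \<psi> x = 0)"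
    using assms closure_subset[of "{x. \<psi> x \<noteq> 0}"] unfolding test_function_def
    by (intro exI[of _ "closure {x. \<psi> x \<noteq> 0}"]) auto
  then show "\<psi> x = 0" if "x \<notin> \<Omega>" for x using that by blast
qed

text \<open>The solutions \<open>T n w\<close> of the problems with kernel capped at \<open>\<delta> n\<close> have bounds independent of \<open>n\<close>, and \<open>G w\<close> is their
weak-star limit along a filter common to all \<open>w\<close>. Order relations and constant lower bounds survive because they can
be tested on measurable sets. The equation survives because \<open>T n w\<close> is paired with the capped operator applied to \<open>\<psi>\<close>,
which converges strongly, so that a product of a weak and a strong limit results.\<close>

lemma green_operator_exists:
  fixes \<Omega> :: "(real ^ 'n) set"
  assumes \<Omega>: "C11_domain \<Omega>" "bounded \<Omega>" and s: "0 < s" "s < 1"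
  obtains c C where "0 < c" "c \<le> C" "\<And>b. 0 \<le> b \<Longrightarrow> \<exists>G. green_operator s \<Omega> c C b G"
proof -
  let ?M = "restrict_space lborel \<Omega>"
  define d where "d x = infdist x (frontier \<Omega>)" for x
  have op: "open \<Omega>" and ne: "\<Omega> \<noteq> {}" using \<Omega> by (auto simp: C11_domain_def)
  have fne: "frontier \<Omega> \<noteq> {}" by (rule frontier_nonempty[OF \<Omega>(2) ne])
  have space: "space ?M = \<Omega>" by (simp add: space_restrict_space)
  have d_pos: "0 < d x" if "x \<in> \<Omega>" for x unfolding d_def by (rule infdist_frontier_pos[OF op that fne])
  have borelM: "h \<in> borel_measurable ?M" if "h \<in> borel_measurable borel" for h :: "real ^ 'n \<Rightarrow> real"
    using that by (intro measurable_restrict_space1) simp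
  have [measurable]: "d \<in> borel_measurable borel"
    unfolding d_def[abs_def] by (intro borel_measurable_continuous_onI continuous_intros)
  have d_meas: "(\<lambda>x. d x powr a) \<in> borel_measurable ?M" for a by (rule borelM) measurable
  interpret finite_measure ?M by (rule finite_measure_restrict_lborel[OF \<Omega>(2) op])
  obtain D where D: "\<And>x. x \<in> \<Omega> \<Longrightarrow> infdist x (frontier \<Omega>) \<le> D" using infdist_frontier_bounded[OF \<Omega>(2) ne] by blast
  obtain c C0 where cC0: "0 < c" "0 < C0" and bounds: "\<And>\<delta> x. 0 < \<delta> \<Longrightarrow> \<delta> \<le> 1 \<Longrightarrow> x \<in> \<Omega> \<Longrightarrow>
      c * max (infdist x (frontier \<Omega>)) \<delta> powr (-2 * s) \<le> (\<integral>z. capped_kernel s \<delta> (z :: real ^ 'n) \<partial>lborel) - (\<integral>y. capped_kernel s \<delta> (x - y) \<partial>?M) \<and>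
      (\<integral>z. capped_kernel s \<delta> (z :: real ^ 'n) \<partial>lborel) - (\<integral>y. capped_kernel s \<delta> (x - y) \<partial>?M) \<le> C0 * max (infdist x (frontier \<Omega>)) \<delta> powr (-2 * s)"
    by (rule killing_bounds[OF \<Omega> s(1)]) (rule that)
  define C where "C = max C0 c"
  have cC: "0 < c" "0 < C" "c \<le> C" using cC0 by (auto simp: C_def)
  define \<delta> where "\<delta> n = inverse (real (Suc n))" for n
  have \<delta>: "0 < \<delta> n" "\<delta> n \<le> 1" for n by (auto simp: \<delta>_def inverse_le_1_iff)
  have \<delta>0: "\<delta> \<longlonglongrightarrow> 0" unfolding \<delta>_def[abs_def] by (rule LIMSEQ_inverse_real_of_nat)
  define g where "g n x = max (d x) (\<delta> n) powr (-2 * s)" for n x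
  define A where "A n = (\<integral>z. capped_kernel s (\<delta> n) (z :: real ^ 'n) \<partial>lborel)" for n
  define J where "J n x y = capped_kernel s (\<delta> n) (x - y :: real ^ 'n)" for n x y
  have kj: "killed_jump_operator ?M (J n) (A n) (inverse (\<delta> n powr (real CARD('n) + 2 * s))) c C (max D 1 powr (-2 * s)) (g n)" for n
    unfolding J_def[abs_def] A_def g_def[abs_def] d_def
  proof (rule killed_jump_operator_capped[OF op \<Omega>(2) ne s(1) \<delta> cC(1,2) D])
    fix x assume x: "x \<in> \<Omega>"
    have "C0 * max (infdist x (frontier \<Omega>)) (\<delta> n) powr (-2 * s) \<le> C * max (infdist x (frontier \<Omega>)) (\<delta> n) powr (-2 * s)"
      by (intro mult_right_mono) (auto simp: C_def)
    then show "c * max (infdist x (frontier \<Omega>)) (\<delta> n) powr (-2 * s) \<le> (\<integral>z. capped_kernel s (\<delta> n) (z :: real ^ 'n) \<partial>lborel) - (\<integral>y. capped_kernel s (\<delta> n) (x - y) \<partial>?M) \<and>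
      (\<integral>z. capped_kernel s (\<delta> n) (z :: real ^ 'n) \<partial>lborel) - (\<integral>y. capped_kernel s (\<delta> n) (x - y) \<partial>?M) \<le> C * max (infdist x (frontier \<Omega>)) (\<delta> n) powr (-2 * s)"
      using bounds[OF \<delta> x, of n] by linarith
  qed
  have "\<exists>G. green_operator s \<Omega> c C b G" if b: "0 \<le> b" for b
  proof -
    define T where "T n w = killed_jump_operator.solution ?M (J n) (A n) (g n) w" for n w
    have adm: "w \<in> borel_measurable ?M" "\<And>x. x \<in> space ?M \<Longrightarrow> 0 \<le> w x" "\<And>x. x \<in> space ?M \<Longrightarrow> w x \<le> b"
      if "admissible \<Omega> b w" for w using that by (auto simp: admissible_def space)
    have T_meas: "T n w \<in> borel_measurable ?M" if "admissible \<Omega> b w" for n w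
      unfolding T_def by (rule killed_jump_operator.solution_measurable[OF kj adm[OF that] b])
    have T_nonneg: "0 \<le> T n w x" if "admissible \<Omega> b w" for n w x
      unfolding T_def by (rule killed_jump_operator.solution_nonneg[OF kj adm[OF that] b])
    have T_le: "T n w x \<le> b / c" if "admissible \<Omega> b w" "x \<in> space ?M" for n w x
      unfolding T_def by (rule killed_jump_operator.solution_le[OF kj adm[OF that(1)] b that(2)])
    \<comment> \<open>Inadmissible \<open>w\<close> get the zero function, so that the index set can be the whole type.\<close>
    define f where "f n w = (if admissible \<Omega> b w then T n w else (\<lambda>_. 0))" for n w
    obtain F G where F: "F \<noteq> bot" "F \<le> sequentially" and G_meas: "\<And>w. G w \<in> borel_measurable ?M"
      and G_nonneg: "\<And>w x. 0 \<le> G w x" and G_le: "\<And>w x. G w x \<le> b / c"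
      and lim: "\<And>w \<phi>. integrable ?M \<phi> \<Longrightarrow> ((\<lambda>n. \<integral>x. f n w x * \<phi> x \<partial>?M) \<longlongrightarrow> (\<integral>x. G w x * \<phi> x \<partial>?M)) F"
    proof (rule weak_star_limit[of ?M f "\<lambda>_. b / c"])
      show "finite_measure ?M" by unfold_locales
      show "f n w \<in> borel_measurable ?M" for n w by (simp add: f_def T_meas)
      show "0 \<le> f n w x" for n w x by (simp add: f_def T_nonneg)
      show "f n w x \<le> b / c" if "x \<in> space ?M" for n w x using that b cC by (simp add: f_def T_le)
      show "0 \<le> b / c" using b cC by simp
    qed (rule that)
    have limT: "((\<lambda>n. \<integral>x. T n w x * \<phi> x \<partial>?M) \<longlongrightarrow> (\<integral>x. G w x * \<phi> x \<partial>?M)) F"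
      if "integrable ?M \<phi>" "admissible \<Omega> b w" for w \<phi>
      using lim[OF that(1), of w] that(2) by (simp add: f_def)
    have absT: "\<bar>T n w x\<bar> \<le> b / c" if "admissible \<Omega> b w" "x \<in> space ?M" for n w x
      using T_nonneg[OF that(1), of n x] T_le[OF that, of n] by simp
    have absG: "\<bar>G w x\<bar> \<le> b / c" for w x using G_nonneg[of w x] G_le[of w x] by simp
    have ind: "integrable ?M (\<lambda>x. indicator B x :: real)" if "B \<in> sets ?M" for B
      using that by (simp add: integrable_real_indicator less_top[symmetric])
    have G_int: "integrable ?M (G w)" for w
      using absG by (intro integrable_const_bound[where B = "b / c"] G_meas AE_I2) auto
    have lower: "AE x in ?M. \<beta> / C \<le> G w x" if w: "admissible \<Omega> b w" and \<beta>: "0 \<le> \<beta>" "\<forall>x\<in>\<Omega>. \<beta> \<le> w x" for w \<beta>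
    proof (rule AE_le_of_set_integrals_le[OF _ G_int])
      show "integrable ?M (\<lambda>_. \<beta> / C)" by simp
      fix B assume B: "B \<in> sets ?M"
      have "(\<integral>x. \<beta> / C * indicator B x \<partial>?M) \<le> (\<integral>x. T n w x * indicator B x \<partial>?M)" for n
      proof (rule integral_mono)
        show "integrable ?M (\<lambda>x. \<beta> / C * indicator B x)" by (intro integrable_mult_right ind B)
        show "integrable ?M (\<lambda>x. T n w x * indicator B x)"
          by (rule finite_measure_integrable_bounded(1)[OF ind[OF B] T_meas[OF w] absT[OF w]])
        fix x assume x: "x \<in> space ?M"
        have "\<beta> / C \<le> T n w x" unfolding T_def
          by (rule killed_jump_operator.solution_ge[OF kj adm[OF w] b x \<beta>(1)]) (use \<beta>(2) space in auto)
        then show "\<beta> / C * indicator B x \<le> T n w x * indicator B x" by (intro mult_right_mono) auto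
      qed
      then show "(\<integral>x. \<beta> / C * indicator B x \<partial>?M) \<le> (\<integral>x. G w x * indicator B x \<partial>?M)"
        by (intro tendsto_lowerbound[OF limT[OF ind[OF B] w] _ F(1)] always_eventually allI)
    qed
    have mono: "AE x in ?M. G w x \<le> G w' x"
      if w: "admissible \<Omega> b w" "admissible \<Omega> b w'" and le: "\<forall>x\<in>\<Omega>. w x \<le> w' x" for w w'
    proof (rule AE_le_of_set_integrals_le[OF G_int G_int])
      fix B assume B: "B \<in> sets ?M"
      have "(\<integral>x. T n w x * indicator B x \<partial>?M) \<le> (\<integral>x. T n w' x * indicator B x \<partial>?M)" for n
      proof (rule integral_mono)
        show "integrable ?M (\<lambda>x. T n w x * indicator B x)"
          by (rule finite_measure_integrable_bounded(1)[OF ind[OF B] T_meas[OF w(1)] absT[OF w(1)]])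
        show "integrable ?M (\<lambda>x. T n w' x * indicator B x)"
          by (rule finite_measure_integrable_bounded(1)[OF ind[OF B] T_meas[OF w(2)] absT[OF w(2)]])
        fix x assume x: "x \<in> space ?M"
        have "T n w x \<le> T n w' x" unfolding T_def
          using le space by (intro killed_jump_operator.solution_mono[OF kj adm(1)[OF w(1)] adm(1)[OF w(2)] adm(2)[OF w(1)] _ adm(3)[OF w(2)] b x]) auto
        then show "T n w x * indicator B x \<le> T n w' x * indicator B x" by (intro mult_right_mono) auto
      qed
      then show "(\<integral>x. G w x * indicator B x \<partial>?M) \<le> (\<integral>x. G w' x * indicator B x \<partial>?M)"
        by (intro tendsto_le[OF F(1) limT[OF ind[OF B] w(2)] limT[OF ind[OF B] w(1)]] always_eventually allI)
    qed
    have weak: "(\<integral>x. G w x * hypersingular s \<psi> x \<partial>?M) = (\<integral>x. d x powr (-2 * s) * w x * \<psi> x \<partial>?M)"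
      if w: "admissible \<Omega> b w" and \<psi>: "test_function \<Omega> \<psi>" for w \<psi>
    proof -
      note bs = test_function_bounded_smooth[OF \<psi>]
      note \<psi>_meas[measurable] = test_functionD(1)[OF \<psi>]
      obtain m where m: "\<And>x. \<bar>\<psi> x\<bar> \<le> m" using test_functionD(2)[OF \<psi>] by blast
      obtain K where K: "compact K" "K \<subseteq> \<Omega>" "\<And>x. x \<notin> K \<Longrightarrow> \<psi> x = 0" using test_functionD(4)[OF \<psi>] by blast
      obtain r where r: "0 < r" "\<And>x. x \<in> K \<Longrightarrow> r \<le> d x"
        using infdist_frontier_ge_on_compact[OF op K(1,2) fne] unfolding d_def by blast
      define L where "L n x = (\<integral>y. capped_kernel s (\<delta> n) (x - y) * (\<psi> x - \<psi> y) \<partial>lborel)" for n x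
      obtain B where B: "\<And>n x. \<bar>L n x\<bar> \<le> B" and H_bound: "\<And>x. \<bar>hypersingular s \<psi> x\<bar> \<le> B"
        using capped_operator_bounded[OF s bs] \<delta>(1) unfolding L_def by metis
      have L_meas: "L n \<in> borel_measurable borel" for n unfolding L_def[abs_def] by measurable
      have H_meas: "hypersingular s \<psi> \<in> borel_measurable borel" by (rule hypersingular_measurable[OF \<psi>_meas])
      have L_lim: "(\<lambda>n. L n x) \<longlonglongrightarrow> hypersingular s \<psi> x" for x
      proof -
        have "(\<lambda>n. \<integral>y. capped_kernel s (\<delta> n) (x - y) *\<^sub>R (\<psi> x - \<psi> y) \<partial>lborel) \<longlonglongrightarrow> hypersingular s \<psi> x"
        proof (rule kernel_approximation_tendsto_hypersingular[OF s bs])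
          show "integrable lborel (capped_kernel s (\<delta> n) :: real ^ 'n \<Rightarrow> real)" for n
            by (rule integrable_capped_kernel(1)[OF s(1) \<delta>(1)])
          show "capped_kernel s (\<delta> n) (- z :: real ^ 'n) = capped_kernel s (\<delta> n) z" for n z by simp
          show "0 \<le> capped_kernel s (\<delta> n) z \<and> capped_kernel s (\<delta> n) z \<le> jump_kernel s z" if "z \<noteq> 0" for n and z :: "real ^ 'n"
            using capped_kernel_le_jump_kernel[OF s(1) that] by simp
          fix z :: "real ^ 'n" assume "z \<noteq> 0"
          then have "\<forall>\<^sub>F n in sequentially. \<delta> n < norm z" using \<delta>0 by (intro order_tendstoD) auto
          then have "\<forall>\<^sub>F n in sequentially. capped_kernel s (\<delta> n) z = jump_kernel s z"
            by eventually_elim (simp add: capped_kernel_eq_jump_kernel)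
          then show "(\<lambda>n. capped_kernel s (\<delta> n) z) \<longlonglongrightarrow> jump_kernel s z" by (rule tendsto_eventually)
        qed
        then show ?thesis by (simp add: L_def)
      qed
      have L_int: "integrable ?M (L n)" for n
        using B by (intro integrable_const_bound[where B = B] borelM L_meas AE_I2) auto
      have H_int: "integrable ?M (hypersingular s \<psi>)"
        using H_bound by (intro integrable_const_bound[where B = B] borelM H_meas AE_I2) auto
      have diff_int: "integrable ?M (\<lambda>x. L n x - hypersingular s \<psi> x)" for n
        by (rule Bochner_Integration.integrable_diff[OF L_int H_int])
      have "(\<lambda>n. \<integral>x. \<bar>L n x - hypersingular s \<psi> x\<bar> \<partial>?M) \<longlonglongrightarrow> (\<integral>x. 0 \<partial>?M)"
      proof (rule integral_dominated_convergence[where w = "\<lambda>_. 2 * B"])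
        show "AE x in ?M. (\<lambda>n. \<bar>L n x - hypersingular s \<psi> x\<bar>) \<longlonglongrightarrow> 0"
        proof (rule AE_I2)
          fix x
          have "(\<lambda>n. \<bar>L n x - hypersingular s \<psi> x\<bar>) \<longlonglongrightarrow> \<bar>hypersingular s \<psi> x - hypersingular s \<psi> x\<bar>"
            by (intro tendsto_intros L_lim)
          then show "(\<lambda>n. \<bar>L n x - hypersingular s \<psi> x\<bar>) \<longlonglongrightarrow> 0" by simp
        qed
        show "AE x in ?M. norm \<bar>L n x - hypersingular s \<psi> x\<bar> \<le> 2 * B" for n
        proof (rule AE_I2)
          fix x show "norm \<bar>L n x - hypersingular s \<psi> x\<bar> \<le> 2 * B"
            using B[of n x] H_bound[of x] unfolding real_norm_def by linarith
        qed
        show "(\<lambda>x. \<bar>L n x - hypersingular s \<psi> x\<bar>) \<in> borel_measurable ?M" for n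
          using diff_int[of n] by (intro borel_measurable_abs borel_measurable_integrable)
      qed auto
      then have "(\<lambda>n. b / c * (\<integral>x. \<bar>L n x - hypersingular s \<psi> x\<bar> \<partial>?M)) \<longlonglongrightarrow> 0"
        using tendsto_mult_left[of _ 0 _ "b / c"] by fastforce
      \<comment> \<open>The solutions are uniformly bounded, so convergence of the capped operator in the mean suffices.\<close>
      then have small: "(\<lambda>n. \<integral>x. T n w x * (L n x - hypersingular s \<psi> x) \<partial>?M) \<longlonglongrightarrow> 0"
        by (rule Lim_null_comparison[rotated])
           (use finite_measure_integrable_bounded(2)[OF diff_int T_meas[OF w] absT[OF w]] in \<open>auto intro!: always_eventually\<close>)
      have source: "(\<lambda>n. \<integral>x. g n x * w x * \<psi> x \<partial>?M) \<longlonglongrightarrow> (\<integral>x. d x powr (-2 * s) * w x * \<psi> x \<partial>?M)"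
      proof (rule integral_dominated_convergence[where w = "\<lambda>_. r powr (-2 * s) * b * m"])
        note [measurable] = adm(1)[OF w] borelM[OF \<psi>_meas] d_meas killed_jump_operator.g[OF kj]
        show "(\<lambda>x. d x powr (-2 * s) * w x * \<psi> x) \<in> borel_measurable ?M" by measurable
        show "(\<lambda>x. g n x * w x * \<psi> x) \<in> borel_measurable ?M" for n by measurable
        show "AE x in ?M. (\<lambda>n. g n x * w x * \<psi> x) \<longlonglongrightarrow> d x powr (-2 * s) * w x * \<psi> x"
        proof (intro AE_I2 tendsto_mult tendsto_const)
          fix x assume "x \<in> space ?M"
          then have "0 < d x" using d_pos space by simp
          then have "\<forall>\<^sub>F n in sequentially. \<delta> n < d x" using \<delta>0 by (intro order_tendstoD) auto
          then have "\<forall>\<^sub>F n in sequentially. g n x = d x powr (-2 * s)"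
            by eventually_elim (simp add: g_def max_def)
          then show "(\<lambda>n. g n x) \<longlonglongrightarrow> d x powr (-2 * s)" by (rule tendsto_eventually)
        qed
        show "AE x in ?M. norm (g n x * w x * \<psi> x) \<le> r powr (-2 * s) * b * m" for n
        proof (rule AE_I2)
          fix x assume x: "x \<in> space ?M"
          have m0: "0 \<le> m" using m[of x] by linarith
          show "norm (g n x * w x * \<psi> x) \<le> r powr (-2 * s) * b * m"
          proof (cases "x \<in> K")
            case True
            have "g n x \<le> r powr (-2 * s)" unfolding g_def
              using r(1) r(2)[OF True] s by (intro powr_mono2') auto
            moreover have "0 \<le> g n x" by (simp add: g_def)
            ultimately show ?thesis unfolding real_norm_def abs_mult
              using adm(2,3)[OF w x] m[of x] b by (intro mult_mono) auto
          qed (use K(3)[of x] b m0 in simp)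
        qed
      qed simp
      have identity: "(\<integral>x. T n w x * L n x \<partial>?M) = (\<integral>x. g n x * w x * \<psi> x \<partial>?M)" for n
      proof -
        have "(\<integral>x. T n w x * L n x \<partial>?M) = (\<integral>x. T n w x * (A n * \<psi> x - (\<integral>y. J n x y * \<psi> y \<partial>?M)) \<partial>?M)"
        proof (intro Bochner_Integration.integral_cong refl)
          fix x
          have "A n * \<psi> x - (\<integral>y. J n x y * \<psi> y \<partial>?M) = L n x"
            unfolding L_def A_def J_def
            by (rule capped_generator_on_test_function[OF op s(1) \<delta>(1) \<psi>_meas test_functionD(3)[OF \<psi>] m])
          then show "T n w x * L n x = T n w x * (A n * \<psi> x - (\<integral>y. J n x y * \<psi> y \<partial>?M))" by simp
        qed
        also have "\<dots> = (\<integral>x. g n x * w x * \<psi> x \<partial>?M)" unfolding T_def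
          by (rule killed_jump_operator.solution_weak_form[OF kj adm[OF w] b borelM[OF \<psi>_meas] m])
        finally show ?thesis .
      qed
      \<comment> \<open>The limit operator is exchanged for the capped one, for which the equation is exact.\<close>
      have split: "(\<integral>x. T n w x * hypersingular s \<psi> x \<partial>?M) = (\<integral>x. g n x * w x * \<psi> x \<partial>?M) - (\<integral>x. T n w x * (L n x - hypersingular s \<psi> x) \<partial>?M)" for n
      proof -
        have "(\<integral>x. T n w x * L n x - T n w x * (L n x - hypersingular s \<psi> x) \<partial>?M)
          = (\<integral>x. T n w x * L n x \<partial>?M) - (\<integral>x. T n w x * (L n x - hypersingular s \<psi> x) \<partial>?M)"
          by (intro Bochner_Integration.integral_diff finite_measure_integrable_bounded(1)[OF _ T_meas[OF w] absT[OF w]] L_int diff_int)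
        then show ?thesis by (simp add: identity right_diff_distrib)
      qed
      have "(\<lambda>n. \<integral>x. T n w x * hypersingular s \<psi> x \<partial>?M) \<longlonglongrightarrow> (\<integral>x. d x powr (-2 * s) * w x * \<psi> x \<partial>?M) - 0"
        unfolding split by (intro tendsto_diff source small)
      then have "((\<lambda>n. \<integral>x. T n w x * hypersingular s \<psi> x \<partial>?M) \<longlongrightarrow> (\<integral>x. d x powr (-2 * s) * w x * \<psi> x \<partial>?M)) F"
        using F(2) by (simp add: tendsto_mono)
      then show ?thesis by (rule tendsto_unique[OF F(1) limT[OF H_int w]])
    qed
    have "green_operator s \<Omega> c C b G"
      unfolding green_operator_def
      using G_meas G_nonneg G_le lower mono weak[unfolded d_def] by blast
    then show ?thesis by blast
  qed
  then show ?thesis using that cC by blast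
qed

section \<open>Monotone iteration\<close>

text \<open>With \<open>m = k powr (- 1 / (1 - q))\<close> the constant \<open>m\<close> satisfies \<open>m\<^sup>q = k m\<close>; the constant super- and subsolutions are of this
form.\<close>

lemma sublinear_fixed_point:
  fixes k q :: real
  assumes "0 < k" "q < 1"
  shows "(k powr (- (1 / (1 - q)))) powr q = k * k powr (- (1 / (1 - q)))"
proof -
  have "1 + - (1 / (1 - q)) = - (1 / (1 - q)) * q" using assms(2) by (simp add: field_simps)
  moreover have "k * k powr (- (1 / (1 - q))) = k powr (1 + - (1 / (1 - q)))"
    using assms(1) by (simp only: powr_add) simp
  ultimately show ?thesis by (simp only: powr_powr)
qed

text \<open>Monotone iteration starting from the constant supersolution \<open>m\<^sub>1\<close>. Hypothesis \<open>super\<close> gives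
\<open>G (m\<^sub>1\<^sup>q) / a \<le> m\<^sub>1\<close>, and \<open>sub\<close> keeps all iterates above \<open>m\<^sub>0\<close>. The iterates decrease pointwise, so the nonlinear term
passes to the limit by dominated convergence, which weak convergence would not allow.\<close>

lemma green_iteration:
  fixes \<Omega> :: "(real ^ 'n) set"
  assumes \<Omega>: "open \<Omega>" "bounded \<Omega>" "frontier \<Omega> \<noteq> {}"
    and G: "green_operator s \<Omega> c C (m\<^sub>1 powr q) G"
    and a: "0 < a" and C: "0 < C" and q: "0 < q" and m: "0 < m\<^sub>0" "m\<^sub>0 \<le> m\<^sub>1"
    and sub: "m\<^sub>0 powr q = a * C * m\<^sub>0" and super: "m\<^sub>1 powr q = a * c * m\<^sub>1" and c: "0 < c"
    and s: "0 < s" "s < 1"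
  shows "\<exists>u. u \<in> borel_measurable (restrict_space lborel \<Omega>) \<and> (\<forall>x. m\<^sub>0 \<le> u x \<and> u x \<le> m\<^sub>1) \<and>
    (\<forall>\<psi>. test_function \<Omega> \<psi> \<longrightarrow> a * (\<integral>x. u x * hypersingular s \<psi> x \<partial>restrict_space lborel \<Omega>)
       = (\<integral>x. infdist x (frontier \<Omega>) powr (-2 * s) * u x powr q * \<psi> x \<partial>restrict_space lborel \<Omega>))"
proof -
  let ?M = "restrict_space lborel \<Omega>"
  define d where "d x = infdist x (frontier \<Omega>)" for x
  have space: "space ?M = \<Omega>" by (simp add: space_restrict_space)
  interpret finite_measure ?M by (rule finite_measure_restrict_lborel[OF \<Omega>(2,1)])
  have borelM: "h \<in> borel_measurable ?M" if "h \<in> borel_measurable borel" for h :: "real ^ 'n \<Rightarrow> real"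
    using that by (intro measurable_restrict_space1) simp
  \<comment> \<open>The clipping makes monotonicity and bounds hold everywhere; the fact \<open>eq\<close> below shows that it changes \<open>G w / a\<close> on null sets only.\<close>
  define step where "step v x = max m\<^sub>0 (min (v x) (G (\<lambda>x. v x powr q) x / a))" for v x
  define u where "u k = (step ^^ k) (\<lambda>_. m\<^sub>1)" for k
  have u0: "u 0 = (\<lambda>_. m\<^sub>1)" and uS: "u (Suc k) = step (u k)" for k by (simp_all add: u_def)
  have u_ge: "m\<^sub>0 \<le> u k x" for k x by (cases k) (simp_all add: u0 uS step_def m)
  have u_dec: "u (Suc k) x \<le> u k x" for k x using u_ge[of k x] by (simp add: uS step_def)
  have u_le: "u k x \<le> m\<^sub>1" for k x
  proof (induction k)
    case (Suc k)
    then show ?case using u_dec[of k x] by simp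
  qed (simp add: u0)
  have adm_iff: "admissible \<Omega> (m\<^sub>1 powr q) (\<lambda>x. u k x powr q)" if [measurable]: "u k \<in> borel_measurable ?M" for k
  proof -
    have "u k x powr q \<le> m\<^sub>1 powr q" for x
      using u_ge[of k x] u_le[of k x] m q by (intro powr_mono2) auto
    then show ?thesis by (simp add: admissible_def)
  qed
  have u_meas: "u k \<in> borel_measurable ?M" for k
  proof (induction k)
    case (Suc k)
    note [measurable] = Suc
    have [measurable]: "G (\<lambda>x. u k x powr q) \<in> borel_measurable ?M"
      using G adm_iff[OF Suc] by (simp add: green_operator_def)
    show ?case unfolding uS step_def[abs_def] by measurable
  qed (simp add: u0)
  note adm = adm_iff[OF u_meas]
  define w where "w k x = u k x powr q" for k x
  have w_adm: "admissible \<Omega> (m\<^sub>1 powr q) (w k)" for k using adm[of k] by (simp add: w_def[abs_def])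
  note Gw = G[unfolded green_operator_def, THEN spec, THEN mp, OF w_adm]
  note Gw_meas = Gw[THEN conjunct1]
  note Gw_bounds = Gw[THEN conjunct2, THEN conjunct1, THEN spec, THEN conjunct2]
  note Gw_lower = Gw[THEN conjunct2, THEN conjunct2, THEN conjunct1, rule_format]
  note Gw_mono = Gw[THEN conjunct2, THEN conjunct2, THEN conjunct2, THEN conjunct1, rule_format]
  note Gw_weak = Gw[THEN conjunct2, THEN conjunct2, THEN conjunct2, THEN conjunct2, rule_format]
  have uSw: "u (Suc k) x = max m\<^sub>0 (min (u k x) (G (w k) x / a))" for k x
    by (simp add: uS step_def w_def[abs_def])
  have lower: "AE x in ?M. m\<^sub>0 \<le> G (w k) x / a" for k
  proof -
    have "m\<^sub>0 powr q \<le> w k x" for x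
      unfolding w_def using u_ge[of k x] m q by (intro powr_mono2) auto
    then have "AE x in ?M. m\<^sub>0 powr q / C \<le> G (w k) x" by (intro Gw_lower) auto
    then show ?thesis
    proof eventually_elim
      case (elim x)
      then show ?case using a C by (simp add: sub field_simps)
    qed
  qed
  have eq: "AE x in ?M. u (Suc k) x = G (w k) x / a" for k
  proof (induction k)
    case 0
    have le: "G (w 0) x / a \<le> u 0 x" for x
    proof -
      have "G (w 0) x \<le> m\<^sub>1 powr q / c" by (rule Gw_bounds)
      then show ?thesis using a c by (simp add: super u0 field_simps)
    qed
    from lower[of 0] show ?case
    proof eventually_elim
      case (elim x)
      then show ?case using le[of x] by (subst uSw) (simp add: max_def min_def)
    qed
  next
    case (Suc k)
    have "w (Suc k) x \<le> w k x" for x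
      unfolding w_def using u_dec[of k x] u_ge[of "Suc k" x] m q by (intro powr_mono2) auto
    then have "AE x in ?M. G (w (Suc k)) x \<le> G (w k) x" by (intro Gw_mono w_adm)
    with Suc lower[of "Suc k"] show ?case
    proof eventually_elim
      case (elim x)
      have "G (w (Suc k)) x / a \<le> u (Suc k) x" using elim(1,3) a by (simp add: divide_right_mono)
      then show ?case using elim(2) by (subst uSw) (simp add: max_def min_def)
    qed
  qed
  define v where "v x = lim (\<lambda>k. u k x)" for x
  have v_lim: "(\<lambda>k. u k x) \<longlonglongrightarrow> v x" for x
  proof -
    have dec: "decseq (\<lambda>k. u k x)" using u_dec by (intro decseq_SucI)
    obtain l where "(\<lambda>k. u k x) \<longlonglongrightarrow> l" by (rule decseq_convergent[OF dec allI[OF u_ge]]) (rule that)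
    then show ?thesis unfolding v_def by (simp add: limI)
  qed
  have v_ge: "m\<^sub>0 \<le> v x" for x using u_ge by (intro tendsto_lowerbound[OF v_lim] always_eventually) auto
  have v_le: "v x \<le> m\<^sub>1" for x using u_le by (intro tendsto_upperbound[OF v_lim] always_eventually) auto
  have v_meas: "v \<in> borel_measurable ?M" by (rule borel_measurable_LIMSEQ_real[OF v_lim u_meas])
  have "a * (\<integral>x. v x * hypersingular s \<psi> x \<partial>?M) = (\<integral>x. d x powr (-2 * s) * v x powr q * \<psi> x \<partial>?M)"
    if \<psi>: "test_function \<Omega> \<psi>" for \<psi>
  proof -
    note \<psi>_meas[measurable] = test_functionD(1)[OF \<psi>]
    obtain M where M: "\<And>x. \<bar>\<psi> x\<bar> \<le> M" using test_functionD(2)[OF \<psi>] by blast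
    obtain K where K: "compact K" "K \<subseteq> \<Omega>" "\<And>x. x \<notin> K \<Longrightarrow> \<psi> x = 0" using test_functionD(4)[OF \<psi>] by blast
    obtain r where r: "0 < r" "\<And>x. x \<in> K \<Longrightarrow> r \<le> d x"
      using infdist_frontier_ge_on_compact[OF \<Omega>(1) K(1,2) \<Omega>(3)] unfolding d_def by blast
    have H_meas: "hypersingular s \<psi> \<in> borel_measurable borel" by (rule hypersingular_measurable[OF \<psi>_meas])
    obtain B where B: "\<And>x. \<bar>hypersingular s \<psi> x\<bar> \<le> B"
      using capped_operator_bounded[OF s test_function_bounded_smooth[OF \<psi>]] by metis
    have H_int: "integrable ?M (hypersingular s \<psi>)"
      using B by (intro integrable_const_bound[where B = B] borelM H_meas AE_I2) auto
    have step_eq: "a * (\<integral>x. u (Suc k) x * hypersingular s \<psi> x \<partial>?M) = (\<integral>x. d x powr (-2 * s) * w k x * \<psi> x \<partial>?M)" for k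
    proof -
      note [measurable] = u_meas[of "Suc k"] borelM[OF H_meas]
      have [measurable]: "G (w k) \<in> borel_measurable ?M" by (rule Gw_meas)
      have "a * (\<integral>x. u (Suc k) x * hypersingular s \<psi> x \<partial>?M) = (\<integral>x. a * (u (Suc k) x * hypersingular s \<psi> x) \<partial>?M)" by simp
      also have "\<dots> = (\<integral>x. G (w k) x * hypersingular s \<psi> x \<partial>?M)"
      proof (rule integral_cong_AE)
        show "AE x in ?M. a * (u (Suc k) x * hypersingular s \<psi> x) = G (w k) x * hypersingular s \<psi> x"
          using eq[of k] by eventually_elim (use a in simp)
      qed measurable
      also have "\<dots> = (\<integral>x. d x powr (-2 * s) * w k x * \<psi> x \<partial>?M)" unfolding d_def by (rule Gw_weak[OF \<psi>])
      finally show ?thesis .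
    qed
    have "(\<lambda>k. \<integral>x. u (Suc k) x * hypersingular s \<psi> x \<partial>?M) \<longlonglongrightarrow> (\<integral>x. v x * hypersingular s \<psi> x \<partial>?M)"
    proof (rule integral_dominated_convergence[where w = "\<lambda>x. m\<^sub>1 * \<bar>hypersingular s \<psi> x\<bar>"])
      note [measurable] = u_meas v_meas borelM[OF H_meas]
      show "(\<lambda>x. v x * hypersingular s \<psi> x) \<in> borel_measurable ?M" by measurable
      show "(\<lambda>x. u (Suc k) x * hypersingular s \<psi> x) \<in> borel_measurable ?M" for k by measurable
      show "integrable ?M (\<lambda>x. m\<^sub>1 * \<bar>hypersingular s \<psi> x\<bar>)" by (intro integrable_mult_right integrable_abs H_int)
      show "AE x in ?M. (\<lambda>k. u (Suc k) x * hypersingular s \<psi> x) \<longlonglongrightarrow> v x * hypersingular s \<psi> x"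
        by (intro AE_I2 tendsto_mult tendsto_const LIMSEQ_Suc v_lim)
      show "AE x in ?M. norm (u (Suc k) x * hypersingular s \<psi> x) \<le> m\<^sub>1 * \<bar>hypersingular s \<psi> x\<bar>" for k
      proof (rule AE_I2)
        fix x
        have "\<bar>u (Suc k) x\<bar> \<le> m\<^sub>1" using u_ge[of "Suc k" x] u_le[of "Suc k" x] m by linarith
        then show "norm (u (Suc k) x * hypersingular s \<psi> x) \<le> m\<^sub>1 * \<bar>hypersingular s \<psi> x\<bar>"
          by (simp add: abs_mult mult_right_mono)
      qed
    qed
    then have lhs: "(\<lambda>k. a * (\<integral>x. u (Suc k) x * hypersingular s \<psi> x \<partial>?M)) \<longlonglongrightarrow> a * (\<integral>x. v x * hypersingular s \<psi> x \<partial>?M)"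
      by (intro tendsto_mult tendsto_const)
    have rhs: "(\<lambda>k. \<integral>x. d x powr (-2 * s) * w k x * \<psi> x \<partial>?M) \<longlonglongrightarrow> (\<integral>x. d x powr (-2 * s) * v x powr q * \<psi> x \<partial>?M)"
    proof (rule integral_dominated_convergence[where w = "\<lambda>_. r powr (-2 * s) * m\<^sub>1 powr q * M"])
      have [measurable]: "d \<in> borel_measurable borel"
        unfolding d_def[abs_def] by (intro borel_measurable_continuous_onI continuous_intros)
      note [measurable] = u_meas v_meas borelM[OF \<psi>_meas] borelM[OF \<open>d \<in> borel_measurable borel\<close>]
      show "(\<lambda>x. d x powr (-2 * s) * v x powr q * \<psi> x) \<in> borel_measurable ?M" by measurable
      show "(\<lambda>x. d x powr (-2 * s) * w k x * \<psi> x) \<in> borel_measurable ?M" for k unfolding w_def by measurable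
      show "AE x in ?M. (\<lambda>k. d x powr (-2 * s) * w k x * \<psi> x) \<longlonglongrightarrow> d x powr (-2 * s) * v x powr q * \<psi> x"
      proof (intro AE_I2 tendsto_mult tendsto_const)
        fix x
        have "v x \<noteq> 0" using v_ge[of x] m by linarith
        then show "(\<lambda>k. w k x) \<longlonglongrightarrow> v x powr q" unfolding w_def by (intro tendsto_powr v_lim tendsto_const)
      qed
      show "AE x in ?M. norm (d x powr (-2 * s) * w k x * \<psi> x) \<le> r powr (-2 * s) * m\<^sub>1 powr q * M" for k
      proof (rule AE_I2)
        fix x
        have M0: "0 \<le> M" using M[of x] by linarith
        show "norm (d x powr (-2 * s) * w k x * \<psi> x) \<le> r powr (-2 * s) * m\<^sub>1 powr q * M"
        proof (cases "x \<in> K")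
          case True
          have "d x powr (-2 * s) \<le> r powr (-2 * s)" using r(1) r(2)[OF True] s by (intro powr_mono2') auto
          moreover have "w k x \<le> m\<^sub>1 powr q" unfolding w_def using u_ge[of k x] u_le[of k x] m q by (intro powr_mono2) auto
          ultimately show ?thesis unfolding real_norm_def abs_mult
            using M[of x] by (intro mult_mono) (auto simp: w_def)
        qed (use K(3)[of x] M0 in simp)
      qed
    qed simp
    show ?thesis using LIMSEQ_unique[OF lhs] rhs unfolding step_eq by blast
  qed
  then show ?thesis using v_meas v_ge v_le unfolding d_def by (intro exI[of _ v]) blast
qed

theorem theorem1p1:
  fixes s q :: real and \<Omega> :: "(real ^ 'n) set"
  defines "d \<equiv> (\<lambda>x. infdist x (frontier \<Omega>))"
  assumes "0 < s" "s < 1" "real CARD('n) > 2 * s"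
    and "C11_domain \<Omega>" "bounded \<Omega>"
    and "0 < q" "q < 1"
  shows "\<exists>u :: real ^ 'n \<Rightarrow> real.
      distributional_solution s \<Omega> (\<lambda>x. u x powr q / d x powr (2 * s)) u \<and>
      (AE x\<in>\<Omega> in lborel. u x > 0) \<and>
      (\<exists>C>0. AE x\<in>\<Omega> in lborel. u x \<ge> C * d x powr s)"
proof -
  let ?M = "restrict_space lborel \<Omega>"
  note s = \<open>0 < s\<close> \<open>s < 1\<close>
  have op: "open \<Omega>" and ne: "\<Omega> \<noteq> {}" using \<open>C11_domain \<Omega>\<close> by (auto simp: C11_domain_def)
  note [measurable] = borel_open[OF op]
  have fne: "frontier \<Omega> \<noteq> {}" by (rule frontier_nonempty[OF \<open>bounded \<Omega>\<close> ne])
  have [measurable]: "d \<in> borel_measurable borel"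
    unfolding d_def by (intro borel_measurable_continuous_onI continuous_intros)
  define a where "a = frac_laplacian_const TYPE('n) s"
  have a: "0 < a" unfolding a_def by (rule frac_laplacian_const_pos[OF s])
  obtain c C where cC: "0 < c" "c \<le> C" and green: "\<And>b. 0 \<le> b \<Longrightarrow> \<exists>G. green_operator s \<Omega> c C b G"
    using green_operator_exists[OF \<open>C11_domain \<Omega>\<close> \<open>bounded \<Omega>\<close> s] by metis
  have C: "0 < C" using cC by simp
  define m\<^sub>0 where "m\<^sub>0 = (a * C) powr (- (1 / (1 - q)))"
  define m\<^sub>1 where "m\<^sub>1 = (a * c) powr (- (1 / (1 - q)))"
  have m0: "0 < m\<^sub>0" using a C by (simp add: m\<^sub>0_def)
  have m01: "m\<^sub>0 \<le> m\<^sub>1" unfolding m\<^sub>0_def m\<^sub>1_def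
    using a cC \<open>q < 1\<close> by (intro powr_mono2') auto
  have sub: "m\<^sub>0 powr q = a * C * m\<^sub>0" unfolding m\<^sub>0_def
    by (rule sublinear_fixed_point) (use a C \<open>q < 1\<close> in auto)
  have super: "m\<^sub>1 powr q = a * c * m\<^sub>1" unfolding m\<^sub>1_def
    by (rule sublinear_fixed_point) (use a cC \<open>q < 1\<close> in auto)
  obtain G where G: "green_operator s \<Omega> c C (m\<^sub>1 powr q) G" using green[of "m\<^sub>1 powr q"] by auto
  from green_iteration[OF op \<open>bounded \<Omega>\<close> fne G a C \<open>0 < q\<close> m0 m01 sub super cC(1) s]
  obtain v where v_all: "v \<in> borel_measurable ?M \<and> (\<forall>x. m\<^sub>0 \<le> v x \<and> v x \<le> m\<^sub>1) \<and>
    (\<forall>\<psi>. test_function \<Omega> \<psi> \<longrightarrow> a * (\<integral>x. v x * hypersingular s \<psi> x \<partial>?M)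
       = (\<integral>x. d x powr (-2 * s) * v x powr q * \<psi> x \<partial>?M))" unfolding d_def by (rule exE)
  note v_meas = v_all[THEN conjunct1]
  have v: "m\<^sub>0 \<le> v x" "v x \<le> m\<^sub>1" for x using v_all by simp_all
  note v_eq = v_all[THEN conjunct2, THEN conjunct2, THEN spec, THEN mp]
  define u where "u x = indicator \<Omega> x * v x" for x
  have u_in: "u x = v x" if "x \<in> \<Omega>" for x using that by (simp add: u_def)
  have u_meas[measurable]: "u \<in> borel_measurable borel"
    using v_meas op unfolding u_def[abs_def] by (subst (asm) borel_measurable_restrict_space_iff) auto
  have u_bounds: "0 \<le> u x" "u x \<le> m\<^sub>1" for x
    using v[of x] m0 by (auto simp: u_def indicator_def)
  have dist: "distributional_solution s \<Omega> (\<lambda>x. u x powr q / d x powr (2 * s)) u"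
    unfolding distributional_solution_def locally_integrable_def
  proof (intro conjI allI impI)
    fix K assume K: "compact K" "K \<subseteq> \<Omega>"
    obtain r where r: "0 < r" "\<And>x. x \<in> K \<Longrightarrow> r \<le> d x"
      using infdist_frontier_ge_on_compact[OF op K fne] unfolding d_def by blast
    have [measurable]: "K \<in> sets borel" using K(1) by (simp add: borel_compact)
    show "set_integrable lborel K (\<lambda>x. u x powr q / d x powr (2 * s))"
      unfolding set_integrable_def
    proof (rule Bochner_Integration.integrable_bound[where f = "\<lambda>x. (m\<^sub>1 powr q / r powr (2 * s)) * indicator K x"])
      show "integrable lborel (\<lambda>x. (m\<^sub>1 powr q / r powr (2 * s)) * indicator K x)"
        using emeasure_compact_finite[OF K(1)] by (intro integrable_mult_right integrable_real_indicator) auto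
      show "AE x in lborel. norm (indicator K x *\<^sub>R (u x powr q / d x powr (2 * s)))
          \<le> norm ((m\<^sub>1 powr q / r powr (2 * s)) * indicator K x)"
      proof (rule AE_I2)
        fix x
        show "norm (indicator K x *\<^sub>R (u x powr q / d x powr (2 * s))) \<le> norm ((m\<^sub>1 powr q / r powr (2 * s)) * indicator K x)"
        proof (cases "x \<in> K")
          case True
          have "u x powr q / d x powr (2 * s) \<le> m\<^sub>1 powr q / r powr (2 * s)"
            using u_bounds[of x] r(1) r(2)[OF True] \<open>0 < q\<close> s by (intro frac_le powr_mono2) auto
          then show ?thesis using True by simp
        qed simp
      qed
    qed measurable
  next
    show "set_integrable lborel \<Omega> u"
      unfolding set_integrable_def
    proof (rule Bochner_Integration.integrable_bound[where f = "\<lambda>x. m\<^sub>1 * indicator \<Omega> x"])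
      show "integrable lborel (\<lambda>x. m\<^sub>1 * indicator \<Omega> x)"
        using emeasure_bounded_finite[OF \<open>bounded \<Omega>\<close>] by (intro integrable_mult_right integrable_real_indicator) auto
      show "AE x in lborel. norm (indicator \<Omega> x *\<^sub>R u x) \<le> norm (m\<^sub>1 * indicator \<Omega> x)"
      proof (rule AE_I2)
        fix x
        have "\<bar>u x\<bar> \<le> \<bar>m\<^sub>1\<bar>" using u_bounds[of x] by linarith
        then show "norm (indicator \<Omega> x *\<^sub>R u x) \<le> norm (m\<^sub>1 * indicator \<Omega> x)" by (cases "x \<in> \<Omega>") auto
      qed
    qed measurable
  next
    fix x assume "x \<notin> \<Omega>" then show "u x = 0" by (simp add: u_def)
  next
    fix \<psi> assume \<psi>: "test_function \<Omega> \<psi>"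
    have fl: "frac_laplacian s \<psi> x = a * hypersingular s \<psi> x" for x
      unfolding frac_laplacian_def a_def pv_integral_eq_hypersingular[OF s test_function_bounded_smooth[OF \<psi>]] ..
    have "(LINT x:\<Omega>|lborel. u x * frac_laplacian s \<psi> x) = a * (\<integral>x. v x * hypersingular s \<psi> x \<partial>?M)"
      unfolding set_lebesgue_integral_def integral_restrict_lborel[OF op] integral_mult_right_zero[symmetric]
      by (intro Bochner_Integration.integral_cong refl) (auto simp: fl u_def indicator_def)
    also have "\<dots> = (\<integral>x. d x powr (-2 * s) * v x powr q * \<psi> x \<partial>?M)" by (rule v_eq[OF \<psi>])
    also have "\<dots> = (LINT x:\<Omega>|lborel. u x powr q / d x powr (2 * s) * \<psi> x)"
      unfolding set_lebesgue_integral_def integral_restrict_lborel[OF op]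
      by (intro Bochner_Integration.integral_cong refl) (auto simp: u_def indicator_def powr_minus divide_inverse)
    finally show "(LINT x:\<Omega>|lborel. u x * frac_laplacian s \<psi> x) = (LINT x:\<Omega>|lborel. u x powr q / d x powr (2 * s) * \<psi> x)" .
  qed
  obtain D where D: "\<And>x. x \<in> \<Omega> \<Longrightarrow> d x \<le> D"
    using infdist_frontier_bounded[OF \<open>bounded \<Omega>\<close> ne] unfolding d_def by blast
  \<comment> \<open>Since \<open>d \<le> D\<close> in \<open>\<Omega>\<close>, the constant lower bound \<open>m\<^sub>0\<close> dominates a multiple of \<open>d\<^sup>s\<close>.\<close>
  define E where "E = m\<^sub>0 / max D 1 powr s"
  have E: "0 < E" using m0 by (simp add: E_def)
  have "E * d x powr s \<le> u x" if "x \<in> \<Omega>" for x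
  proof -
    have "d x powr s \<le> max D 1 powr s" using D[OF that] s by (intro powr_mono2) (auto simp: d_def infdist_nonneg)
    then have "E * d x powr s \<le> E * max D 1 powr s" using E by (intro mult_left_mono) auto
    also have "\<dots> = m\<^sub>0" by (simp add: E_def)
    also have "\<dots> \<le> u x" using v(1)[of x] u_in[OF that] by simp
    finally show ?thesis .
  qed
  moreover have "0 < u x" if "x \<in> \<Omega>" for x using v(1)[of x] u_in[OF that] m0 by simp
  ultimately show ?thesis using dist E by blast
qed

end
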